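(* For any positive, locally bounded real-valued function $f$ defined in a neighborhood of $\infty$ there exists a finitely generated amenable group $\Gamma$ such that, near zero, $$N(\lambda)\preceq\frac{1}{f(\lambda^{-1})},$$ where $N$ is the spectral distribution of the Laplace operator of the uniform probability measure on a finite symmetric generating set $S$ of $\Gamma$.
   Context: A neighborhood of $\infty$ is an interval $(x_0,\infty)$; locally bounded means bounded on compact subsets of it. Spectral distribution: for the uniform probability measure $\mu=\frac1{|S|}\sum_{s\in S}\delta_s$, let $R_\mu:l^2(\Gamma)\to l^2(\Gamma)$, $R_\mu(h)(x)=\sum_{\gamma}h(x\gamma^{-1})\mu(\gamma)$, and $\Delta=\mathrm{id}-R_\mu$. Then $N(\lambda)=\langle\chi_{(-\infty,\lambda]}(\Delta)\delta_e,\delta_e\rangle_{l^2(\Gamma)}$ for $\lambda\ge0$. Asymptotic comparison: $h\preceq g$ near zero means there are $C,D,\epsilon>0$ with $h(\lambda)\le Cg(D\lambda)$ for all $\lambda\in[0,\epsilon)$; an expression defined only for small $\lambda>0$ (such as $1/f(\lambda^{-1})$) is given the value $0$ at $\lambda=0$. *)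

theory Defs
  imports "HOL-Probability.Probability" "HOL-Algebra.Generated_Groups"
begin

definition finitely_generated :: "('a, 'b) monoid_scheme \<Rightarrow> bool" where
  "finitely_generated G \<longleftrightarrow>
     (\<exists>S. finite S \<and> S \<subseteq> carrier G \<and> generate G S = carrier G)"

text \<open>Amenability of a discrete group: there is a left-invariant finitely additive probability
  measure defined on all subsets.\<close>

definition amenable :: "('a, 'b) monoid_scheme \<Rightarrow> bool" where
  "amenable G \<longleftrightarrow>
     (\<exists>m :: 'a set \<Rightarrow> real.
        m (carrier G) = 1 \<and>
        (\<forall>A. A \<subseteq> carrier G \<longrightarrow> 0 \<le> m A) \<and>
        (\<forall>A B. A \<subseteq> carrier G \<longrightarrow> B \<subseteq> carrier G \<longrightarrow> A \<inter> B = {} \<longrightarrow>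
            m (A \<union> B) = m A + m B) \<and>
        (\<forall>g A. g \<in> carrier G \<longrightarrow> A \<subseteq> carrier G \<longrightarrow> m (g <#\<^bsub>G\<^esub> A) = m A))"

definition symmetric_generating_set :: "('a, 'b) monoid_scheme \<Rightarrow> 'a set \<Rightarrow> bool" where
  "symmetric_generating_set G S \<longleftrightarrow>
     S \<subseteq> carrier G \<and> (\<forall>s\<in>S. inv\<^bsub>G\<^esub> s \<in> S) \<and> generate G S = carrier G"

text \<open>The Hilbert space of square-summable complex functions on \<open>X\<close>. Functions on \<open>X\<close> are
  represented by functions on the whole type that vanish outside \<open>X\<close>.\<close>

definition ell2 :: "'a set \<Rightarrow> ('a \<Rightarrow> complex) set" where
  "ell2 X = {h. (\<forall>x. x \<notin> X \<longrightarrow> h x = 0) \<and> (\<lambda>x. (cmod (h x))\<^sup>2) summable_on X}"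

definition ell2_inner :: "'a set \<Rightarrow> ('a \<Rightarrow> complex) \<Rightarrow> ('a \<Rightarrow> complex) \<Rightarrow> complex" where
  "ell2_inner X g h = (\<Sum>\<^sub>\<infinity>x\<in>X. g x * cnj (h x))"

definition ell2_norm :: "'a set \<Rightarrow> ('a \<Rightarrow> complex) \<Rightarrow> real" where
  "ell2_norm X h = sqrt (\<Sum>\<^sub>\<infinity>x\<in>X. (cmod (h x))\<^sup>2)"

definition point_mass :: "'a \<Rightarrow> 'a \<Rightarrow> complex" where
  "point_mass a x = (if x = a then 1 else 0)"

text \<open>Linearity and boundedness need not be demanded: they follow from the symmetry condition,
  which ranges over the whole space, and from idempotency.\<close>

definition ell2_projection :: "'a set \<Rightarrow> (('a \<Rightarrow> complex) \<Rightarrow> 'a \<Rightarrow> complex) \<Rightarrow> bool" where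
  "ell2_projection X P \<longleftrightarrow>
     (\<forall>h\<in>ell2 X. P h \<in> ell2 X \<and> P (P h) = P h) \<and>
     (\<forall>g\<in>ell2 X. \<forall>h\<in>ell2 X. ell2_inner X (P g) h = ell2_inner X g (P h))"

text \<open>The scalar measure \<open>B \<mapsto> \<langle>E(B) h, h\<rangle>\<close>.\<close>

definition scalar_spectral_measure ::
    "'a set \<Rightarrow> (real set \<Rightarrow> ('a \<Rightarrow> complex) \<Rightarrow> 'a \<Rightarrow> complex) \<Rightarrow> ('a \<Rightarrow> complex) \<Rightarrow> real measure"
  where
  "scalar_spectral_measure X E h =
     measure_of UNIV (sets borel) (\<lambda>B. ennreal (Re (ell2_inner X (E B h) h)))"

text \<open>\<open>E\<close> is the projection-valued spectral measure of the bounded self-adjoint operator \<open>T\<close> on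
  the space of square-summable functions on \<open>X\<close>, that is, \<open>T = \<integral> t dE(t)\<close>: it takes projections
  as values, has bounded support and total mass the identity, is multiplicative and strongly
  countably additive, and represents the quadratic form of \<open>T\<close> (which determines \<open>T\<close>, as the
  scalars are complex).\<close>

definition is_spectral_measure ::
    "'a set \<Rightarrow> (('a \<Rightarrow> complex) \<Rightarrow> 'a \<Rightarrow> complex) \<Rightarrow>
      (real set \<Rightarrow> ('a \<Rightarrow> complex) \<Rightarrow> 'a \<Rightarrow> complex) \<Rightarrow> bool" where
  "is_spectral_measure X T E \<longleftrightarrow>
     (\<forall>B\<in>sets borel. ell2_projection X (E B)) \<and>
     (\<exists>a>0. \<forall>h\<in>ell2 X. E {-a<..<a} h = h) \<and>
     (\<forall>A\<in>sets borel. \<forall>B\<in>sets borel. \<forall>h\<in>ell2 X. E (A \<inter> B) h = E A (E B h)) \<and>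
     (\<forall>B :: nat \<Rightarrow> real set. range B \<subseteq> sets borel \<longrightarrow> disjoint_family B \<longrightarrow>
        (\<forall>h\<in>ell2 X.
           (\<lambda>n. ell2_norm X (\<lambda>x. E (\<Union>i. B i) h x - (\<Sum>i<n. E (B i) h x)))
             \<longlonglongrightarrow> 0)) \<and>
     (\<forall>h\<in>ell2 X.
        integrable (scalar_spectral_measure X E h) (\<lambda>t. t) \<and>
        ell2_inner X (T h) h = complex_of_real (\<integral>t. t \<partial>scalar_spectral_measure X E h))"

text \<open>The operator \<open>\<chi>\<^sub>B(T) = E(B)\<close>. By the spectral theorem \<open>E\<close> exists for every bounded
  self-adjoint \<open>T\<close>, and it is unique on Borel sets and on square-summable functions; the choice
  operator only leaves its irrelevant values elsewhere unspecified.\<close>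

definition spectral_projection ::
    "'a set \<Rightarrow> (('a \<Rightarrow> complex) \<Rightarrow> 'a \<Rightarrow> complex) \<Rightarrow> real set \<Rightarrow> ('a \<Rightarrow> complex) \<Rightarrow> 'a \<Rightarrow> complex"
  where
  "spectral_projection X T = (SOME E. is_spectral_measure X T E)"

definition right_convolution ::
    "('a, 'b) monoid_scheme \<Rightarrow> 'a pmf \<Rightarrow> ('a \<Rightarrow> complex) \<Rightarrow> 'a \<Rightarrow> complex" where
  "right_convolution G \<mu> h x =
     (if x \<in> carrier G
      then \<Sum>\<^sub>\<infinity>\<gamma>\<in>carrier G. h (x \<otimes>\<^bsub>G\<^esub> inv\<^bsub>G\<^esub> \<gamma>) * complex_of_real (pmf \<mu> \<gamma>)
      else 0)"

definition laplacian ::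
    "('a, 'b) monoid_scheme \<Rightarrow> 'a pmf \<Rightarrow> ('a \<Rightarrow> complex) \<Rightarrow> 'a \<Rightarrow> complex" where
  "laplacian G \<mu> h x = h x - right_convolution G \<mu> h x"

text \<open>The inner product is real, \<open>spectral_projection\<close> being an orthogonal projection.\<close>

definition spectral_distribution :: "('a, 'b) monoid_scheme \<Rightarrow> 'a pmf \<Rightarrow> real \<Rightarrow> real" where
  "spectral_distribution G \<mu> l =
     Re (ell2_inner (carrier G)
           (spectral_projection (carrier G) (laplacian G \<mu>) {..l} (point_mass \<one>\<^bsub>G\<^esub>))
           (point_mass \<one>\<^bsub>G\<^esub>))"

text \<open>If \<open>g\<close> is meaningful only near zero this is still the intended relation, because
  \<open>\<epsilon>\<close> may always be decreased.\<close>

definition preceq_near_zero :: "(real \<Rightarrow> real) \<Rightarrow> (real \<Rightarrow> real) \<Rightarrow> bool" where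
  "preceq_near_zero h g \<longleftrightarrow>
     (\<exists>C D \<epsilon>. C > 0 \<and> D > 0 \<and> \<epsilon> > 0 \<and> (\<forall>l\<in>{0..<\<epsilon>}. h l \<le> C * g (D * l)))"

end

theory Submission
  imports Defs "HOL-Computational_Algebra.Polynomial" "HOL-Real_Asymp.Real_Asymp"
begin

text \<open>
Write \<open>\<Delta>\<close> for the Laplacian of \<open>S\<close> and \<open>\<tau>(X) = \<langle>X\<delta>, \<delta>\<rangle>\<close> for the trace. Spectral calculus gives
\<open>(1 - l/2)^n N(l) \<le> \<tau>((1 - \<Delta>/2)^n)\<close>. If \<open>M\<close> is the average over four involutions of bounded word
length with respect to \<open>S\<close>, then \<open>\<Delta> \<ge> \<kappa>(1 - M)\<close> for some \<open>\<kappa> > 0\<close> that depends only on these lengths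
and on the size of \<open>S\<close>. The trace of an odd power is monotone, so
\<open>\<tau>((1 - \<Delta>/2)^n) \<le> \<tau>((1 - \<kappa>(1 - M)/2)^n)\<close> for odd \<open>n\<close>. If the four involutions satisfy no relation
of length at most \<open>n\<close> beyond those of the free product of four groups of order two, then the
right-hand side decays exponentially in \<open>n\<close>, as it does on the four-regular tree.

The group is generated by the shift \<open>t\<close> of \<open>\<int> \<times> W\<close> in the first coordinate, \<open>W\<close> being the set of words
over four letters, and an involution \<open>u\<close> that moves only the fibres over powers of two. Over
\<open>2^(4n+i)\<close>, \<open>i < 4\<close>, it acts as the \<open>i\<close>-th generator of the free product on the ball of radius \<open>R n\<close>.
The conjugates of \<open>u\<close> by the powers \<open>t^(2^(4n+i))\<close> then act on the fibre over \<open>0\<close> without relations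
of length at most \<open>R n\<close>, while their word length does not depend on \<open>R\<close>. Since \<open>R\<close> may grow as fast
as desired, so may \<open>1/N(1/x)\<close>. The powers of two are so sparse that finitely many conjugates of \<open>u\<close>
by powers of \<open>t\<close> generate a finite group, which makes the group amenable.

The function \<open>N\<close> refers to a spectral measure given by a choice operator, so that its existence has
to be proved. For an operator \<open>A\<close> with \<open>0 \<le> A \<le> 1\<close>, the Bernstein polynomials of \<open>A\<close> are positive
operators and define discrete measures; by Helly's theorem these have a limit with moments
\<open>\<langle>A^j h, h\<rangle>\<close>, and \<open>E(B) h\<close> is the limit of \<open>q(A) h\<close> for polynomials \<open>q\<close> that tend to the indicator
function of \<open>B\<close> in \<open>L\<^sup>2\<close>.
\<close>

section \<open>The spectral theorem for positive contractions\<close>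

locale positive_contraction =
  fixes A :: "'h::{real_inner,complete_space} \<Rightarrow> 'h"
  assumes bounded_linear_A: "bounded_linear A"
    and symmetric: "inner (A x) y = inner x (A y)"
    and nonneg: "0 \<le> inner (A x) x"
    and contractive: "inner (A x) x \<le> inner x x"
begin

section \<open>Polynomials in \<open>A\<close> and positivity of the Bernstein polynomials\<close>

interpretation A: bounded_linear A by (rule bounded_linear_A)

text \<open>p(A) h by Horner's scheme, so that proofs go by induction over
  \<open>pCons\<close>.\<close>

definition pcalc :: "real poly \<Rightarrow> 'h \<Rightarrow> 'h" where
  "pcalc p h = fold_coeffs (\<lambda>a v. a *\<^sub>R h + A v) p 0"

lemma pcalc_0 [simp]: "pcalc 0 h = 0"
  by (simp add: pcalc_def)

lemma pcalc_pCons [simp]: "pcalc (pCons a p) h = a *\<^sub>R h + A (pcalc p h)"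
  by (cases "p = 0 \<and> a = 0") (auto simp: pcalc_def A.zero)

lemma pcalc_1 [simp]: "pcalc 1 h = h"
  by (simp add: one_pCons A.zero)

lemma pcalc_X [simp]: "pcalc [:0, 1:] h = A h"
  by (simp add: A.zero)

lemma pcalc_add: "pcalc (p + q) h = pcalc p h + pcalc q h"
proof (induction p arbitrary: q)
  case 0 then show ?case by simp
next
  case (pCons a p)
  show ?case by (cases q) (simp add: pCons.IH A.add scaleR_add_left)
qed

lemma pcalc_smult: "pcalc (smult c p) h = c *\<^sub>R pcalc p h"
  by (induction p) (simp_all add: A.scaleR scaleR_add_right)

lemma pcalc_minus: "pcalc (- p) h = - pcalc p h"
  using pcalc_smult[of "-1" p h] by simp

lemma pcalc_diff: "pcalc (p - q) h = pcalc p h - pcalc q h"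
  using pcalc_add[of p "- q" h] by (simp add: pcalc_minus)

lemma pcalc_sum: "pcalc (\<Sum>i\<in>I. p i) h = (\<Sum>i\<in>I. pcalc (p i) h)"
  by (induction I rule: infinite_finite_induct) (simp_all add: pcalc_add)

lemma bounded_linear_pcalc: "bounded_linear (pcalc p)"
proof (induction p)
  case 0 then show ?case by (simp add: pcalc_0[abs_def] bounded_linear_zero)
next
  case (pCons a p)
  have "bounded_linear (\<lambda>h. a *\<^sub>R h + A (pcalc p h))"
    by (intro bounded_linear_add bounded_linear_scaleR_right
        bounded_linear_compose[OF bounded_linear_A] pCons)
  moreover have "pcalc (pCons a p) = (\<lambda>h. a *\<^sub>R h + A (pcalc p h))"
    by (rule ext) simp
  ultimately show ?case by simp
qed

lemma pcalc_linear:
  "pcalc p (g + h) = pcalc p g + pcalc p h" "pcalc p (c *\<^sub>R h) = c *\<^sub>R pcalc p h"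
  using bounded_linear_pcalc[THEN bounded_linear.linear]
  by (simp_all add: linear_add linear_scale)

lemma pcalc_commute: "pcalc p (A h) = A (pcalc p h)"
  by (induction p) (simp_all add: A.add A.scaleR A.zero)

lemma pcalc_mult: "pcalc (p * q) h = pcalc p (pcalc q h)"
  by (induction p) (simp_all add: mult_pCons_left pcalc_add pcalc_smult)

lemma pcalc_symmetric: "inner (pcalc p g) h = inner g (pcalc p h)"
  by (induction p arbitrary: h) (simp_all add: inner_add_left inner_add_right symmetric pcalc_commute)

lemma pcalc_square: "inner (pcalc (q * q) h) h = (norm (pcalc q h))\<^sup>2"
  by (simp add: pcalc_mult pcalc_symmetric power2_norm_eq_inner)

definition bern :: "nat \<Rightarrow> nat \<Rightarrow> real poly" where
  "bern n k = smult (real (n choose k)) ([:0, 1:] ^ k * [:1, - 1:] ^ (n - k))"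

text \<open>Splitting off the square of \<open>q\<close> leaves one of the factors 1, x, 1 - x, x (1
  - x). For x positivity is \<open>nonneg\<close>, for 1 - x it is
  \<open>contractive\<close>.\<close>

lemma pcalc_nonneg: "0 \<le> inner (pcalc ([:0, 1:] ^ k * [:1, - 1:] ^ l) h) h"
proof -
  let ?x = "[:0, 1:] :: real poly" and ?y = "[:1, - 1:] :: real poly"
  define q where "q = ?x ^ (k div 2) * ?y ^ (l div 2)"
  have y: "?y = 1 - ?x" by (simp add: one_pCons)
  have X: "0 \<le> inner (pcalc (?x * (r * r)) h) h" for r
    by (simp only: pcalc_mult pcalc_X) (simp add: pcalc_commute[symmetric] pcalc_symmetric, metis nonneg
        pcalc_commute pcalc_symmetric)
  have Y: "0 \<le> inner (pcalc (?y * (r * r)) h) h" for r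
  proof -
    have "inner (pcalc (?y * (r * r)) h) h = inner (pcalc r h) (pcalc r h) - inner (A (pcalc r h))
        (pcalc r h)"
      unfolding y left_diff_distrib
      by (simp add: pcalc_diff inner_diff_left pcalc_mult pcalc_symmetric pcalc_commute del: mult_pCons_left)
         (metis pcalc_commute pcalc_symmetric)
    then show ?thesis using contractive[of "pcalc r h"] by simp
  qed
  have XY: "0 \<le> inner (pcalc (?x * ?y * (r * r)) h) h" for r
  proof -
    \<comment> \<open>Because x + (1 - x) = 1, the mixed factor is a sum of x and 1 - x with square
      coefficients.\<close>
    have "?x * ?y = ?x * (?y * ?y) + ?y * (?x * ?x)" by (simp add: one_pCons)
    then have "?x * ?y * (r * r) = ?x * ((?y * r) * (?y * r)) + ?y * ((?x * r) * (?x * r))"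
      by (simp only: distrib_right) (simp only: mult.assoc mult.left_commute)
    then show ?thesis using X[of "?y * r"] Y[of "?x * r"]
      by (simp add: pcalc_add inner_add_left del: mult_pCons_left mult_pCons_right)
  qed
  have ex: "?x ^ k = (if odd k then ?x else 1) * (?x ^ (k div 2) * ?x ^ (k div 2))"
    by (simp add: mult_2[symmetric] power_add[symmetric] power_Suc[symmetric] del: power_Suc mult_pCons_left
        mult_pCons_right)
  have ey: "?y ^ l = (if odd l then ?y else 1) * (?y ^ (l div 2) * ?y ^ (l div 2))"
    by (simp add: mult_2[symmetric] power_add[symmetric] power_Suc[symmetric] del: power_Suc mult_pCons_left
        mult_pCons_right)
  have "?x ^ k * ?y ^ l = ((if odd k then ?x else 1) * (if odd l then ?y else 1)) * (q * q)"
    unfolding q_def by (subst ex, subst ey) (simp only: mult.assoc mult.left_commute)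
  then show ?thesis
    using X[of q] Y[of q] XY[of q] pcalc_square[of q h]
    by (auto split: if_splits simp del: mult_pCons_left mult_pCons_right)
qed

lemma smult_sum_right: "smult c (\<Sum>i\<in>I. f i) = (\<Sum>i\<in>I. smult c (f i :: real poly))"
  by (induction I rule: infinite_finite_induct) (simp_all add: smult_add_right)

text \<open>The factorial moments of the Bernstein weights are exact: with \<open>k choose j\<close>
  in place of a power of k/n no error term arises. After exchanging the binomial coefficients the
  sum is the binomial theorem for x + (1 - x).\<close>

lemma sum_choose_bern:
  assumes "j \<le> n"
  shows "(\<Sum>k\<le>n. smult (real (k choose j)) (bern n k)) = smult (real (n choose j)) ([:0, 1:] ^ j)"
proof -
  let ?x = "[:0, 1:] :: real poly" and ?y = "[:1, - 1:] :: real poly"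
  have "(\<Sum>k\<le>n. smult (real (k choose j)) (bern n k)) =
        (\<Sum>k\<in>{j..n}. smult (real (k choose j)) (bern n k))"
    by (intro sum.mono_neutral_right) (auto simp: binomial_eq_0)
  also have "\<dots> = (\<Sum>k\<in>{j..n}. smult (real (n choose j)) (?x ^ j *
        (of_nat (n - j choose (k - j)) * ?x ^ (k - j) * ?y ^ ((n - j) - (k - j)))))"
  proof (rule sum.cong[OF refl])
    fix k assume k: "k \<in> {j..n}"
    then have "real (k choose j) * real (n choose k) = real (n choose j) * real (n - j choose (k - j))"
      using choose_mult[of j k n] by (metis atLeastAtMost_iff mult.commute of_nat_mult)
    moreover have "?x ^ k = ?x ^ j * ?x ^ (k - j)" "n - k = (n - j) - (k - j)"
      using k by (simp_all add: power_add[symmetric] del: mult_pCons_left mult_pCons_right)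
    ultimately show "smult (real (k choose j)) (bern n k) = smult (real (n choose j)) (?x ^ j *
        (of_nat (n - j choose (k - j)) * ?x ^ (k - j) * ?y ^ ((n - j) - (k - j))))"
      by (simp add: bern_def of_nat_poly mult.assoc del: mult_pCons_right)
  qed
  also have "\<dots> = smult (real (n choose j)) (?x ^ j * (\<Sum>k\<in>{j..n}.
        (of_nat (n - j choose (k - j)) * ?x ^ (k - j) * ?y ^ ((n - j) - (k - j)))))"
    by (simp only: sum_distrib_left smult_sum_right)
  also have "(\<Sum>k\<in>{j..n}. (of_nat (n - j choose (k - j)) * ?x ^ (k - j) * ?y ^ ((n - j) - (k - j))))
     = (\<Sum>k\<le>n - j. of_nat (n - j choose k) * ?x ^ k * ?y ^ ((n - j) - k))"
    using assms by (intro sum.reindex_bij_witness[of _ "\<lambda>k. k + j" "\<lambda>k. k - j"]) auto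
  also have "\<dots> = (?x + ?y) ^ (n - j)"
    by (rule binomial_ring[symmetric])
  also have "?x + ?y = 1" by (simp add: one_pCons)
  finally show ?thesis by simp
qed

end

text \<open>Both terms are products of j factors in [-1, 1], namely (k - i)/(n - i) against k/n, and
  matching factors differ by at most j/(n - j). This turns factorial moments into power moments of
  the points k/n.\<close>

lemma choose_ratio_tendsto:
  "(\<lambda>n. SUP k\<in>{..n}. \<bar>real (k choose j) / real (n choose j) - (real k / real n) ^ j\<bar>) \<longlonglongrightarrow> 0"
proof (rule tendsto_sandwich)
  have bound: "\<bar>real (k choose j) / real (n choose j) - (real k / real n) ^ j\<bar>
      \<le> real j * (real j / (real n - real j))"
    if n: "n \<ge> 2 * j + 1" and k: "k \<le> n" for n k
  proof -
    have ge: "real n - real i \<ge> real j + 1" "real n - real i \<ge> real n - real j" if "i < j" for i 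
      using that n by linarith+
    have fac: "real (a choose j) = (\<Prod>i<j. real a - real i) / fact j" for a
      by (simp add: binomial_gbinomial gbinomial_prod_rev atLeast0LessThan)
    have "real (k choose j) / real (n choose j) = (\<Prod>i<j. (real k - real i) / (real n - real i))"
      by (simp add: fac prod_dividef)
    moreover have "norm ((\<Prod>i<j. (real k - real i) / (real n - real i)) - (\<Prod>i<j. real k / real n))
        \<le> (\<Sum>i<j. norm ((real k - real i) / (real n - real i) - real k / real n))"
    proof (rule norm_prod_diff)
      fix i assume "i \<in> {..<j}"
      then have i: "i < j" by simp
      \<comment> \<open>For k < i the numerator is negative; then i - k \<le> i \<le> n - i because
        n exceeds 2 j.\<close>
      have "\<bar>real k - real i\<bar> \<le> real n - real i"
        using n k i by linarith
      then show "norm ((real k - real i) / (real n - real i)) \<le> 1"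
        using ge[OF i] by (simp add: abs_divide)
      show "norm (real k / real n) \<le> 1" using k by (auto simp: divide_le_eq_1)
    qed
    moreover have "norm ((real k - real i) / (real n - real i) - real k / real n)
        \<le> real j / (real n - real j)"
      if i: "i < j" for i
    proof -
      have n0: "real n > 0" "real n - real i > 0" using ge[OF i] n by auto
      have "(real k - real i) / (real n - real i) - real k / real n
          = - (real i * ((real n - real k) / real n) / (real n - real i))"
        using n0 by (simp add: field_simps)
      also have "norm \<dots> = real i * ((real n - real k) / real n) / (real n - real i)"
        using n0 k by simp
      also have "\<dots> \<le> real i * 1 / (real n - real i)"
        using n0 k by (intro divide_right_mono mult_left_mono) (auto simp: divide_le_eq_1)
      also have "\<dots> \<le> real j / (real n - real j)"
        using i ge[OF i] n by (intro frac_le) auto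
      finally show ?thesis .
    qed
    then have "(\<Sum>i<j. norm ((real k - real i) / (real n - real i) - real k / real n))
        \<le> real j * (real j / (real n - real j))"
      using sum_bounded_above[of "{..<j}" "\<lambda>i. norm ((real k - real i) / (real n - real i) - real k / real n)"
          "real j / (real n - real j)"]
      by auto
    ultimately show ?thesis by simp
  qed
  show "\<forall>\<^sub>F n in sequentially. (SUP k\<in>{..n}. \<bar>real (k choose j) / real (n choose j) - (real k / real n) ^ j\<bar>)
      \<le> real j * (real j / (real n - real j))"
    using eventually_ge_at_top[of "2 * j + 1"]
    by eventually_elim (rule cSUP_least, simp, rule bound, simp_all)
  show "\<forall>\<^sub>F n in sequentially. 0 \<le> (SUP k\<in>{..n}. \<bar>real (k choose j) / real (n choose j) - (real k / real n) ^
      j\<bar>)"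
    by (intro always_eventually allI cSUP_upper2[where x = "0::nat"]) auto
  show "(\<lambda>n. real j * (real j / (real n - real j))) \<longlonglongrightarrow> 0"
    by real_asymp
qed simp

section \<open>Measures on the unit interval and mean-square approximation of indicator functions by
  polynomials\<close>

locale unit_interval_measure = finite_measure M for M :: "real measure" +
  assumes sets_M [measurable_cong, simp]: "sets M = sets borel"
    and AE_unit: "AE t in M. t \<in> {0..1}"
begin

lemma space_M [simp]: "space M = UNIV"
  using sets_M[THEN sets_eq_imp_space_eq] by simp

lemma integrable_bounded:
  assumes "f \<in> borel_measurable borel" "\<And>t. t \<in> {0..1} \<Longrightarrow> \<bar>f t\<bar> \<le> (B::real)"
  shows "integrable M f"
proof (rule integrable_const_bound[where B = B])
  show "AE t in M. norm (f t) \<le> B" using AE_unit by eventually_elim (use assms in auto)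
qed (use assms in simp)

end

lemma poly_bounded_unit: "\<exists>B\<ge>0. \<forall>t\<in>{0..1}. \<bar>poly p (t::real)\<bar> \<le> B"
proof -
  have "compact (poly p ` {0..1})"
    by (intro compact_continuous_image continuous_intros) simp
  then obtain B where "\<forall>x\<in>poly p ` {0..1}. norm x \<le> B"
    using compact_imp_bounded bounded_iff by blast
  then show ?thesis by (intro exI[of _ "max 0 B"]) (auto simp: le_max_iff_disj)
qed

lemma poly_borel_measurable [measurable]: "poly p \<in> borel_measurable (borel :: real measure)"
  by (intro borel_measurable_continuous_onI continuous_intros)

text \<open>The bound is asked only on the unit interval, which carries the measures, so that
  polynomials qualify.\<close>

definition unit_bounded :: "(real \<Rightarrow> real) \<Rightarrow> bool" where
  "unit_bounded f \<longleftrightarrow> f \<in> borel_measurable borel \<and> bounded (f ` {0..1})"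

lemma unit_bounded_poly: "unit_bounded (poly p)"
  using poly_bounded_unit[of p] by (auto simp: unit_bounded_def bounded_iff)

lemma unit_bounded_indicator: "B \<in> sets borel \<Longrightarrow> unit_bounded (indicator B)"
  by (auto simp: unit_bounded_def bounded_iff indicator_def intro!: exI[of _ 1])

lemma unit_bounded_diff: "unit_bounded f \<Longrightarrow> unit_bounded g \<Longrightarrow> unit_bounded (\<lambda>t. f t - g t)"
  by (auto simp: unit_bounded_def intro: bounded_minus_comp)

lemmas unit_bounded_intros = unit_bounded_poly unit_bounded_indicator unit_bounded_diff

definition sqdist :: "real measure \<Rightarrow> real set \<Rightarrow> real poly \<Rightarrow> real" where
  "sqdist M B p = (\<integral>t. (indicator B t - poly p t)\<^sup>2 \<partial>M)"

lemma cts_step_bounds: "a < b \<Longrightarrow> 0 \<le> cts_step a b t \<and> cts_step a b t \<le> 1"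
  by (auto simp: cts_step_def divide_le_eq_1)

lemma sqdist_nonneg: "0 \<le> sqdist M B p"
  by (simp add: sqdist_def)

context unit_interval_measure
begin

lemma integrable_unit_bounded:
  assumes "unit_bounded f"
  shows "integrable M f" "integrable M (\<lambda>t. (f t)\<^sup>2)"
proof -
  have m[measurable]: "f \<in> borel_measurable borel" using assms by (simp add: unit_bounded_def)
  obtain K where K: "\<And>t. t \<in> {0..1} \<Longrightarrow> \<bar>f t\<bar> \<le> K"
    using assms by (force simp: unit_bounded_def bounded_iff)
  then show "integrable M f" by (intro integrable_bounded m)
  show "integrable M (\<lambda>t. (f t)\<^sup>2)"
  proof (rule integrable_bounded)
    fix t :: real assume "t \<in> {0..1}"
    from power_mono[OF K[OF this], of 2] show "\<bar>(f t)\<^sup>2\<bar> \<le> K\<^sup>2" by simp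
  qed simp
qed

lemma integrable_poly: "integrable M (poly p)"
  by (intro integrable_unit_bounded unit_bounded_intros)

text \<open>Pointwise (a + b)^2 \<le> 2 a^2 + 2 b^2. The triangle, sum, product and uniform
  estimates for \<open>sqdist\<close> below are instances.\<close>

lemma integral_square_le:
  assumes f: "unit_bounded f" and g: "unit_bounded g" and h: "unit_bounded h"
    and le: "\<And>t. t \<in> {0..1} \<Longrightarrow> \<bar>h t\<bar> \<le> \<bar>f t\<bar> + K * \<bar>g t\<bar>"
  shows "(\<integral>t. (h t)\<^sup>2 \<partial>M) \<le> 2 * (\<integral>t. (f t)\<^sup>2 \<partial>M) + 2 * K\<^sup>2 * (\<integral>t. (g t)\<^sup>2 \<partial>M)"
proof -
  note int = integrable_unit_bounded(2)[OF f] integrable_unit_bounded(2)[OF g]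
  have "(\<integral>t. (h t)\<^sup>2 \<partial>M) \<le> (\<integral>t. 2 * (f t)\<^sup>2 + 2 * K\<^sup>2 * (g t)\<^sup>2 \<partial>M)"
  proof (rule integral_mono_AE)
    show "AE t in M. (h t)\<^sup>2 \<le> 2 * (f t)\<^sup>2 + 2 * K\<^sup>2 * (g t)\<^sup>2"
      using AE_unit
    proof eventually_elim
      case (elim t)
      have "(h t)\<^sup>2 \<le> (\<bar>f t\<bar> + K * \<bar>g t\<bar>)\<^sup>2" using power_mono[OF le[OF elim], of 2] by simp
      also have "\<dots> \<le> 2 * \<bar>f t\<bar>\<^sup>2 + 2 * (K * \<bar>g t\<bar>)\<^sup>2"
        using zero_le_power2[of "\<bar>f t\<bar> - K * \<bar>g t\<bar>"] unfolding power2_diff power2_sum by linarith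
      finally show ?case by (simp add: power_mult_distrib)
    qed
  qed (use int integrable_unit_bounded(2)[OF h] in auto)
  also have "\<dots> = 2 * (\<integral>t. (f t)\<^sup>2 \<partial>M) + 2 * K\<^sup>2 * (\<integral>t. (g t)\<^sup>2 \<partial>M)"
    using int by simp
  finally show ?thesis .
qed

lemma sqdist_eq_0:
  assumes [measurable]: "B \<in> sets borel" and B: "{0..1} \<subseteq> B"
  shows "sqdist M B 1 = 0"
proof -
  have "sqdist M B 1 = (\<integral>t. 0 \<partial>M)"
    unfolding sqdist_def
  proof (rule integral_cong_AE)
    show "AE t in M. (indicator B t - poly 1 t)\<^sup>2 = (0::real)"
      using AE_unit by eventually_elim (use B in \<open>auto simp: indicator_def\<close>)
  qed simp_all
  then show ?thesis by simp
qed

text \<open>Cauchy-Schwarz against the constant function 1, obtained by expanding the variance about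
  the mean \<open>c\<close>.\<close>

lemma square_integral_le:
  assumes "integrable M f" "integrable M (\<lambda>t. (f t)\<^sup>2)"
  shows "(\<integral>t. f t \<partial>M)\<^sup>2 \<le> measure M UNIV * (\<integral>t. (f t)\<^sup>2 \<partial>M)"
proof (cases "measure M UNIV = 0")
  case True
  then have "AE t in M. False"
    by (intro AE_I[of _ _ UNIV]) (simp_all add: emeasure_eq_measure)
  then have "(\<integral>t. f t \<partial>M) = (\<integral>t. 0 \<partial>M)"
    by (intro integral_cong_AE) (use assms in auto)
  then show ?thesis by (simp add: True)
next
  case False
  then have m: "measure M UNIV > 0" by (simp add: zero_less_measure_iff)
  define b where "b = (\<integral>t. f t \<partial>M)"
  define c where "c = b / measure M UNIV"
  have "0 \<le> (\<integral>t. (f t - c)\<^sup>2 \<partial>M)" by simp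
  also have "\<dots> = (\<integral>t. (f t)\<^sup>2 - 2 * c * f t + c\<^sup>2 \<partial>M)"
    by (simp add: power2_diff algebra_simps)
  also have "\<dots> = (\<integral>t. (f t)\<^sup>2 \<partial>M) - 2 * c * b + c\<^sup>2 * measure M UNIV"
    using assms by (simp add: b_def)
  also have "\<dots> = (\<integral>t. (f t)\<^sup>2 \<partial>M) - b\<^sup>2 / measure M UNIV"
    using m by (simp add: c_def field_simps power2_eq_square)
  finally show ?thesis using m by (simp add: b_def[symmetric] field_simps)
qed

lemma integral_poly_diff:
  assumes B: "B \<in> sets borel"
  shows "((\<integral>t. poly p t \<partial>M) - measure M B)\<^sup>2 \<le> measure M UNIV * sqdist M B p"
proof -
  have ub: "unit_bounded (\<lambda>t. indicator B t - poly p t)" by (intro unit_bounded_intros B)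
  have "(\<integral>t. indicator B t - poly p t \<partial>M)\<^sup>2 \<le> measure M UNIV * sqdist M B p"
    unfolding sqdist_def by (intro square_integral_le integrable_unit_bounded ub)
  moreover have "(\<integral>t. indicator B t - poly p t \<partial>M) = measure M B - (\<integral>t. poly p t \<partial>M)"
    using integrable_unit_bounded(1)[OF unit_bounded_indicator[OF B]] integrable_poly[of p] B by simp
  ultimately show ?thesis by (simp add: power2_commute)
qed

lemma sqdist_triangle:
  assumes B: "B \<in> sets borel" and C: "C \<in> sets borel" and "C \<subseteq> B"
  shows "sqdist M B p \<le> 2 * measure M (B - C) + 2 * sqdist M C p"
proof -
  have "sqdist M B p \<le> 2 * (\<integral>t. (indicator B t - indicator C t)\<^sup>2 \<partial>M) + 2 * 1\<^sup>2 * sqdist M C p"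
    unfolding sqdist_def by (rule integral_square_le) (auto intro!: unit_bounded_intros B C)
  moreover have "(\<lambda>t. (indicator B t - indicator C t)\<^sup>2) = indicat_real (B - C)"
    using assms(3) by (intro ext) (auto simp: indicator_def)
  ultimately show ?thesis using B C by simp
qed

lemma sqdist_add:
  assumes B: "B \<in> sets borel" and C: "C \<in> sets borel" and "B \<inter> C = {}"
  shows "sqdist M (B \<union> C) (p + q) \<le> 2 * sqdist M B p + 2 * sqdist M C q"
proof -
  have "sqdist M (B \<union> C) (p + q) \<le> 2 * sqdist M B p + 2 * 1\<^sup>2 * sqdist M C q"
    unfolding sqdist_def
  proof (rule integral_square_le)
    fix t :: real
    show "\<bar>indicator (B \<union> C) t - poly (p + q) t\<bar> \<le> \<bar>indicator B t - poly p t\<bar> + 1 * \<bar>indicator C t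
        - poly q t\<bar>"
      using assms(3) by (auto simp: indicator_def)
  qed (intro unit_bounded_intros sets.Un B C)+
  then show ?thesis by simp
qed

lemma poly_sqdist:
  assumes B: "B \<in> sets borel"
  shows "(\<integral>t. poly ((p - q) * (p - q)) t \<partial>M) \<le> 2 * sqdist M B p + 2 * sqdist M B q"
proof -
  have "(\<integral>t. (poly (p - q) t)\<^sup>2 \<partial>M) \<le> 2 * sqdist M B p + 2 * 1\<^sup>2 * sqdist M B q"
    unfolding sqdist_def
    by (intro integral_square_le) (use B in \<open>auto intro!: unit_bounded_intros\<close>)
  then show ?thesis by (simp add: power2_eq_square)
qed

text \<open>Split 1_B 1_C - p q as 1_C (1_B - p) + p (1_C - q). The bound \<open>K\<close> depends
  on \<open>p\<close>, so limits have to be taken in \<open>q\<close> first.\<close>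

lemma sqdist_mult:
  assumes B: "B \<in> sets borel" and C: "C \<in> sets borel"
    and K: "\<And>t. t \<in> {0..1} \<Longrightarrow> \<bar>poly p t\<bar> \<le> K"
  shows "sqdist M (B \<inter> C) (p * q) \<le> 2 * sqdist M B p + 2 * K\<^sup>2 * sqdist M C q"
  unfolding sqdist_def
proof (rule integral_square_le)
  fix t :: real assume t: "t \<in> {0..1}"
  have "indicator (B \<inter> C) t - poly (p * q) t =
      indicator C t * (indicator B t - poly p t) + poly p t * (indicator C t - poly q t)"
    by (auto simp: indicator_def algebra_simps)
  also have "\<bar>\<dots>\<bar> \<le> \<bar>indicator C t * (indicator B t - poly p t)\<bar> + \<bar>poly p t * (indicator C t - poly q t)\<bar>"
    by (rule abs_triangle_ineq)
  also have "\<dots> \<le> \<bar>indicator B t - poly p t\<bar> + K * \<bar>indicator C t - poly q t\<bar>"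
    unfolding abs_mult using K[OF t] by (intro add_mono mult_right_mono) (auto simp: indicator_def)
  finally show "\<bar>indicator (B \<inter> C) t - poly (p * q) t\<bar> \<le>
      \<bar>indicator B t - poly p t\<bar> + K * \<bar>indicator C t - poly q t\<bar>" .
qed (intro unit_bounded_intros sets.Int B C)+

lemma sqdist_uniform:
  assumes B: "B \<in> sets borel" and f: "unit_bounded f"
    and d: "\<And>t. t \<in> {0..1} \<Longrightarrow> \<bar>f t - poly p t\<bar> \<le> d"
  shows "sqdist M B p \<le> 2 * (\<integral>t. (indicator B t - f t)\<^sup>2 \<partial>M) + 2 * d\<^sup>2 * measure M UNIV"
proof -
  have "sqdist M B p \<le> 2 * (\<integral>t. (indicator B t - f t)\<^sup>2 \<partial>M) + 2 * d\<^sup>2 * (\<integral>t. (poly 1 t)\<^sup>2 \<partial>M)"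
    unfolding sqdist_def
  proof (rule integral_square_le)
    fix t :: real assume "t \<in> {0..1}"
    from d[OF this] show "\<bar>indicator B t - poly p t\<bar> \<le> \<bar>indicator B t - f t\<bar> + d * \<bar>poly 1 t\<bar>" by simp
  qed (intro unit_bounded_intros B f)+
  then show ?thesis by simp
qed

text \<open>The ramps decrease pointwise to the indicator function of the half-line, and dominated
  convergence applies.\<close>

lemma cts_step_tendsto:
  "(\<lambda>k. \<integral>t. (indicator {..a} t - cts_step a (a + 1 / real (Suc k)) t)\<^sup>2 \<partial>M) \<longlonglongrightarrow> 0"
proof -
  have m[measurable]: "cts_step a b \<in> borel_measurable borel" for b :: real
    unfolding cts_step_def[abs_def] by measurable
  have "(\<lambda>k. \<integral>t. (indicator {..a} t - cts_step a (a + 1 / real (Suc k)) t)\<^sup>2 \<partial>M) \<longlonglongrightarrow> (\<integral>t. 0 \<partial>M)"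
  proof (rule integral_dominated_convergence[where w = "\<lambda>_. 1"])
    show "AE t in M. (\<lambda>k. (indicator {..a} t - cts_step a (a + 1 / real (Suc k)) t)\<^sup>2) \<longlonglongrightarrow> 0"
    proof (rule AE_I2)
      fix t
      have "\<forall>\<^sub>F k in sequentially. (indicator {..a} t - cts_step a (a + 1 / real (Suc k)) t)\<^sup>2 = 0"
      proof (cases "t \<le> a")
        case True then show ?thesis by (simp add: cts_step_def)
      next
        case False
        then have "t - a > 0" by simp
        then obtain k0 where k0: "1 / real (Suc k0) < t - a"
          using nat_approx_posE by blast
        show ?thesis using eventually_ge_at_top[of k0]
        proof eventually_elim
          case (elim k)
          have "1 / real (Suc k) \<le> 1 / real (Suc k0)" using elim by (intro divide_left_mono) auto
          then have "a + 1 / real (Suc k) \<le> t" using k0 by linarith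
          with False show ?case by (auto simp: cts_step_def)
        qed
      qed
      then show "(\<lambda>k. (indicator {..a} t - cts_step a (a + 1 / real (Suc k)) t)\<^sup>2) \<longlonglongrightarrow> 0"
        by (rule tendsto_eventually)
    qed
    show "AE t in M. norm ((indicator {..a} t - cts_step a (a + 1 / real (Suc k)) t)\<^sup>2) \<le> 1" for k
    proof (rule AE_I2)
      fix t
      have "0 \<le> cts_step a (a + 1 / real (Suc k)) t" "cts_step a (a + 1 / real (Suc k)) t \<le> 1"
        using cts_step_bounds[of a "a + 1 / real (Suc k)" t] by auto
      then have "\<bar>indicator {..a} t - cts_step a (a + 1 / real (Suc k)) t\<bar> \<le> 1"
        by (auto simp: indicator_def)
      then show "norm ((indicator {..a} t - cts_step a (a + 1 / real (Suc k)) t)\<^sup>2) \<le> 1"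
        by (simp add: abs_square_le_1)
    qed
  qed auto
  then show ?thesis by simp
qed

end

lemma measure_tail_tendsto_0:
  assumes "finite_measure M" "disjoint_family B" "\<And>i::nat. B i \<in> sets M"
  shows "(\<lambda>n. measure M ((\<Union>i. B i) - (\<Union>i<n. B i))) \<longlonglongrightarrow> 0"
proof -
  interpret finite_measure M by fact
  have "(\<lambda>n. measure M ((\<Union>i. B i) - (\<Union>i<n. B i))) \<longlonglongrightarrow> measure M (\<Inter>n. (\<Union>i. B i) - (\<Union>i<n. B i))"
    using assms(3) by (intro finite_Lim_measure_decseq) (auto simp: decseq_def)
  moreover have "(\<Inter>n. (\<Union>i. B i) - (\<Union>i<n. B i)) = {}" by blast
  ultimately show ?thesis by (simp only: measure_empty)
qed

lemma Int_stable_atMost: "Int_stable (range (\<lambda>a::real. {..a}))"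
  by (auto simp: Int_stable_def)

text \<open>Dynkin induction from the half-lines: ramps and Weierstrass approximation for a
  half-line, \<open>1 - p\<close> for a complement, finite unions and a small tail for a disjoint
  union. Both measures are carried along so that one polynomial serves the two.\<close>

lemma polynomials_dense:
  assumes M: "unit_interval_measure M" and N: "unit_interval_measure N"
    and B: "B \<in> sets borel" and "e > 0"
  shows "\<exists>p. sqdist M B p < e \<and> sqdist N B p < e"
proof -
  interpret M: unit_interval_measure M by fact
  interpret N: unit_interval_measure N by fact
  have Pow_UNIV_range: "range (\<lambda>a::real. {..a}) \<subseteq> Pow UNIV" by simp
  have "(\<forall>e>0. \<exists>p. sqdist M B p < e \<and> sqdist N B p < e) \<and> B \<in> sets borel"
    if B: "B \<in> sigma_sets UNIV (range (\<lambda>a::real. {..a}))" for B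
    using Int_stable_atMost Pow_UNIV_range B
  proof (induction rule: sigma_sets_induct_disjoint)
    case empty
    show ?case by (auto intro!: exI[of _ 0] simp: sqdist_def)
  next
    case (basic B)
    then obtain a where a: "B = {..a}" by auto
    have "\<exists>p. sqdist M B p < e \<and> sqdist N B p < e" if e: "e > 0" for e
    proof -
      define c where "c k = cts_step a (a + 1 / real (Suc k))" for k
      have m[measurable]: "cts_step a b \<in> borel_measurable borel" for b :: real
        unfolding cts_step_def[abs_def] by measurable
      have "\<forall>\<^sub>F k in sequentially. (\<integral>t. (indicator {..a} t - c k t)\<^sup>2 \<partial>M) < e / 4"
        "\<forall>\<^sub>F k in sequentially. (\<integral>t. (indicator {..a} t - c k t)\<^sup>2 \<partial>N) < e / 4"
        unfolding c_def
        using order_tendstoD(2)[OF M.cts_step_tendsto, of "e / 4" a]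
          order_tendstoD(2)[OF N.cts_step_tendsto, of "e / 4" a] e by simp_all
      then have "\<forall>\<^sub>F k in sequentially. (\<integral>t. (indicator {..a} t - c k t)\<^sup>2 \<partial>M)
          < e / 4 \<and> (\<integral>t. (indicator {..a} t - c k t)\<^sup>2 \<partial>N) < e / 4"
        by (rule eventually_conj)
      then obtain k where k: "(\<integral>t. (indicator {..a} t - c k t)\<^sup>2 \<partial>M) < e / 4"
          "(\<integral>t. (indicator {..a} t - c k t)\<^sup>2 \<partial>N) < e / 4"
        by (auto simp: eventually_sequentially)
      define m where "m = max (measure M UNIV) (measure N UNIV) + 1"
      have m: "m > 0" "measure M UNIV \<le> m" "measure N UNIV \<le> m"
        by (auto simp: m_def max_def add_nonneg_pos)
      \<comment> \<open>Chosen so that the uniform error contributes at most e/2; the ramp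
        contributes less than 2 * (e/4).\<close>
      define d where "d = sqrt (e / (4 * m))"
      have d: "d > 0" "2 * d\<^sup>2 * m = e / 2" using e m by (auto simp: d_def field_simps)
      have "continuous_on {0..1} (c k)"
        unfolding c_def
        using uniformly_continuous_imp_continuous[OF
            cts_step_uniformly_continuous[of a "a + 1 / real (Suc k)"]]
        by (auto intro: continuous_on_subset)
      from Bernstein_Weierstrass[OF this d(1)] obtain n where
        n: "\<And>x. x \<in> {0..1} \<Longrightarrow> \<bar>c k x - (\<Sum>j\<le>n. c k (j / n) * Bernstein n j x)\<bar> < d"
        by blast
      define p where "p = (\<Sum>j\<le>n. smult (c k (j / n) * real (n choose j))
          ([:0, 1:] ^ j * [:1, - 1:] ^ (n - j)))"
      have p: "poly p x = (\<Sum>j\<le>n. c k (j / n) * Bernstein n j x)" for x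
        by (simp add: p_def poly_sum Bernstein_def mult.assoc)
      have c1: "\<bar>c k t\<bar> \<le> 1" for t
        using cts_step_bounds[of a "a + 1 / real (Suc k)" t] by (auto simp: c_def)
      have dp: "\<bar>c k t - poly p t\<bar> \<le> d" if "t \<in> {0..1}" for t using n[OF that] p by simp
      have cub: "unit_bounded (c k)"
        using c1 by (auto simp: unit_bounded_def c_def bounded_iff)
      have "2 * d\<^sup>2 * measure M UNIV \<le> e / 2" "2 * d\<^sup>2 * measure N UNIV \<le> e / 2"
        using mult_left_mono[OF m(2), of "2 * d\<^sup>2"] mult_left_mono[OF m(3), of "2 * d\<^sup>2"] d(2) by simp_all
      then have "sqdist M B p < e" "sqdist N B p < e"
        using M.sqdist_uniform[of B "c k" p d] N.sqdist_uniform[of B "c k" p d] cub dp k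
        unfolding a by auto
      then show ?thesis by blast
    qed
    then show ?case by (auto simp: a)
  next
    case (compl B)
    have "\<exists>p. sqdist M (UNIV - B) p < e \<and> sqdist N (UNIV - B) p < e" if e: "e > 0" for e
    proof -
      from compl e obtain p where "sqdist M B p < e" "sqdist N B p < e" by blast
      moreover have "(indicator (UNIV - B) t - poly (1 - p) t)\<^sup>2 = (indicator B t - poly p t)\<^sup>2" for t
        by (auto simp: indicator_def power2_eq_square algebra_simps)
      ultimately show ?thesis by (intro exI[of _ "1 - p"]) (simp add: sqdist_def)
    qed
    then show ?case using compl by auto
  next
    case (union B)
    have Bm: "B i \<in> sets borel" for i using union by auto
    have fin: "\<forall>e>0. \<exists>p. sqdist M (\<Union>i<n. B i) p < e \<and> sqdist N (\<Union>i<n. B i) p < e" for n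
    proof (induction n)
      case 0 show ?case by (auto intro!: exI[of _ 0] simp: sqdist_def)
    next
      case (Suc n)
      show ?case
      proof (intro allI impI)
        fix e :: real assume e: "e > 0"
        then obtain p where p: "sqdist M (\<Union>i<n. B i) p < e / 4" "sqdist N (\<Union>i<n. B i) p < e / 4"
          using Suc by (meson zero_less_divide_iff zero_less_numeral)
        from union(3)[of n] e obtain q where q: "sqdist M (B n) q < e / 4" "sqdist N (B n) q < e / 4"
          by (meson zero_less_divide_iff zero_less_numeral)
        have eq: "(\<Union>i<Suc n. B i) = (\<Union>i<n. B i) \<union> B n" by (auto simp: less_Suc_eq)
        have dis: "(\<Union>i<n. B i) \<inter> B n = {}"
          using disjoint_family_onD[OF union(1)] by (auto dest!: nat_neq_iff[THEN iffD2, OF disjI1])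
        have mm: "(\<Union>i<n. B i) \<in> sets borel" using Bm by auto
        show "\<exists>p. sqdist M (\<Union>i<Suc n. B i) p < e \<and> sqdist N (\<Union>i<Suc n. B i) p < e"
          unfolding eq
          using M.sqdist_add[OF mm Bm dis, of p q] N.sqdist_add[OF mm Bm dis, of p q] p q
          by (intro exI[of _ "p + q"]) auto
      qed
    qed
    have "\<exists>p. sqdist M (\<Union>i. B i) p < e \<and> sqdist N (\<Union>i. B i) p < e" if e: "e > 0" for e
    proof -
      have "\<forall>\<^sub>F n in sequentially. measure M ((\<Union>i. B i) - (\<Union>i<n. B i)) < e / 4"
           "\<forall>\<^sub>F n in sequentially. measure N ((\<Union>i. B i) - (\<Union>i<n. B i)) < e / 4"
        using order_tendstoD(2)[OF measure_tail_tendsto_0[OF M.finite_measure_axioms union(1)], of "e / 4"]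
          order_tendstoD(2)[OF measure_tail_tendsto_0[OF N.finite_measure_axioms union(1)], of "e / 4"] e Bm
        by simp_all
      then have "\<forall>\<^sub>F n in sequentially. measure M ((\<Union>i. B i) - (\<Union>i<n. B i))
          < e / 4 \<and> measure N ((\<Union>i. B i) - (\<Union>i<n. B i)) < e / 4"
        by (rule eventually_conj)
      then obtain n where n: "measure M ((\<Union>i. B i) - (\<Union>i<n. B i)) < e / 4"
          "measure N ((\<Union>i. B i) - (\<Union>i<n. B i)) < e / 4"
        by (auto simp: eventually_sequentially)
      obtain p where p: "sqdist M (\<Union>i<n. B i) p < e / 4" "sqdist N (\<Union>i<n. B i) p < e / 4"
        using fin e by (meson zero_less_divide_iff zero_less_numeral)
      have mm: "(\<Union>i<n. B i) \<in> sets borel" "(\<Union>i. B i) \<in> sets borel" "(\<Union>i<n. B i) \<subseteq> (\<Union>i. B i)" using Bm by auto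
      show ?thesis
        using M.sqdist_triangle[OF mm(2,1,3), of p] N.sqdist_triangle[OF mm(2,1,3), of p] p n
        by (intro exI[of _ p]) auto
    qed
    then show ?case using Bm by auto
  qed
  moreover have "sets (borel :: real measure) = sigma_sets UNIV (range (\<lambda>a::real. {..a}))"
    by (subst borel_eq_atMost) simp
  ultimately show ?thesis using B \<open>e > 0\<close> by auto
qed

lemma one_div_Suc_tendsto_0: "(\<lambda>n. 1 / real (Suc n)) \<longlonglongrightarrow> 0"
  using LIMSEQ_inverse_real_of_nat by (simp add: inverse_eq_divide)

lemma squeeze_zero:
  fixes f g :: "nat \<Rightarrow> real"
  assumes "\<And>n. 0 \<le> f n" "\<And>n. f n \<le> g n" "g \<longlonglongrightarrow> 0"
  shows "f \<longlonglongrightarrow> 0"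
  using assms by (intro tendsto_sandwich[OF _ _ tendsto_const assms(3)]) auto

section \<open>Scalar spectral measures as limits of Bernstein measures\<close>

context positive_contraction
begin

lemma pcalc_monom_sum: "pcalc p h = (\<Sum>i\<le>degree p. coeff p i *\<^sub>R pcalc ([:0, 1:] ^ i) h)"
proof -
  have "pcalc p h = pcalc (\<Sum>i\<le>degree p. monom (coeff p i) i) h"
    by (simp add: poly_as_sum_of_monoms)
  then show ?thesis by (simp add: pcalc_sum monom_altdef pcalc_smult)
qed

text \<open>The numbers \<open>w n k\<close> are nonnegative with sum 1, so that placing them at k/n
  gives probability measures on the unit interval. Helly's theorem yields a limit, and the exact
  factorial moments \<open>wj\<close> identify its moments.\<close>

lemma scalar_measure_unit:
  assumes h: "norm h = 1"
  shows "\<exists>M. unit_interval_measure M \<and> (\<forall>p. (\<integral>t. poly p t \<partial>M) = inner (pcalc p h) h)"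
proof -
  define w where "w n k = inner (pcalc (bern n k) h) h" for n k
  have w0: "0 \<le> w n k" for n k
    by (simp add: w_def bern_def pcalc_smult pcalc_nonneg)
  have wj: "(\<Sum>k\<le>n. real (k choose j) * w n k) = real (n choose j) * inner (pcalc ([:0, 1:] ^ j) h) h"
    if "j \<le> n" for j n
  proof -
    have "(\<Sum>k\<le>n. real (k choose j) * w n k) = inner (pcalc (\<Sum>k\<le>n. smult (real (k choose j)) (bern n k)) h) h"
      by (simp add: w_def pcalc_sum pcalc_smult inner_sum_left)
    then show ?thesis by (simp add: sum_choose_bern[OF that] pcalc_smult)
  qed
  have w1: "(\<Sum>k\<le>n. w n k) = 1" for n
    using wj[of 0 n] h by (simp add: power2_norm_eq_inner[symmetric])
  define \<nu> where "\<nu> n = distr (point_measure {..n} (\<lambda>k. ennreal (w n k))) borel (\<lambda>k. real k / real n)" for n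
  have \<nu>: "real_distribution (\<nu> n)" for n
  proof -
    have "prob_space (point_measure {..n} (\<lambda>k. ennreal (w n k)))"
      by (rule prob_spaceI) (simp add: space_point_measure emeasure_point_measure_finite w0 w1)
    then have "prob_space (\<nu> n)"
      unfolding \<nu>_def by (rule prob_space.prob_space_distr) (simp add: measurable_point_measure_eq1)
    then show ?thesis
      by (simp add: real_distribution_def real_distribution_axioms_def \<nu>_def)
  qed
  have int\<nu>: "(\<integral>t. \<phi> t \<partial>\<nu> n) = (\<Sum>k\<le>n. w n k * \<phi> (real k / real n))"
    if "\<phi> \<in> borel_measurable borel" for \<phi> :: "real \<Rightarrow> real" and n
    unfolding \<nu>_def
    by (subst integral_distr)
       (auto simp: that measurable_point_measure_eq1 lebesgue_integral_point_measure_finite w0)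
  \<comment> \<open>For n = 0 the quotient is 0 by convention, so the bounds hold there as
    well.\<close>
  have kn: "0 \<le> real k / real n" "real k / real n \<le> 1" if "k \<le> n" for k n
    using that by (auto simp: divide_le_eq_1)
  \<comment> \<open>Tightness is stated with intervals open on the left; the end point -1 keeps an
    atom at 0 inside.\<close>
  have "measure (\<nu> n) {- 1<..1} = 1" for n
  proof -
    interpret real_distribution "\<nu> n" by (rule \<nu>)
    have "measure (\<nu> n) {- 1<..1} = (\<integral>t. indicator {- 1<..1} t \<partial>\<nu> n)"
      by simp
    also have "\<dots> = (\<Sum>k\<le>n. w n k * indicator {- 1<..1} (real k / real n))"
      by (rule int\<nu>) simp
    also have "\<dots> = (\<Sum>k\<le>n. w n k)"
      proof (rule sum.cong[OF refl])
      fix k assume "k \<in> {..n}"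
      then have "- 1 < real k / real n" "real k / real n \<le> 1"
        using kn[of k n] by (linarith | simp)+
      then have "real k / real n \<in> {- 1<..1}" by simp
      then show "w n k * indicator {- 1<..1} (real k / real n) = w n k"
          by (simp only: indicator_simps mult_1_right)
    qed
    finally show ?thesis by (simp add: w1)
  qed
  then have "\<exists>a b::real. a < b \<and> (\<forall>n. measure (\<nu> n) {a<..b} > 1 - \<epsilon>)" if "\<epsilon> > 0" for \<epsilon>
    using that by (intro exI[of _ "-1::real"] exI[of _ "1::real"]) simp
  then have "tight \<nu>"
    unfolding tight_def using \<nu> by blast
  from tight_imp_convergent_subsubsequence[OF this strict_mono_id]
  obtain r M where r: "strict_mono r" and M: "real_distribution M" and conv: "weak_conv_m (\<nu> \<circ> r) M"
    by auto
  interpret M: real_distribution M by fact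
  have conv_int: "(\<lambda>n. \<integral>t. \<phi> t \<partial>\<nu> (r n)) \<longlonglongrightarrow> (\<integral>t. \<phi> t \<partial>M)"
    if "\<And>x. isCont \<phi> x" "\<And>x. norm (\<phi> x) \<le> B" for \<phi> :: "real \<Rightarrow> real" and B
    using weak_conv_imp_integral_bdd_continuous_conv[of "\<nu> \<circ> r" M \<phi> B] \<nu> M conv that by simp
  \<comment> \<open>Clamping to the unit interval turns powers into bounded continuous test
    functions and does not change their integrals over \<open>\<nu> n\<close>.\<close>
  define c where "c t = max 0 (min 1 t)" for t :: real
  have c: "0 \<le> c t" "c t \<le> 1" "isCont c t" "t \<in> {0..1} \<Longrightarrow> c t = t" "c \<in> borel_measurable borel" for t
    by (auto simp: c_def[abs_def] intro!: continuous_intros)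
  \<comment> \<open>This bounded continuous integrand is zero exactly on the unit interval, hence at
    all atoms of \<open>\<nu> n\<close>. A zero integral in the limit confines \<open>M\<close> to
    that interval.\<close>
  have "(\<integral>t. min 1 \<bar>t - c t\<bar> \<partial>M) = 0"
  proof -
    have "(\<lambda>n. \<integral>t. min 1 \<bar>t - c t\<bar> \<partial>\<nu> (r n)) \<longlonglongrightarrow> (\<integral>t. min 1 \<bar>t - c t\<bar> \<partial>M)"
      by (rule conv_int[of _ 1]) (auto intro!: continuous_intros c)
    moreover have "(\<integral>t. min 1 \<bar>t - c t\<bar> \<partial>\<nu> (r n)) = 0" for n
      by (subst int\<nu>) (use c(5) in \<open>auto simp: c(4) kn intro!: sum.neutral\<close>)
    ultimately show ?thesis by (simp add: LIMSEQ_const_iff)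
  qed
  moreover have "integrable M (\<lambda>t. min 1 \<bar>t - c t\<bar>)"
    using c(5) by (intro M.integrable_const_bound[where B = 1]) auto
  ultimately have "AE t in M. min 1 \<bar>t - c t\<bar> = 0"
    by (subst (asm) integral_nonneg_eq_0_iff_AE) auto
  then have AE: "AE t in M. t \<in> {0..1}"
    by eventually_elim (auto simp: c_def min_def max_def split: if_splits)
  have "unit_interval_measure M"
    by unfold_locales (use AE in auto)
  then interpret U: unit_interval_measure M .
  have moments: "(\<integral>t. t ^ j \<partial>M) = inner (pcalc ([:0, 1:] ^ j) h) h" for j
  proof -
    define m where "m = inner (pcalc ([:0, 1:] ^ j) h) h"
    define e where "e n = (SUP k\<in>{..n}. \<bar>real (k choose j) / real (n choose j) - (real k / real n) ^ j\<bar>)"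
        for n
    \<comment> \<open>By \<open>wj\<close> the number \<open>m\<close> is the average of the ratios
      of binomial coefficients with the same weights, so only their distance from the powers of k/n
      enters.\<close>
    have bnd: "\<bar>(\<integral>t. c t ^ j \<partial>\<nu> n) - m\<bar> \<le> e n" if n: "n \<ge> j" for n
    proof -
      have nz: "real (n choose j) > 0" using n by simp
      have m: "m = (\<Sum>k\<le>n. w n k * (real (k choose j) / real (n choose j)))"
        using wj[OF n] nz by (simp add: m_def sum_divide_distrib[symmetric] mult.commute field_simps)
      have "(\<integral>t. c t ^ j \<partial>\<nu> n) = (\<Sum>k\<le>n. w n k * (real k / real n) ^ j)"
        by (subst int\<nu>) (use c(5) in \<open>auto simp: c(4) kn\<close>)
      then have "\<bar>(\<integral>t. c t ^ j \<partial>\<nu> n) - m\<bar>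
          = \<bar>\<Sum>k\<le>n. w n k * ((real k / real n) ^ j - real (k choose j) / real (n choose j))\<bar>"
        unfolding m by (simp add: right_diff_distrib sum_subtractf)
      also have "\<dots> \<le> (\<Sum>k\<le>n. w n k * e n)"
      proof (rule order_trans[OF sum_abs], rule sum_mono)
        fix k assume "k \<in> {..n}"
        then have "\<bar>(real k / real n) ^ j - real (k choose j) / real (n choose j)\<bar> \<le> e n"
          unfolding e_def by (subst abs_minus_commute) (rule cSUP_upper, auto)
        then show "\<bar>w n k * ((real k / real n) ^ j - real (k choose j) / real (n choose j))\<bar> \<le> w n k * e n"
          by (simp add: abs_mult w0 mult_left_mono)
      qed
      also have "\<dots> = e n" by (simp add: sum_distrib_right[symmetric] w1)
      finally show ?thesis .
    qed
    have "e \<longlonglongrightarrow> 0" unfolding e_def by (rule choose_ratio_tendsto)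
    moreover have "\<forall>\<^sub>F n in sequentially. norm ((\<integral>t. c t ^ j \<partial>\<nu> n) - m) \<le> e n"
      unfolding real_norm_def using eventually_ge_at_top[of j] by eventually_elim (rule bnd)
    ultimately have "(\<lambda>n. (\<integral>t. c t ^ j \<partial>\<nu> n) - m) \<longlonglongrightarrow> 0"
      by (rule Lim_null_comparison[rotated])
    then have "(\<lambda>n. (\<integral>t. c t ^ j \<partial>\<nu> n)) \<longlonglongrightarrow> m" by (simp add: LIM_zero_iff)
    then have "(\<lambda>n. (\<integral>t. c t ^ j \<partial>\<nu> (r n))) \<longlonglongrightarrow> m"
      using LIMSEQ_subseq_LIMSEQ[OF _ r, of "\<lambda>n. (\<integral>t. c t ^ j \<partial>\<nu> n)" m] by (simp only: o_def)
    moreover have "(\<lambda>n. (\<integral>t. c t ^ j \<partial>\<nu> (r n))) \<longlonglongrightarrow> (\<integral>t. c t ^ j \<partial>M)"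
      by (rule conv_int[of _ 1]) (auto intro!: continuous_intros c power_le_one simp: power_abs c(1,2))
    ultimately have "(\<integral>t. c t ^ j \<partial>M) = m" by (rule LIMSEQ_unique[symmetric])
    moreover have "(\<integral>t. c t ^ j \<partial>M) = (\<integral>t. t ^ j \<partial>M)"
    proof (rule integral_cong_AE)
      show "AE t in M. c t ^ j = t ^ j" using AE by eventually_elim (simp add: c(4))
    qed (use c(5) in auto)
    ultimately show ?thesis by (simp add: m_def)
  qed
  have "(\<integral>t. poly p t \<partial>M) = inner (pcalc p h) h" for p
  proof -
    have ij: "integrable M (\<lambda>t. t ^ i)" for i
      using U.integrable_poly[of "[:0, 1:] ^ i"] by (simp add: poly_power[abs_def])
    have "(\<integral>t. poly p t \<partial>M) = (\<integral>t. (\<Sum>i\<le>degree p. coeff p i * t ^ i) \<partial>M)"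
      by (simp add: poly_altdef)
    also have "\<dots> = (\<Sum>i\<le>degree p. coeff p i * (\<integral>t. t ^ i \<partial>M))"
      by (subst Bochner_Integration.integral_sum) (auto intro!: ij)
    also have "\<dots> = inner (pcalc p h) h"
      by (subst pcalc_monom_sum) (simp add: inner_sum_left moments)
    finally show ?thesis .
  qed
  with U.unit_interval_measure_axioms show ?thesis by blast
qed

lemma scalar_measure_exists:
  "\<exists>M. unit_interval_measure M \<and> (\<forall>p. (\<integral>t. poly p t \<partial>M) = inner (pcalc p h) h)"
proof (cases "h = 0")
  case True
  have "unit_interval_measure (null_measure borel)"
    unfolding unit_interval_measure_def unit_interval_measure_axioms_def
    by (auto intro!: finite_measureI AE_I[where N = UNIV])
  then show ?thesis
    by (intro exI[of _ "null_measure borel"]) (simp add: True)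
next
  case False
  define u where "u = h /\<^sub>R norm h"
  have "norm u = 1" using False by (simp add: u_def)
  from scalar_measure_unit[OF this] obtain M where M: "unit_interval_measure M"
    and int: "\<And>p. (\<integral>t. poly p t \<partial>M) = inner (pcalc p u) u" by blast
  interpret M: unit_interval_measure M by fact
  define N where "N = density M (\<lambda>_. ennreal ((norm h)\<^sup>2))"
  have "unit_interval_measure N"
    unfolding unit_interval_measure_def unit_interval_measure_axioms_def
  proof (intro conjI)
    show "finite_measure N"
      by (rule finite_measureI)
         (simp add: N_def emeasure_density_const M.emeasure_eq_measure ennreal_mult[symmetric])
    show "sets N = sets borel" by (simp add: N_def)
    show "AE t in N. t \<in> {0..1}"
      unfolding N_def using M.AE_unit by (subst AE_density) auto
  qed
  moreover have "(\<integral>t. poly p t \<partial>N) = inner (pcalc p h) h" for p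
  proof -
    have "(\<integral>t. poly p t \<partial>N) = (norm h)\<^sup>2 * (\<integral>t. poly p t \<partial>M)"
      unfolding N_def by (subst integral_density) auto
    also have "\<dots> = inner (pcalc p (norm h *\<^sub>R u)) (norm h *\<^sub>R u)"
      by (simp add: int pcalc_linear power2_eq_square)
    finally show ?thesis using False by (simp add: u_def)
  qed
  ultimately show ?thesis by blast
qed

definition smeasure :: "'h \<Rightarrow> real measure" where
  "smeasure h = (SOME M. unit_interval_measure M \<and> (\<forall>p. (\<integral>t. poly p t \<partial>M) = inner (pcalc p h) h))"

lemma unit_interval_smeasure: "unit_interval_measure (smeasure h)"
  and integral_smeasure: "(\<integral>t. poly p t \<partial>smeasure h) = inner (pcalc p h) h"
  using someI_ex[OF scalar_measure_exists[of h]] unfolding smeasure_def by auto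

section \<open>Spectral projections as limits of polynomials in \<open>A\<close>\<close>

abbreviation err :: "'h \<Rightarrow> real set \<Rightarrow> real poly \<Rightarrow> real" where
  "err h \<equiv> sqdist (smeasure h)"

abbreviation approx :: "'h \<Rightarrow> real set \<Rightarrow> (nat \<Rightarrow> real poly) \<Rightarrow> bool" where
  "approx h B q \<equiv> (\<lambda>n. err h B (q n)) \<longlonglongrightarrow> 0"

text \<open>The map p |-> p(A) h is isometric for the L^2 norm of \<open>smeasure h\<close>, so
  polynomials close to the same indicator function give close vectors.\<close>

lemma norm_pcalc_diff:
  assumes "B \<in> sets borel"
  shows "(norm (pcalc p h - pcalc q h))\<^sup>2 \<le> 2 * err h B p + 2 * err h B q"
proof -
  have "(norm (pcalc p h - pcalc q h))\<^sup>2 = (\<integral>t. poly ((p - q) * (p - q)) t \<partial>smeasure h)"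
    by (simp only: integral_smeasure pcalc_square pcalc_diff)
  also have "\<dots> \<le> 2 * err h B p + 2 * err h B q"
    by (rule unit_interval_measure.poly_sqdist[OF unit_interval_smeasure assms])
  finally show ?thesis .
qed

text \<open>Approximation in two spaces at once makes it unnecessary to know that the scalar measures are
  unique.\<close>

lemma approximating_polynomials:
  assumes "B \<in> sets borel"
  obtains q where "approx g B q" "approx h B q"
proof -
  have "\<forall>n. \<exists>p. err g B p < 1 / real (Suc n) \<and> err h B p < 1 / real (Suc n)"
    using polynomials_dense[OF unit_interval_smeasure unit_interval_smeasure assms] by simp
  then obtain q where q: "\<And>n. err g B (q n) < 1 / real (Suc n)" "\<And>n. err h B (q n) < 1 / real (Suc n)"
    by metis
  show thesis
  proof (rule that[of q]; rule tendsto_sandwich[of "\<lambda>_. 0"])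
    show "(\<lambda>n. 1 / real (Suc n)) \<longlonglongrightarrow> 0" "(\<lambda>n. 1 / real (Suc n)) \<longlonglongrightarrow> 0"
      by (rule one_div_Suc_tendsto_0)+
  qed (auto intro!: always_eventually sqdist_nonneg less_imp_le q simp del: of_nat_Suc)
qed

text \<open>For Borel sets the limit exists and is the same for all approximating sequences, by
  \<open>sproj_limit\<close>; the choice is thus harmless.\<close>

definition sproj :: "real set \<Rightarrow> 'h \<Rightarrow> 'h" where
  "sproj B h = (SOME v. \<exists>q. approx h B q \<and> (\<lambda>n. pcalc (q n) h) \<longlonglongrightarrow> v)"

lemma sproj_limit:
  assumes B: "B \<in> sets borel" and q: "approx h B q"
  shows "(\<lambda>n. pcalc (q n) h) \<longlonglongrightarrow> sproj B h"
proof -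
  have null: "(\<lambda>n. norm (pcalc (p n) h - pcalc (p' n) h)) \<longlonglongrightarrow> 0"
    if "approx h B p" "approx h B p'" for p p'
  proof -
    have "(\<lambda>n. 2 * err h B (p n) + 2 * err h B (p' n)) \<longlonglongrightarrow> 2 * 0 + 2 * 0"
      by (intro tendsto_intros that)
    then have lim: "(\<lambda>n. 2 * err h B (p n) + 2 * err h B (p' n)) \<longlonglongrightarrow> 0" by simp
    have "(\<lambda>n. (norm (pcalc (p n) h - pcalc (p' n) h))\<^sup>2) \<longlonglongrightarrow> 0"
    proof (rule squeeze_zero[OF _ _ lim])
      show "(norm (pcalc (p n) h - pcalc (p' n) h))\<^sup>2 \<le> 2 * err h B (p n) + 2 * err h B (p' n)" for n
        by (rule norm_pcalc_diff[OF B])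
    qed simp
    from tendsto_real_sqrt[OF this] show ?thesis by simp
  qed
  have conv: "convergent (\<lambda>n. pcalc (p n) h)" if p: "approx h B p" for p
  proof -
    have "Cauchy (\<lambda>n. pcalc (p n) h)"
    proof (rule metric_CauchyI)
      fix e :: real assume e: "e > 0"
      then have "\<forall>\<^sub>F n in sequentially. err h B (p n) < e\<^sup>2 / 4"
        by (intro order_tendstoD(2)[OF p]) simp
      then obtain n0 where n0: "\<And>n. n \<ge> n0 \<Longrightarrow> err h B (p n) < e\<^sup>2 / 4"
        by (auto simp: eventually_sequentially)
      have "dist (pcalc (p m) h) (pcalc (p n) h) < e" if "m \<ge> n0" "n \<ge> n0" for m n
      proof -
        have "(norm (pcalc (p m) h - pcalc (p n) h))\<^sup>2 < e\<^sup>2"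
          using norm_pcalc_diff[OF B, of "p m" h "p n"] n0[OF that(1)] n0[OF that(2)] by linarith
        then show ?thesis using e by (simp add: dist_norm power2_less_imp_less)
      qed
      then show "\<exists>M. \<forall>m\<ge>M. \<forall>n\<ge>M. dist (pcalc (p m) h) (pcalc (p n) h) < e" by blast
    qed
    then show ?thesis by (simp add: Cauchy_convergent_iff)
  qed
  have "\<exists>q. approx h B q \<and> (\<lambda>n. pcalc (q n) h) \<longlonglongrightarrow> sproj B h"
    unfolding sproj_def
  proof (rule someI_ex)
    show "\<exists>v q. approx h B q \<and> (\<lambda>n. pcalc (q n) h) \<longlonglongrightarrow> v"
      using q conv[OF q] by (auto simp: convergent_def)
  qed
  then obtain p where p: "approx h B p" "(\<lambda>n. pcalc (p n) h) \<longlonglongrightarrow> sproj B h" by blast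
  have "(\<lambda>n. pcalc (q n) h - pcalc (p n) h) \<longlonglongrightarrow> 0"
    using null[OF q p(1)] by (simp add: tendsto_norm_zero_iff)
  from tendsto_add[OF this p(2)] show ?thesis by simp
qed

lemma sproj_error:
  assumes B: "B \<in> sets borel"
  shows "(norm (pcalc p h - sproj B h))\<^sup>2 \<le> 2 * err h B p"
proof -
  obtain q where q: "approx h B q" using approximating_polynomials[OF B] by metis
  have "(\<lambda>n. (norm (pcalc p h - pcalc (q n) h))\<^sup>2) \<longlonglongrightarrow> (norm (pcalc p h - sproj B h))\<^sup>2"
    by (intro tendsto_intros sproj_limit[OF B q])
  moreover have "(\<lambda>n. 2 * err h B p + 2 * err h B (q n)) \<longlonglongrightarrow> 2 * err h B p + 2 * 0"
    by (intro tendsto_intros q)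
  ultimately have "(norm (pcalc p h - sproj B h))\<^sup>2 \<le> 2 * err h B p + 2 * 0"
    by (rule LIMSEQ_le) (use norm_pcalc_diff[OF B] in blast)
  then show ?thesis by simp
qed

lemma sproj_symmetric:
  assumes B: "B \<in> sets borel"
  shows "inner (sproj B g) h = inner g (sproj B h)"
proof -
  obtain q where q: "approx g B q" "approx h B q"
    using approximating_polynomials[OF B] by metis
  have "(\<lambda>n. inner (pcalc (q n) g) h) \<longlonglongrightarrow> inner (sproj B g) h"
    by (intro tendsto_intros sproj_limit B q)
  moreover have "(\<lambda>n. inner g (pcalc (q n) h)) \<longlonglongrightarrow> inner g (sproj B h)"
    by (intro tendsto_intros sproj_limit B q)
  ultimately show ?thesis using LIMSEQ_unique by (simp add: pcalc_symmetric)
qed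

text \<open>Applied below to multiplication by \<i>, it makes the projections compatible with the
  complex structure.\<close>

lemma sproj_commute:
  assumes B: "B \<in> sets borel" and U: "bounded_linear U" and AU: "\<And>v. A (U v) = U (A v)"
  shows "sproj B (U h) = U (sproj B h)"
proof -
  interpret U: bounded_linear U by fact
  obtain q where q: "approx (U h) B q" "approx h B q"
    using approximating_polynomials[OF B] by metis
  have pU: "pcalc p (U h) = U (pcalc p h)" for p
    by (induction p) (simp_all add: U.add U.scaleR U.zero AU)
  have "(\<lambda>n. pcalc (q n) (U h)) \<longlonglongrightarrow> sproj B (U h)"
    by (intro sproj_limit B q)
  moreover have "(\<lambda>n. U (pcalc (q n) h)) \<longlonglongrightarrow> U (sproj B h)"
    by (intro U.tendsto sproj_limit B q)
  ultimately show ?thesis using LIMSEQ_unique by (simp add: pU)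
qed

lemma inner_sproj:
  assumes B: "B \<in> sets borel"
  shows "inner (sproj B h) h = measure (smeasure h) B"
proof -
  obtain q where q: "approx h B q" using approximating_polynomials[OF B] by metis
  have "(\<lambda>n. (inner (pcalc (q n) h) h - measure (smeasure h) B)\<^sup>2) \<longlonglongrightarrow> 0"
  proof (rule squeeze_zero)
    show "(inner (pcalc (q n) h) h - measure (smeasure h) B)\<^sup>2 \<le> measure (smeasure h) UNIV * err h B (q n)"
        for n
      using unit_interval_measure.integral_poly_diff[OF unit_interval_smeasure B]
          by (simp add: integral_smeasure)
    show "(\<lambda>n. measure (smeasure h) UNIV * err h B (q n)) \<longlonglongrightarrow> 0"
      using tendsto_mult_right_zero[OF q] by simp
  qed auto
  moreover have "(\<lambda>n. (inner (pcalc (q n) h) h - measure (smeasure h) B)\<^sup>2)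
      \<longlonglongrightarrow> (inner (sproj B h) h - measure (smeasure h) B)\<^sup>2"
    by (intro tendsto_intros sproj_limit B q)
  ultimately have "(inner (sproj B h) h - measure (smeasure h) B)\<^sup>2 = 0"
    using LIMSEQ_unique by blast
  then show ?thesis by simp
qed

text \<open>For a fixed polynomial \<open>r\<close> let \<open>q\<close> approximate C, then let
  \<open>r\<close> approximate B. The sequence \<open>p\<close> has to be good for \<open>h\<close>,
  which controls the error, and for \<open>sproj C h\<close>, which gives the limit.\<close>

lemma sproj_inter:
  assumes B: "B \<in> sets borel" and C: "C \<in> sets borel"
  shows "sproj (B \<inter> C) h = sproj B (sproj C h)"
proof -
  define k where "k = sproj C h"
  obtain p where p: "approx h B p" "approx k B p"
    using approximating_polynomials[OF B] by metis
  obtain q where q: "approx h C q" using approximating_polynomials[OF C] by metis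
  have BC: "B \<inter> C \<in> sets borel" using B C by simp
  have le: "(norm (pcalc r k - sproj (B \<inter> C) h))\<^sup>2 \<le> 4 * err h B r" for r
  proof -
    obtain K where K: "\<And>t. t \<in> {0..1} \<Longrightarrow> \<bar>poly r t\<bar> \<le> K" using poly_bounded_unit by blast
    have "(\<lambda>n. (norm (pcalc r (pcalc (q n) h) - sproj (B \<inter> C) h))\<^sup>2) \<longlonglongrightarrow> (norm (pcalc r k - sproj (B \<inter> C) h))\<^sup>2"
      unfolding k_def by (intro tendsto_intros bounded_linear.tendsto[OF bounded_linear_pcalc] sproj_limit C
          q)
    moreover have "(\<lambda>n. 2 * (2 * err h B r + 2 * K\<^sup>2 * err h C (q n))) \<longlonglongrightarrow> 2 * (2 * err h B r + 2 * K\<^sup>2 * 0)"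
      by (intro tendsto_intros q)
    moreover have "(norm (pcalc r (pcalc (q n) h) - sproj (B \<inter> C) h))\<^sup>2
        \<le> 2 * (2 * err h B r + 2 * K\<^sup>2 * err h C (q n))" for n
      using sproj_error[OF BC, of "r * q n" h]
        unit_interval_measure.sqdist_mult[OF unit_interval_smeasure B C, of r K h "q n"] K
      by (simp add: pcalc_mult)
    ultimately have "(norm (pcalc r k - sproj (B \<inter> C) h))\<^sup>2 \<le> 2 * (2 * err h B r + 2 * K\<^sup>2 * 0)"
      by (intro LIMSEQ_le) auto
    then show ?thesis by simp
  qed
  have "(\<lambda>n. (norm (pcalc (p n) k - sproj (B \<inter> C) h))\<^sup>2) \<longlonglongrightarrow> 0"
  proof (rule squeeze_zero)
    show "(norm (pcalc (p n) k - sproj (B \<inter> C) h))\<^sup>2 \<le> 4 * err h B (p n)" for n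
      using le by simp
    show "(\<lambda>n. 4 * err h B (p n)) \<longlonglongrightarrow> 0"
      using tendsto_mult_right_zero[OF p(1)] by simp
  qed auto
  moreover have "(\<lambda>n. (norm (pcalc (p n) k - sproj (B \<inter> C) h))\<^sup>2) \<longlonglongrightarrow> (norm (sproj B k - sproj (B \<inter> C) h))\<^sup>2"
    by (intro tendsto_intros sproj_limit B p)
  ultimately have "(norm (sproj B k - sproj (B \<inter> C) h))\<^sup>2 = 0"
    using LIMSEQ_unique by blast
  then show ?thesis by (simp add: k_def)
qed

lemma sproj_idem: "B \<in> sets borel \<Longrightarrow> sproj B (sproj B h) = sproj B h"
  using sproj_inter[of B B h] by simp

lemma norm_sproj:
  assumes B: "B \<in> sets borel"
  shows "(norm (sproj B h))\<^sup>2 = measure (smeasure h) B"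
proof -
  have "(norm (sproj B h))\<^sup>2 = inner (sproj B (sproj B h)) h"
    unfolding power2_norm_eq_inner by (subst sproj_symmetric[OF B]) simp
  then show ?thesis by (simp add: sproj_idem B inner_sproj)
qed

lemma sproj_unit:
  assumes B: "B \<in> sets borel" "{0..1} \<subseteq> B"
  shows "sproj B h = h"
proof -
  have "(norm (pcalc 1 h - sproj B h))\<^sup>2 \<le> 0"
    using sproj_error[OF B(1), of 1 h] unit_interval_measure.sqdist_eq_0[OF unit_interval_smeasure B, of h]
        by simp
  then show ?thesis by simp
qed

lemma sproj_Un:
  assumes B: "B \<in> sets borel" and C: "C \<in> sets borel" and dis: "B \<inter> C = {}"
  shows "sproj (B \<union> C) h = sproj B h + sproj C h"
proof -
  obtain p where p: "approx h B p" using approximating_polynomials[OF B] by metis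
  obtain q where q: "approx h C q" using approximating_polynomials[OF C] by metis
  have "(\<lambda>n. err h (B \<union> C) (p n + q n)) \<longlonglongrightarrow> 0"
  proof (rule squeeze_zero)
    show "err h (B \<union> C) (p n + q n) \<le> 2 * err h B (p n) + 2 * err h C (q n)" for n
      using unit_interval_measure.sqdist_add[OF unit_interval_smeasure B C dis] by simp
    show "(\<lambda>n. 2 * err h B (p n) + 2 * err h C (q n)) \<longlonglongrightarrow> 0"
      using tendsto_add[OF tendsto_mult_right_zero[OF p] tendsto_mult_right_zero[OF q]] by simp
  qed (auto simp: sqdist_nonneg)
  from sproj_limit[OF _ this] have "(\<lambda>n. pcalc (p n + q n) h) \<longlonglongrightarrow> sproj (B \<union> C) h"
    using B C by simp
  moreover have "(\<lambda>n. pcalc (p n + q n) h) \<longlonglongrightarrow> sproj B h + sproj C h"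
    unfolding pcalc_add by (intro tendsto_intros sproj_limit B C p q)
  ultimately show ?thesis using LIMSEQ_unique by blast
qed

lemma sproj_empty: "sproj {} h = 0"
  using norm_sproj[of "{}" h] by simp

text \<open>The remainder is the projection for the tail of the union, and its squared norm is the
  measure of that tail.\<close>

lemma sproj_sums:
  assumes B: "\<And>i::nat. B i \<in> sets borel" and dis: "disjoint_family B"
  shows "(\<lambda>n. norm (sproj (\<Union>i. B i) h - (\<Sum>i<n. sproj (B i) h))) \<longlonglongrightarrow> 0"
proof -
  interpret M: unit_interval_measure "smeasure h" by (rule unit_interval_smeasure)
  have fin: "sproj (\<Union>i<n. B i) h = (\<Sum>i<n. sproj (B i) h)" for n
  proof (induction n)
    case 0 show ?case by (simp add: sproj_empty)
  next
    case (Suc n)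
    have "(\<Union>i<n. B i) \<inter> B n = {}"
      using disjoint_family_onD[OF dis] by (auto dest!: nat_neq_iff[THEN iffD2, OF disjI1])
    moreover have "(\<Union>i<Suc n. B i) = (\<Union>i<n. B i) \<union> B n" by (auto simp: less_Suc_eq)
    ultimately show ?case using B Suc by (simp add: sproj_Un)
  qed
  have eq: "norm (sproj (\<Union>i. B i) h - (\<Sum>i<n. sproj (B i) h))
      = sqrt (measure (smeasure h) ((\<Union>i. B i) - (\<Union>i<n. B i)))" for n
  proof -
    have "(\<Union>i. B i) = (\<Union>i<n. B i) \<union> ((\<Union>i. B i) - (\<Union>i<n. B i))" by blast
    then have "sproj (\<Union>i. B i) h = sproj ((\<Union>i<n. B i) \<union> ((\<Union>i. B i) - (\<Union>i<n. B i))) h" by (rule arg_cong)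
    also have "\<dots> = sproj (\<Union>i<n. B i) h + sproj ((\<Union>i. B i) - (\<Union>i<n. B i)) h"
      using B by (intro sproj_Un) auto
    finally have "sproj (\<Union>i. B i) h - (\<Sum>i<n. sproj (B i) h) = sproj ((\<Union>i. B i) - (\<Union>i<n. B i)) h"
      by (simp add: fin)
    moreover have "(\<Union>i. B i) - (\<Union>i<n. B i) \<in> sets borel" using B by auto
    ultimately show ?thesis using norm_sproj[of "(\<Union>i. B i) - (\<Union>i<n. B i)" h]
      by (metis norm_ge_zero real_sqrt_unique)
  qed
  have "(\<lambda>n. sqrt (measure (smeasure h) ((\<Union>i. B i) - (\<Union>i<n. B i)))) \<longlonglongrightarrow> sqrt 0"
    using dis B by (intro tendsto_intros measure_tail_tendsto_0 M.finite_measure_axioms) auto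
  then show ?thesis by (simp add: eq)
qed

lemma smeasure_mean: "integrable (smeasure h) (\<lambda>t. t)" "(\<integral>t. t \<partial>smeasure h) = inner (A h) h"
proof -
  have "poly [:0, 1:] = (\<lambda>t::real. t)" by (rule ext) simp
  then show "integrable (smeasure h) (\<lambda>t. t)" "(\<integral>t. t \<partial>smeasure h) = inner (A h) h"
    using unit_interval_measure.integrable_poly[OF unit_interval_smeasure, of h "[:0, 1:]"]
      integral_smeasure[where p = "[:0, 1:]" and h = h] by (simp_all del: pcalc_pCons)
qed

end

section \<open>The Hilbert space of square-summable functions\<close>

lemma ell2_UNIV: "h \<in> ell2 UNIV \<longleftrightarrow> (\<lambda>x. (cmod (h x))\<^sup>2) summable_on UNIV"
  by (simp add: ell2_def)

lemma summable_on_real_comparison: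
  fixes f g :: "'a \<Rightarrow> real"
  assumes "g summable_on X" "\<And>x. x \<in> X \<Longrightarrow> \<bar>f x\<bar> \<le> g x"
  shows "f summable_on X"
  using Infinite_Sum.abs_summable_on_comparison_test'[of g X f] assms
  by (auto intro: abs_summable_summable)

lemma ell2_add: "f \<in> ell2 UNIV \<Longrightarrow> g \<in> ell2 UNIV \<Longrightarrow> (\<lambda>x. f x + g x) \<in> ell2 UNIV"
  unfolding ell2_UNIV
proof (rule summable_on_real_comparison)
  assume "(\<lambda>x. (cmod (f x))\<^sup>2) summable_on UNIV" "(\<lambda>x. (cmod (g x))\<^sup>2) summable_on UNIV"
  then show "(\<lambda>x. 2 * (cmod (f x))\<^sup>2 + 2 * (cmod (g x))\<^sup>2) summable_on UNIV"
    by (intro summable_on_add summable_on_cmult_right)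
  fix x
  have "(cmod (f x + g x))\<^sup>2 \<le> (cmod (f x) + cmod (g x))\<^sup>2"
    by (intro power_mono norm_triangle_ineq) simp
  then show "\<bar>(cmod (f x + g x))\<^sup>2\<bar> \<le> 2 * (cmod (f x))\<^sup>2 + 2 * (cmod (g x))\<^sup>2"
    using zero_le_power2[of "cmod (f x) - cmod (g x)"] by (simp add: power2_eq_square algebra_simps)
qed

lemma ell2_cmult: "f \<in> ell2 UNIV \<Longrightarrow> (\<lambda>x. c * f x) \<in> ell2 UNIV"
  unfolding ell2_UNIV by (simp add: norm_mult power_mult_distrib summable_on_cmult_right)

lemma ell2_prod_summable:
  assumes "f \<in> ell2 UNIV" "g \<in> ell2 UNIV"
  shows "(\<lambda>x. f x * cnj (g x)) summable_on UNIV"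
proof -
  have "(\<lambda>x. (cmod (f x))\<^sup>2 + (cmod (g x))\<^sup>2) summable_on UNIV"
    using assms unfolding ell2_UNIV by (intro summable_on_add)
  then have "(\<lambda>x. norm (f x * cnj (g x))) summable_on UNIV"
  proof (rule summable_on_real_comparison)
    fix x
    show "\<bar>norm (f x * cnj (g x))\<bar> \<le> (cmod (f x))\<^sup>2 + (cmod (g x))\<^sup>2"
      using sum_squares_bound[of "cmod (f x)" "cmod (g x)"]
          mult_nonneg_nonneg[OF norm_ge_zero[of "f x"] norm_ge_zero[of "g x"]]
      unfolding norm_mult complex_mod_cnj abs_mult abs_norm_cancel mult.assoc by linarith
  qed
  then show ?thesis by (rule abs_summable_summable)
qed

text \<open>The abstract spectral theorem asks for a type with a real inner product. It will be the
  real part of the complex one, and \<open>cscale\<close> retains the complex structure.\<close>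

typedef 'a l2 = "ell2 (UNIV :: 'a set)" morphisms l2f Abs_l2
  by (rule exI[of _ "\<lambda>_. 0"]) (simp add: ell2_UNIV)

lemma l2_eqI: "(\<And>i. l2f x i = l2f y i) \<Longrightarrow> x = y"
  by (metis ext l2f_inject)

lemma l2f_in [simp]: "l2f x \<in> ell2 UNIV" by (rule l2f)

definition cscale :: "complex \<Rightarrow> 'a l2 \<Rightarrow> 'a l2" where
  "cscale c x = Abs_l2 (\<lambda>i. c * l2f x i)"

lemma l2f_cscale [simp]: "l2f (cscale c x) i = c * l2f x i"
  unfolding cscale_def by (subst Abs_l2_inverse) (auto intro!: ell2_cmult)

instantiation l2 :: (type) real_vector
begin
definition zero_l2 where "zero_l2 = Abs_l2 (\<lambda>_. 0)"
definition plus_l2 where "plus_l2 x y = Abs_l2 (\<lambda>i. l2f x i + l2f y i)"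
definition uminus_l2 where "uminus_l2 x = cscale (- 1) x"
definition minus_l2 where "minus_l2 x y = x + cscale (- 1) y" for x y :: "'a l2"
definition scaleR_l2 where "scaleR_l2 r x = cscale (of_real r) x"

lemma l2f_zero [simp]: "l2f 0 i = 0"
  unfolding zero_l2_def by (subst Abs_l2_inverse) (auto simp: ell2_UNIV)

lemma l2f_plus [simp]: "l2f (x + y) i = l2f x i + l2f y i"
  unfolding plus_l2_def by (subst Abs_l2_inverse) (auto intro!: ell2_add)

lemma l2f_uminus [simp]: "l2f (- x) i = - l2f x i"
  unfolding uminus_l2_def by simp

lemma l2f_minus [simp]: "l2f (x - y) i = l2f x i - l2f y i"
  unfolding minus_l2_def by simp

lemma l2f_scaleR [simp]: "l2f (r *\<^sub>R x) i = of_real r * l2f x i"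
  unfolding scaleR_l2_def by simp

instance
  by standard (auto intro!: l2_eqI simp: algebra_simps)
end

instantiation l2 :: (type) real_inner
begin
definition inner_l2 where "inner_l2 x y = (\<Sum>\<^sub>\<infinity>i. Re (l2f x i * cnj (l2f y i)))"
definition norm_l2 where "norm_l2 x = sqrt (inner x x)" for x :: "'a l2"
definition dist_l2 where "dist_l2 x y = norm (x - y)" for x y :: "'a l2"
definition sgn_l2 where "sgn_l2 x = x /\<^sub>R norm x" for x :: "'a l2"
definition uniformity_l2 where
  "(uniformity :: ('a l2 \<times> 'a l2) filter) = (INF e\<in>{0<..}. principal {(x, y). dist x y < e})"
definition open_l2 where
  "open_l2 U = (\<forall>x\<in>U. eventually (\<lambda>(x', y). x' = x \<longrightarrow> y \<in> U) uniformity)" for U :: "'a l2 set"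

lemma summable_inner_l2: "(\<lambda>i. Re (l2f x i * cnj (l2f y i))) summable_on UNIV"
  by (intro summable_on_Re ell2_prod_summable l2f)

lemma Re_mult_cnj_self: "Re (z * cnj z) = (cmod z)\<^sup>2"
  by (simp add: complex_mult_cnj cmod_power2)

instance
proof
  fix x y z :: "'a l2" and r :: real and U :: "'a l2 set"
  show "dist x y = norm (x - y)" by (rule dist_l2_def)
  show "sgn x = x /\<^sub>R norm x" by (rule sgn_l2_def)
  show "(uniformity :: ('a l2 \<times> 'a l2) filter) = (INF e\<in>{0<..}. principal {(x, y). dist x y < e})"
    by (rule uniformity_l2_def)
  show "open U = (\<forall>x\<in>U. eventually (\<lambda>(x', y). x' = x \<longrightarrow> y \<in> U) uniformity)" by (rule open_l2_def)
  show "inner x y = inner y x" by (simp add: inner_l2_def mult.commute)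
  show "inner (x + y) z = inner x z + inner y z"
    unfolding inner_l2_def
    by (subst infsum_add[symmetric]) (auto intro!: summable_inner_l2 infsum_cong simp: algebra_simps simp del:
        times_complex.sel)
  show "inner (r *\<^sub>R x) y = r * inner x y"
    unfolding inner_l2_def
    by (subst infsum_cmult_right'[symmetric]) (auto intro!: infsum_cong simp: algebra_simps)
  show "0 \<le> inner x x"
    unfolding inner_l2_def Re_mult_cnj_self by (intro infsum_nonneg) simp
  show "inner x x = 0 \<longleftrightarrow> x = 0"
  proof
    assume "inner x x = 0"
    then have "(\<Sum>\<^sub>\<infinity>i. (cmod (l2f x i))\<^sup>2) \<le> 0" unfolding inner_l2_def Re_mult_cnj_self by simp
    then have "(cmod (l2f x i))\<^sup>2 = 0" for i
      using l2f[of x] by (intro nonneg_infsum_le_0D[where A = UNIV]) (auto simp: ell2_UNIV)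
    then show "x = 0" by (intro l2_eqI) simp
  qed (simp add: inner_l2_def)
  show "norm x = sqrt (inner x x)" by (rule norm_l2_def)
qed
end

lemma norm_l2_square: "(norm x)\<^sup>2 = (\<Sum>\<^sub>\<infinity>i. (cmod (l2f x i))\<^sup>2)"
  unfolding power2_norm_eq_inner inner_l2_def Re_mult_cnj_self ..

lemma norm_l2_coord: "cmod (l2f x i) \<le> norm x"
proof -
  have "(\<Sum>i\<in>{i}. (cmod (l2f x i))\<^sup>2) \<le> (norm x)\<^sup>2"
    unfolding norm_l2_square using l2f[of x]
    by (intro finite_sum_le_infsum) (auto simp: ell2_UNIV)
  then show ?thesis by (auto intro: power2_le_imp_le)
qed

instance l2 :: (type) complete_space
proof
  fix X :: "nat \<Rightarrow> 'a l2" assume X: "Cauchy X"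
  have "Cauchy (\<lambda>n. l2f (X n) i)" for i
  proof (rule metric_CauchyI)
    fix e :: real assume "e > 0"
    then obtain M where M: "\<And>m n. m \<ge> M \<Longrightarrow> n \<ge> M \<Longrightarrow> dist (X m) (X n) < e"
      using metric_CauchyD[OF X] by blast
    have "dist (l2f (X m) i) (l2f (X n) i) < e" if "m \<ge> M" "n \<ge> M" for m n
      using norm_l2_coord[of "X m - X n" i] M[OF that] by (simp add: dist_norm)
    then show "\<exists>M. \<forall>m\<ge>M. \<forall>n\<ge>M. dist (l2f (X m) i) (l2f (X n) i) < e" by blast
  qed
  then have "\<forall>i. \<exists>l. (\<lambda>n. l2f (X n) i) \<longlonglongrightarrow> l"
    by (simp add: Cauchy_convergent_iff convergent_def)
  then obtain f where f: "\<And>i. (\<lambda>n. l2f (X n) i) \<longlonglongrightarrow> f i" by metis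
  \<comment> \<open>Bounds on partial sums that are uniform over finite sets survive the
    coordinatewise limit and then pass to the infinite sum.\<close>
  have fin: "\<exists>M. \<forall>m\<ge>M. \<forall>F. finite F \<longrightarrow> (\<Sum>i\<in>F. (cmod (l2f (X m) i - f i))\<^sup>2) \<le> e\<^sup>2" if "e > 0" for e
  proof -
    obtain M where M: "\<And>m n. m \<ge> M \<Longrightarrow> n \<ge> M \<Longrightarrow> dist (X m) (X n) < e"
      using metric_CauchyD[OF X \<open>e > 0\<close>] by blast
    have "(\<Sum>i\<in>F. (cmod (l2f (X m) i - f i))\<^sup>2) \<le> e\<^sup>2" if m: "m \<ge> M" and F: "finite F" for m F
    proof (rule LIMSEQ_le_const2)
      show "(\<lambda>n. \<Sum>i\<in>F. (cmod (l2f (X m) i - l2f (X n) i))\<^sup>2) \<longlonglongrightarrow> (\<Sum>i\<in>F. (cmod (l2f (X m) i - f i))\<^sup>2)"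
        by (intro tendsto_intros f)
      show "\<exists>N. \<forall>n\<ge>N. (\<Sum>i\<in>F. (cmod (l2f (X m) i - l2f (X n) i))\<^sup>2) \<le> e\<^sup>2"
      proof (intro exI[of _ M] allI impI)
        fix n assume n: "n \<ge> M"
        have "(\<Sum>i\<in>F. (cmod (l2f (X m - X n) i))\<^sup>2) \<le> (norm (X m - X n))\<^sup>2"
          unfolding norm_l2_square using l2f[of "X m - X n"] F
          by (intro finite_sum_le_infsum) (auto simp: ell2_UNIV)
        also have "\<dots> \<le> e\<^sup>2"
          using M[OF m n] by (intro power_mono) (auto simp: dist_norm)
        finally show "(\<Sum>i\<in>F. (cmod (l2f (X m) i - l2f (X n) i))\<^sup>2) \<le> e\<^sup>2" by simp
      qed
    qed
    then show ?thesis by blast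
  qed
  have diff: "(\<lambda>i. l2f (X m) i - f i) \<in> ell2 UNIV"
    if "\<forall>F. finite F \<longrightarrow> (\<Sum>i\<in>F. (cmod (l2f (X m) i - f i))\<^sup>2) \<le> e\<^sup>2" for m e
    unfolding ell2_UNIV using that
    by (intro nonneg_bdd_above_summable_on bdd_aboveI2[where M = "e\<^sup>2"]) auto
  obtain M where "\<forall>m\<ge>M. \<forall>F. finite F \<longrightarrow> (\<Sum>i\<in>F. (cmod (l2f (X m) i - f i))\<^sup>2) \<le> 1\<^sup>2"
    using fin[of 1] by auto
  then have "(\<lambda>i. l2f (X M) i - f i) \<in> ell2 UNIV" using diff[of M 1] by blast
  from ell2_add[OF l2f[of "X M"] ell2_cmult[OF this, of "- 1"]] have f2: "f \<in> ell2 UNIV" by simp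
  define x where "x = Abs_l2 f"
  have x: "l2f x i = f i" for i unfolding x_def by (simp add: Abs_l2_inverse[OF f2])
  have "X \<longlonglongrightarrow> x"
  proof (rule metric_LIMSEQ_I)
    fix r :: real assume r: "r > 0"
    then obtain M where M: "\<And>m F. m \<ge> M \<Longrightarrow> finite F \<Longrightarrow> (\<Sum>i\<in>F. (cmod (l2f (X m) i - f i))\<^sup>2) \<le> (r / 2)\<^sup>2"
      using fin[of "r / 2"] by auto
    have "dist (X m) x < r" if "m \<ge> M" for m
    proof -
      have "(norm (X m - x))\<^sup>2 \<le> (r / 2)\<^sup>2"
        unfolding norm_l2_square using l2f[of "X m - x"] M[OF that]
        by (intro infsum_le_finite_sums) (auto simp: ell2_UNIV x)
      then have "norm (X m - x) \<le> r / 2" using r by (auto intro: power2_le_imp_le)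
      then show ?thesis using r by (simp add: dist_norm)
    qed
    then show "\<exists>no. \<forall>n\<ge>no. dist (X n) x < r" by blast
  qed
  then show "convergent X" by (auto simp: convergent_def)
qed

text \<open>The real inner product determines the complex one because Im (a * cnj b) = Re (a * cnj
  (\<i> * b)).\<close>

lemma ell2_inner_l2f:
  "ell2_inner UNIV (l2f x) (l2f y) = Complex (inner x y) (inner x (cscale \<i> y))"
proof (rule complex_eqI)
  show "Re (ell2_inner UNIV (l2f x) (l2f y)) = Re (Complex (inner x y) (inner x (cscale \<i> y)))"
    by (simp add: ell2_inner_def inner_l2_def infsum_Re[OF ell2_prod_summable, symmetric] del:
        times_complex.sel)
  show "Im (ell2_inner UNIV (l2f x) (l2f y)) = Im (Complex (inner x y) (inner x (cscale \<i> y)))"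
    by (simp add: ell2_inner_def inner_l2_def infsum_Im[OF ell2_prod_summable, symmetric])
qed

lemma ell2_norm_l2f: "ell2_norm UNIV (l2f x) = norm x"
  unfolding ell2_norm_def norm_l2_square[symmetric] by simp

lemma bounded_linear_cscale: "bounded_linear (cscale c)"
proof (rule bounded_linear_intro)
  show "cscale c (x + y) = cscale c x + cscale c y" for x y :: "'a l2"
    by (rule l2_eqI) (simp add: algebra_simps)
  show "cscale c (r *\<^sub>R x) = r *\<^sub>R cscale c x" for r and x :: "'a l2"
    by (rule l2_eqI) simp
  show "norm (cscale c x) \<le> norm x * cmod c" for x :: "'a l2"
  proof -
    have "(norm (cscale c x))\<^sup>2 = (cmod c)\<^sup>2 * (norm x)\<^sup>2"
      unfolding norm_l2_square by (simp add: norm_mult power_mult_distrib infsum_cmult_right')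
    then have "(norm (cscale c x))\<^sup>2 = (norm x * cmod c)\<^sup>2" by (simp add: power_mult_distrib)
    then show ?thesis by (simp add: power2_eq_iff_nonneg)
  qed
qed

section \<open>Composition with bijections, and unit vectors\<close>

definition pull :: "('a \<Rightarrow> 'a) \<Rightarrow> 'a l2 \<Rightarrow> 'a l2" where
  "pull \<sigma> x = Abs_l2 (\<lambda>i. l2f x (\<sigma> i))"

lemma l2f_pull [simp]: "bij \<sigma> \<Longrightarrow> l2f (pull \<sigma> x) i = l2f x (\<sigma> i)"
  using l2f[of x] unfolding pull_def
  by (subst Abs_l2_inverse)
     (auto simp: ell2_UNIV summable_on_reindex_bij_betw[of \<sigma> UNIV UNIV "\<lambda>i. (cmod (l2f x i))\<^sup>2"])

lemma inner_pull:
  assumes "bij \<sigma>"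
  shows "inner (pull \<sigma> x) (pull \<sigma> y) = inner x y"
  unfolding inner_l2_def
  using infsum_reindex_bij_betw[OF assms, of "\<lambda>i. Re (l2f x i * cnj (l2f y i))"] assms
  by (simp del: times_complex.sel)

lemma norm_pull: "bij \<sigma> \<Longrightarrow> norm (pull \<sigma> x) = norm x"
  by (simp add: norm_eq_sqrt_inner inner_pull)

lemma bounded_linear_pull:
  assumes "bij \<sigma>"
  shows "bounded_linear (pull \<sigma>)"
  using assms
  by (intro bounded_linear_intro[where K = 1]) (auto intro!: l2_eqI simp: norm_pull)

definition pt :: "'a \<Rightarrow> 'a l2" where
  "pt a = Abs_l2 (point_mass a)"

lemma l2f_pt: "l2f (pt a) = point_mass a"
proof -
  have "(\<lambda>x. (cmod (point_mass a x))\<^sup>2) summable_on UNIV"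
    by (subst summable_on_cong_neutral[where T = "{a}" and g = "\<lambda>x. (cmod (point_mass a x))\<^sup>2"])
       (auto simp: point_mass_def)
  then show ?thesis unfolding pt_def by (subst Abs_l2_inverse) (auto simp: ell2_UNIV)
qed

lemma inner_pt: "inner x (cscale c (pt a)) = Re (l2f x a * cnj c)"
proof -
  have "inner x (cscale c (pt a)) = (\<Sum>\<^sub>\<infinity>i. Re (l2f x i * cnj (c * point_mass a i)))"
    by (simp add: inner_l2_def l2f_pt del: times_complex.sel)
  also have "\<dots> = (\<Sum>\<^sub>\<infinity>i\<in>{a}. Re (l2f x i * cnj (c * point_mass a i)))"
    by (rule infsum_cong_neutral) (auto simp: point_mass_def)
  finally show ?thesis by (simp add: point_mass_def del: times_complex.sel)
qed

lemma cscale_1 [simp]: "cscale 1 x = x"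
  by (rule l2_eqI) simp

lemma inner_pt1: "inner x (pt a) = Re (l2f x a)"
  using inner_pt[of x 1 a] by simp

section \<open>Spectral measures\<close>

lemma l2f_sum: "l2f (\<Sum>i\<in>I. v i) x = (\<Sum>i\<in>I. l2f (v i) x)"
  by (induction I rule: infinite_finite_induct) simp_all

text \<open>The factor 2 adapts the contraction to a Laplacian, whose spectrum lies in [0, 2].
  \<open>E\<close> is the resolution of \<open>A\<close> with Borel sets pulled back along t |-> 2
  t.\<close>

theorem spectral_measure_exists:
  fixes A :: "'a l2 \<Rightarrow> 'a l2"
  assumes A: "positive_contraction A"
    and Ai: "\<And>v. A (cscale \<i> v) = cscale \<i> (A v)"
    and T: "\<And>v. T (l2f v) = l2f (2 *\<^sub>R A v)"
  shows "\<exists>E. is_spectral_measure UNIV T E"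
proof -
  interpret positive_contraction A by fact
  define D where "D B = (\<lambda>t::real. 2 * t) -` B" for B
  have DB[simp]: "D B \<in> sets borel" if "B \<in> sets borel" for B
    using measurable_sets[OF _ that, of "\<lambda>t. 2 * t" borel] by (simp add: D_def)
  define E where "E B h = l2f (sproj (D B) (Abs_l2 h))" for B h
  have E: "E B (l2f v) = l2f (sproj (D B) v)" for B v
    by (simp add: E_def l2f_inverse)
  have ball: "(\<forall>h\<in>ell2 UNIV. Q h) \<longleftrightarrow> (\<forall>v. Q (l2f v))" for Q :: "('a \<Rightarrow> complex) \<Rightarrow> bool"
    by (metis Abs_l2_inverse l2f)
  have sproj_i: "sproj (D B) (cscale \<i> v) = cscale \<i> (sproj (D B) v)" if "B \<in> sets borel" for B v
    by (rule sproj_commute) (use that in \<open>auto intro: bounded_linear_cscale Ai\<close>)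
  have meas: "scalar_spectral_measure UNIV E (l2f v) = distr (smeasure v) borel (\<lambda>t. 2 * t)" for v
  proof -
    interpret M: unit_interval_measure "smeasure v" by (rule unit_interval_smeasure)
    let ?N = "distr (smeasure v) borel (\<lambda>t. 2 * t)"
    have "scalar_spectral_measure UNIV E (l2f v) = measure_of (space ?N) (sets ?N) (emeasure ?N)"
      unfolding scalar_spectral_measure_def space_distr sets_distr space_borel
    proof (rule measure_of_eq)
      fix B :: "real set" assume "B \<in> sigma_sets UNIV (sets borel)"
      then have B: "B \<in> sets borel" by (metis sets.sigma_sets_eq space_borel)
      show "ennreal (Re (ell2_inner UNIV (E B (l2f v)) (l2f v))) = emeasure ?N B"
        using B inner_sproj[OF DB[OF B], of v]
        by (simp add: E ell2_inner_l2f emeasure_distr M.emeasure_eq_measure D_def[symmetric])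
    qed simp
    then show ?thesis by (simp only: measure_of_of_measure)
  qed
  have "is_spectral_measure UNIV T E"
    unfolding is_spectral_measure_def ell2_projection_def ball
  proof (intro conjI ballI allI impI)
    fix B :: "real set" and v w :: "'a l2" assume B: "B \<in> sets borel"
    show "E B (l2f v) \<in> ell2 UNIV" by (simp add: E)
    show "E B (E B (l2f v)) = E B (l2f v)" using B by (simp add: E sproj_idem)
    show "ell2_inner UNIV (E B (l2f v)) (l2f w) = ell2_inner UNIV (l2f v) (E B (l2f w))"
      using B by (simp add: E ell2_inner_l2f sproj_symmetric sproj_i[symmetric])
  next
    \<comment> \<open>The resolution is supported in [0, 2], so any radius above 2 serves.\<close>
    have "D {- 3<..<3} \<in> sets borel" by (rule DB) simp
    moreover have "{0..1} \<subseteq> D {- 3<..<3}" by (auto simp: D_def)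
    ultimately show "\<exists>a>0. \<forall>v. E {- a<..<a} (l2f v) = l2f v"
      by (intro exI[of _ 3]) (simp add: E sproj_unit)
  next
    fix B C :: "real set" and v assume B: "B \<in> sets borel" "C \<in> sets borel"
    have "D (B \<inter> C) = D B \<inter> D C" by (auto simp: D_def)
    then show "E (B \<inter> C) (l2f v) = E B (E C (l2f v))"
      using B by (simp add: E sproj_inter)
  next
    fix B :: "nat \<Rightarrow> real set" and v assume B: "range B \<subseteq> sets borel" "disjoint_family B"
    have U: "D (\<Union>i. B i) = (\<Union>i. D (B i))" by (auto simp: D_def)
    have "disjoint_family (\<lambda>i. D (B i))" using B(2) by (auto simp: D_def disjoint_family_on_def)
    moreover have "D (B i) \<in> sets borel" for i using B(1) by auto
    moreover have "ell2_norm UNIV (\<lambda>x. E (\<Union>i. B i) (l2f v) x - (\<Sum>i<n. E (B i) (l2f v) x))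
        = norm (sproj (\<Union>i. D (B i)) v - (\<Sum>i<n. sproj (D (B i)) v))" for n
    proof -
      have "(\<lambda>x. E (\<Union>i. B i) (l2f v) x - (\<Sum>i<n. E (B i) (l2f v) x))
        = l2f (sproj (\<Union>i. D (B i)) v - (\<Sum>i<n. sproj (D (B i)) v))"
        by (rule ext) (simp add: E U l2f_sum)
      then show ?thesis by (simp only: ell2_norm_l2f)
    qed
    ultimately show "(\<lambda>n. ell2_norm UNIV (\<lambda>x. E (\<Union>i. B i) (l2f v) x - (\<Sum>i<n. E (B i) (l2f v) x))) \<longlonglongrightarrow> 0"
      using sproj_sums[of "\<lambda>i. D (B i)" v] by simp
  next
    fix v
    have m: "(\<lambda>t. 2 * t) \<in> borel_measurable (smeasure v)"
    proof -
      have "measurable (smeasure v) (borel :: real measure) = measurable borel borel"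
        by (rule measurable_cong_sets) (simp_all add: unit_interval_measure.sets_M[OF unit_interval_smeasure])
      moreover have "(\<lambda>t::real. 2 * t) \<in> measurable borel borel" by measurable
      ultimately show ?thesis by blast
    qed
    show "integrable (scalar_spectral_measure UNIV E (l2f v)) (\<lambda>t. t)"
      unfolding meas
      by (rule iffD2[OF integrable_distr_eq[OF m]])
         (auto intro: integrable_mult_right smeasure_mean(1)[of v])
    \<comment> \<open>The quadratic form of a symmetric operator that commutes with \<i> is
      real.\<close>
    have "inner (A v) (cscale \<i> v) = 0"
    proof -
      have i: "inner (cscale \<i> x) y = - inner x (cscale \<i> y)" for x y :: "'a l2"
        unfolding inner_l2_def by (simp add: infsum_uminus[symmetric] algebra_simps)
      have "inner (A v) (cscale \<i> v) = inner v (cscale \<i> (A v))"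
        by (simp add: symmetric Ai)
      also have "\<dots> = - inner (A v) (cscale \<i> v)"
        using i[of v "A v"] by (simp add: inner_commute)
      finally show ?thesis by simp
    qed
    moreover have "(\<integral>t. t \<partial>scalar_spectral_measure UNIV E (l2f v)) = 2 * inner (A v) v"
    proof -
      have "(\<integral>t. t \<partial>distr (smeasure v) borel (\<lambda>t. 2 * t)) = (\<integral>t. 2 * t \<partial>smeasure v)"
        by (rule integral_distr[OF m]) simp
      then show ?thesis unfolding meas using smeasure_mean[of v] by simp
    qed
    ultimately show "ell2_inner UNIV (T (l2f v)) (l2f v)
        = complex_of_real (\<integral>t. t \<partial>scalar_spectral_measure UNIV E (l2f v))"
      by (simp add: T ell2_inner_l2f complex_eq_iff)
  qed
  then show ?thesis by blast
qed

section \<open>Consequences of the defining properties of a spectral measure\<close>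

locale spectral_resolution =
  fixes T E and L :: "'a l2 \<Rightarrow> 'a l2"
  assumes E: "is_spectral_measure UNIV T E"
    and T: "T (l2f v) = l2f (L v)"
    and linear_L: "linear L"
    and symmetric_L: "inner (L v) w = inner v (L w)"
begin

text \<open>The given \<open>E\<close> as maps on the type of vectors. As
  \<open>spectral_projection\<close> is known only through its defining properties, the facts below
  come from these and not from the construction above.\<close>

definition P :: "real set \<Rightarrow> 'a l2 \<Rightarrow> 'a l2" where
  "P B v = Abs_l2 (E B (l2f v))"

lemma l2f_P: "B \<in> sets borel \<Longrightarrow> l2f (P B v) = E B (l2f v)"
  using E unfolding P_def is_spectral_measure_def ell2_projection_def
  by (simp add: Abs_l2_inverse)

lemma P_idem: "B \<in> sets borel \<Longrightarrow> P B (P B v) = P B v"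
  using E unfolding is_spectral_measure_def ell2_projection_def
  by (simp add: l2f_inject[symmetric] l2f_P)

lemma P_symmetric: "B \<in> sets borel \<Longrightarrow> inner (P B v) w = inner v (P B w)"
proof -
  assume B: "B \<in> sets borel"
  have "ell2_inner UNIV (l2f (P B v)) (l2f w) = ell2_inner UNIV (l2f v) (l2f (P B w))"
    using E B unfolding is_spectral_measure_def ell2_projection_def by (simp add: l2f_P)
  then show ?thesis by (simp add: ell2_inner_l2f)
qed

lemma P_inter: "B \<in> sets borel \<Longrightarrow> C \<in> sets borel \<Longrightarrow> P (B \<inter> C) v = P B (P C v)"
  using E unfolding is_spectral_measure_def by (simp add: l2f_inject[symmetric] l2f_P)

lemma P_sums:
  assumes "\<And>i::nat. B i \<in> sets borel" "disjoint_family B"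
  shows "(\<lambda>n. \<Sum>i<n. P (B i) v) \<longlonglongrightarrow> P (\<Union>i. B i) v"
proof -
  have "(\<lambda>n. ell2_norm UNIV (\<lambda>x. E (\<Union>i. B i) (l2f v) x - (\<Sum>i<n. E (B i) (l2f v) x))) \<longlonglongrightarrow> 0"
    using E[unfolded is_spectral_measure_def] assms l2f[of v] by (simp add: image_subset_iff)
  moreover have "(\<lambda>x. E (\<Union>i. B i) (l2f v) x - (\<Sum>i<n. E (B i) (l2f v) x))
      = l2f (P (\<Union>i. B i) v - (\<Sum>i<n. P (B i) v))" for n
    using assms(1) by (intro ext) (simp add: l2f_sum l2f_P sets.countable_UN)
  ultimately have "(\<lambda>n. norm (P (\<Union>i. B i) v - (\<Sum>i<n. P (B i) v))) \<longlonglongrightarrow> 0"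
    by (simp add: ell2_norm_l2f)
  then have "(\<lambda>n. P (\<Union>i. B i) v - (\<Sum>i<n. P (B i) v)) \<longlonglongrightarrow> 0"
    by (simp add: tendsto_norm_zero_iff)
  from tendsto_diff[OF tendsto_const[of "P (\<Union>i. B i) v"] this] show ?thesis by simp
qed

text \<open>The partial sums n * \<open>P {} v\<close> converge, so their consecutive differences,
  all equal to \<open>P {} v\<close>, tend to 0.\<close>

lemma P_empty: "P {} v = 0"
proof -
  have "(\<lambda>n. \<Sum>i<n. P {} v) \<longlonglongrightarrow> P {} v"
    using P_sums[of "\<lambda>_. {}" v] by (simp add: disjoint_family_on_def)
  then have "(\<lambda>n. (\<Sum>i<Suc n. P {} v) - (\<Sum>i<n. P {} v)) \<longlonglongrightarrow> P {} v - P {} v"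
    by (intro tendsto_diff LIMSEQ_Suc)
  moreover have "(\<lambda>n. (\<Sum>i<Suc n. P {} v) - (\<Sum>i<n. P {} v)) = (\<lambda>n. P {} v)"
    by (rule ext) (simp only: sum.lessThan_Suc add_diff_cancel_left')
  ultimately have "(\<lambda>n::nat. P {} v) \<longlonglongrightarrow> 0" by (simp only: diff_self)
  then show ?thesis by (simp add: LIMSEQ_const_iff)
qed

lemma P_UNIV: "P UNIV v = v"
proof -
  obtain a where a: "\<And>h. h \<in> ell2 UNIV \<Longrightarrow> E {-a<..<a} h = h"
    using E[unfolded is_spectral_measure_def, THEN conjunct2, THEN conjunct1] by auto
  have "P {-a<..<a} v = v" by (simp add: P_def a l2f_inverse)
  moreover have "P (UNIV \<inter> {-a<..<a}) v = P UNIV (P {-a<..<a} v)" by (rule P_inter) auto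
  ultimately show ?thesis by simp
qed

lemma P_compl: "B \<in> sets borel \<Longrightarrow> P B v + P (- B) v = v"
proof -
  assume B: "B \<in> sets borel"
  \<comment> \<open>Padding with empty sets reduces the two-set case to countable
    additivity.\<close>
  define C where "C i = (if i = 0 then B else if i = 1 then - B else {})" for i :: nat
  have C: "C i \<in> sets borel" for i using B by (auto simp: C_def)
  have "(\<lambda>n. \<Sum>i<n. P (C i) v) \<longlonglongrightarrow> P (\<Union>i. C i) v"
    by (rule P_sums[OF C]) (auto simp: disjoint_family_on_def C_def)
  moreover have "(\<Union>i. C i) = UNIV" by (auto simp: C_def)
  moreover have "(\<Sum>i<Suc (Suc n). P (C i) v) = P B v + P (- B) v" for n
    by (induction n) (simp_all add: C_def P_empty)
  ultimately show ?thesis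
    using LIMSEQ_ignore_initial_segment[of "\<lambda>n. \<Sum>i<n. P (C i) v" "P UNIV v" 2]
    by (simp add: P_UNIV LIMSEQ_const_iff del: sum.lessThan_Suc)
qed

lemma P_add: "B \<in> sets borel \<Longrightarrow> P B (v + w) = P B v + P B w"
proof -
  assume B: "B \<in> sets borel"
  have "inner (P B (v + w) - (P B v + P B w)) z = 0" for z
    using B by (simp add: inner_diff_left inner_add_left P_symmetric)
  then have "P B (v + w) - (P B v + P B w) = 0" by (metis inner_eq_zero_iff)
  then show ?thesis by simp
qed

lemma P_disjoint: "B \<in> sets borel \<Longrightarrow> P B (P (- B) v) = 0" "B \<in> sets borel \<Longrightarrow> P (- B) (P B v) = 0"
  using P_inter[of B "- B" v] P_inter[of "- B" B v] by (simp_all add: P_empty)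

lemma inner_P_nonneg: "B \<in> sets borel \<Longrightarrow> inner (P B v) v = (norm (P B v))\<^sup>2"
  by (metis P_idem P_symmetric power2_norm_eq_inner)

definition mu :: "'a l2 \<Rightarrow> real measure" where
  "mu v = scalar_spectral_measure UNIV E (l2f v)"

lemma sets_mu [simp, measurable_cong]: "sets (mu v) = sets borel"
  unfolding mu_def scalar_spectral_measure_def
  by (simp add: sets_measure_of) (metis sets.sigma_sets_eq space_borel)

lemma space_mu [simp]: "space (mu v) = UNIV"
  using sets_mu[THEN sets_eq_imp_space_eq] by simp

lemma emeasure_mu: "B \<in> sets borel \<Longrightarrow> emeasure (mu v) B = ennreal (inner (P B v) v)"
proof -
  assume B: "B \<in> sets borel"
  have Re: "Re (ell2_inner UNIV (E C (l2f v)) (l2f v)) = inner (P C v) v" if "C \<in> sets borel" for C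
    using that by (simp add: l2f_P[symmetric] ell2_inner_l2f)
  have "emeasure (mu v) B = ennreal (Re (ell2_inner UNIV (E B (l2f v)) (l2f v)))"
    unfolding mu_def scalar_spectral_measure_def
  proof (rule emeasure_measure_of_sigma)
    show "sigma_algebra UNIV (sets (borel :: real measure))"
      by (metis sets.sigma_algebra_axioms space_borel)
    show "positive (sets borel) (\<lambda>B. ennreal (Re (ell2_inner UNIV (E B (l2f v)) (l2f v))))"
      by (simp add: positive_def Re P_empty)
    show "countably_additive (sets borel) (\<lambda>B. ennreal (Re (ell2_inner UNIV (E B (l2f v)) (l2f v))))"
    proof (rule countably_additiveI)
      fix C :: "nat \<Rightarrow> real set" assume C: "range C \<subseteq> sets borel" "disjoint_family C"
      have Cb: "C i \<in> sets borel" for i using C by auto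
      have Cu: "(\<Union>i. C i) \<in> sets borel" using Cb by auto
      have "(\<lambda>n. inner (\<Sum>i<n. P (C i) v) v) \<longlonglongrightarrow> inner (P (\<Union>i. C i) v) v"
        by (intro tendsto_intros P_sums Cb C)
      then have "(\<lambda>i. inner (P (C i) v) v) sums inner (P (\<Union>i. C i) v) v"
        by (simp add: sums_def inner_sum_left)
      then have "(\<lambda>i. ennreal (inner (P (C i) v) v)) sums ennreal (inner (P (\<Union>i. C i) v) v)"
        by (subst sums_ennreal) (auto simp: inner_P_nonneg Cb Cu)
      then have "(\<Sum>i. ennreal (inner (P (C i) v) v)) = ennreal (inner (P (\<Union>i. C i) v) v)"
        by (rule sums_unique[symmetric])
      then show "(\<Sum>i. ennreal (Re (ell2_inner UNIV (E (C i) (l2f v)) (l2f v))))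
          = ennreal (Re (ell2_inner UNIV (E (\<Union>i. C i) (l2f v)) (l2f v)))"
        using Re[OF Cb] Re[OF Cu] by simp
    qed
    show "B \<in> sets borel" by fact
  qed
  then show ?thesis using Re[OF B] by simp
qed

lemma inner_L: "integrable (mu v) (\<lambda>t. t)" "inner (L v) v = (\<integral>t. t \<partial>mu v)"
proof -
  have "integrable (mu v) (\<lambda>t. t) \<and> ell2_inner UNIV (T (l2f v)) (l2f v) = complex_of_real (\<integral>t. t \<partial>mu v)"
    using E unfolding is_spectral_measure_def mu_def by simp
  then show "integrable (mu v) (\<lambda>t. t)" "inner (L v) v = (\<integral>t. t \<partial>mu v)"
    by (simp_all add: T ell2_inner_l2f complex_eq_iff)
qed

text \<open>By symmetry and multiplicativity the form of \<open>P C\<close> at \<open>P B v\<close>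
  equals that of \<open>P (C \<inter> B)\<close> at \<open>v\<close>.\<close>

lemma mu_P:
  assumes B: "B \<in> sets borel"
  shows "mu (P B v) = density (mu v) (indicator B)"
proof (rule measure_eqI)
  fix C assume "C \<in> sets (mu (P B v))"
  then have C: "C \<in> sets borel" by simp
  have CB: "C \<inter> B \<in> sets borel" using B C by simp
  have "inner (P C (P B v)) (P B v) = inner (P B (P C (P B v))) v"
    using B by (simp add: P_symmetric)
  also have "P B (P C (P B v)) = P (B \<inter> (C \<inter> B)) v"
    using B C CB by (simp add: P_inter del: Int_left_absorb)
  also have "B \<inter> (C \<inter> B) = C \<inter> B" by blast
  finally have "emeasure (mu (P B v)) C = emeasure (mu v) (C \<inter> B)"
    using C CB by (simp add: emeasure_mu)
  also have "\<dots> = emeasure (density (mu v) (indicator B)) C"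
    using B C CB by (simp add: emeasure_density nn_integral_indicator indicator_inter_arith[symmetric]
        Int_commute)
  finally show "emeasure (mu (P B v)) C = emeasure (density (mu v) (indicator B)) C" .
qed simp

lemma inner_L_P:
  assumes B: "B \<in> sets borel"
  shows "inner (L (P B v)) (P B v) = (\<integral>t. indicator B t * t \<partial>mu v)"
proof -
  have "(\<integral>t. t \<partial>density (mu v) (\<lambda>t. ennreal (indicator B t))) = (\<integral>t. indicator B t *\<^sub>R t \<partial>mu v)"
    using B by (intro integral_density) auto
  then show ?thesis by (simp add: inner_L(2) mu_P[OF B] ennreal_indicator)
qed

lemma integrable_mu_ind: "B \<in> sets borel \<Longrightarrow> integrable (mu v) (\<lambda>t. indicator B t * t)"
  using integrable_mult_indicator[of B "mu v" "\<lambda>t. t"] inner_L(1) by simp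

lemma inner_L_le: "inner (L (P {..l} v)) (P {..l} v) \<le> l * (norm (P {..l} v))\<^sup>2"
proof -
  have "(\<integral>t. indicator {..l} t * t \<partial>mu v) \<le> (\<integral>t. indicator {..l} t * l \<partial>mu v)"
  proof (rule integral_mono)
    show "integrable (mu v) (\<lambda>t. indicator {..l} t * l)"
      by (intro integrable_mult_left integrable_real_indicator) (simp_all add: emeasure_mu)
    show "indicator {..l} t * t \<le> indicator {..l} t * l" for t by (simp add: indicator_def)
  qed (simp add: integrable_mu_ind)
  also have "\<dots> = l * measure (mu v) {..l}" by simp
  also have "measure (mu v) {..l} = (norm (P {..l} v))\<^sup>2"
    using emeasure_mu[of "{..l}" v] inner_P_nonneg[of "{..l}" v] by (simp add: measure_def)
  finally show ?thesis by (simp add: inner_L_P)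
qed

text \<open>The integral of t splits over B and its complement, so the form of \<open>L\<close> at
  \<open>x\<close> is the sum of its values at the two components, and the cross terms vanish. The
  vector \<open>P B v + P (- B) w\<close> then separates \<open>v\<close> from
  \<open>w\<close>.\<close>

lemma L_orthogonal:
  assumes B: "B \<in> sets borel"
  shows "inner (L (P B v)) (P (- B) w) = 0"
proof -
  have mB: "- B \<in> sets borel" using B by auto
  have *: "inner (L (P B x)) (P (- B) x) = 0" for x
  proof -
    have "(\<integral>t. t \<partial>mu x) = (\<integral>t. indicator B t * t + indicator (- B) t * t \<partial>mu x)"
      by (intro Bochner_Integration.integral_cong) (auto simp: indicator_def)
    also have "\<dots> = inner (L (P B x)) (P B x) + inner (L (P (- B) x)) (P (- B) x)"
      using B mB by (simp add: inner_L_P integrable_mu_ind)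
    finally have "inner (L x) x = inner (L (P B x)) (P B x) + inner (L (P (- B) x)) (P (- B) x)"
      by (simp add: inner_L(2))
    moreover have "inner (L x) x = inner (L (P B x + P (- B) x)) (P B x + P (- B) x)"
      by (simp add: P_compl B)
    moreover have "inner (L (P (- B) x)) (P B x) = inner (L (P B x)) (P (- B) x)"
      by (metis inner_commute symmetric_L)
    ultimately show ?thesis
      by (simp add: linear_add[OF linear_L] inner_add_left inner_add_right)
  qed
  have "P B (P B v + P (- B) w) = P B v" "P (- B) (P B v + P (- B) w) = P (- B) w"
    using B mB by (simp_all add: P_add P_idem P_disjoint)
  then show ?thesis using *[of "P B v + P (- B) w"] by simp
qed

lemma L_invariant:
  assumes B: "B \<in> sets borel"
  shows "P B (L (P B v)) = L (P B v)"
proof -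
  have mB: "- B \<in> sets borel" using B by auto
  have "inner (P (- B) (L (P B v))) w = 0" for w
    using L_orthogonal[OF B, of v w] P_symmetric[OF mB] by simp
  then have "P (- B) (L (P B v)) = 0" by (metis inner_eq_zero_iff)
  then show ?thesis using P_compl[OF B, of "L (P B v)"] by simp
qed

text \<open>Induction in steps of two: the form of S^(n+2) at \<open>v\<close> is the form of S^n at
  \<open>S v\<close>, and Cauchy-Schwarz gives c * norm v \<le> norm (S v).\<close>

lemma power_lower_bound:
  fixes S :: "'a l2 \<Rightarrow> 'a l2"
  assumes inv: "\<And>v. v \<in> V \<Longrightarrow> S v \<in> V" and sym: "\<And>v w. inner (S v) w = inner v (S w)"
    and c: "\<And>v. v \<in> V \<Longrightarrow> c * (norm v)\<^sup>2 \<le> inner (S v) v" "0 \<le> c"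
  shows "v \<in> V \<Longrightarrow> c ^ n * (norm v)\<^sup>2 \<le> inner ((S ^^ n) v) v"
proof (induction n arbitrary: v rule: induct_nat_012)
  case 0 then show ?case by (simp add: power2_norm_eq_inner)
next
  case 1 then show ?case using c by simp
next
  case (ge2 n)
  have "(S ^^ n) (S v) = S ((S ^^ n) v)" for v by (metis funpow_swap1)
  then have "inner ((S ^^ Suc (Suc n)) v) v = inner ((S ^^ n) (S v)) (S v)"
    by (simp add: sym)
  also have "\<dots> \<ge> c ^ n * (norm (S v))\<^sup>2" using ge2 inv by simp
  finally have 1: "c ^ n * (norm (S v))\<^sup>2 \<le> inner ((S ^^ Suc (Suc n)) v) v" .
  have "c * norm v \<le> norm (S v)"
  proof (cases "v = 0")
    case False
    have "c * norm v * norm v \<le> norm (S v) * norm v"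
      using c(1)[OF ge2.prems] norm_cauchy_schwarz[of "S v" v] by (simp add: power2_eq_square mult.assoc)
    then show ?thesis using False by simp
  qed simp
  then have "(c * norm v)\<^sup>2 \<le> (norm (S v))\<^sup>2" using c(2) by (intro power_mono) auto
  then have "c ^ n * (c * norm v)\<^sup>2 \<le> c ^ n * (norm (S v))\<^sup>2" using c(2) by (intro mult_left_mono) auto
  with 1 show ?case by (simp add: power_mult_distrib power2_eq_square algebra_simps)
qed

text \<open>\<open>S\<close> preserves the range of \<open>P {..l}\<close> and its complement, so
  the powers have no cross terms. On the first part \<open>S\<close> is at least 1 - l/2, on the
  second at least 0.\<close>

lemma spectral_distribution_power_bound:
  assumes S: "\<And>v. S v = v - (1 / 2) *\<^sub>R L v" and pos: "\<And>v. 0 \<le> inner (S v) v"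
    and l: "l \<le> 2"
  shows "(1 - l / 2) ^ n * (norm (P {..l} v))\<^sup>2 \<le> inner ((S ^^ n) v) v"
proof -
  let ?B = "{..l}"
  have B: "?B \<in> sets borel" "- ?B \<in> sets borel" by auto
  have symS: "inner (S v) w = inner v (S w)" for v w
    by (simp add: S inner_diff_left inner_diff_right symmetric_L)
  have Sadd: "S (v + w) = S v + S w" for v w
    by (simp add: S linear_add[OF linear_L] scaleR_add_right)
  have Sn: "(S ^^ n) (v + w) = (S ^^ n) v + (S ^^ n) w" for v w n
    by (induction n) (simp_all add: Sadd)
  have Pdiff: "P C (v - r *\<^sub>R w) = P C v - r *\<^sub>R P C w" if C: "C \<in> sets borel" for C v w r
  proof -
    have "inner (P C (v - r *\<^sub>R w) - (P C v - r *\<^sub>R P C w)) z = 0" for z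
      using C by (simp add: inner_diff_left P_symmetric)
    then have "P C (v - r *\<^sub>R w) - (P C v - r *\<^sub>R P C w) = 0" by (metis inner_eq_zero_iff)
    then show ?thesis by simp
  qed
  have inv: "P C (S v) = S v" if "P C v = v" "C \<in> sets borel" for C v
    using that L_invariant[of C v] by (simp add: S Pdiff)
  have invn: "P C ((S ^^ n) v) = (S ^^ n) v" if "P C v = v" "C \<in> sets borel" for C v n
    by (induction n) (use that inv in auto)
  have orth: "inner ((S ^^ n) (P C v)) (P (- C) w) = 0" if C: "C \<in> sets borel" for C v w
  proof -
    have mC: "- C \<in> sets borel" using C by auto
    have "inner ((S ^^ n) (P C v)) (P (- C) w) = inner (P C ((S ^^ n) (P C v))) (P (- C) w)"
      using invn[OF P_idem[OF C] C] by simp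
    also have "\<dots> = inner ((S ^^ n) (P C v)) (P C (P (- C) w))" by (rule P_symmetric[OF C])
    finally show ?thesis by (simp add: P_disjoint C)
  qed
  have "inner ((S ^^ n) v) v = inner ((S ^^ n) (P ?B v + P (- ?B) v)) (P ?B v + P (- ?B) v)"
    by (simp only: P_compl[OF B(1)])
  also have "\<dots> = inner ((S ^^ n) (P ?B v)) (P ?B v) + inner ((S ^^ n) (P (- ?B) v)) (P (- ?B) v)"
    using orth[OF B(1), of v v] orth[OF B(2), of v v]
    by (simp add: Sn inner_add_left inner_add_right)
  \<comment> \<open>Taking the constant 0 gives nonnegativity; for n = 0 the factor is 0^0 = 1,
    which is harmless.\<close>
  also have "inner ((S ^^ n) (P (- ?B) v)) (P (- ?B) v) \<ge> 0 ^ n * (norm (P (- ?B) v))\<^sup>2"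
    by (rule power_lower_bound[where V = UNIV]) (auto simp: symS pos[unfolded symS])
  moreover have "(0::real) ^ n * (norm (P (- ?B) v))\<^sup>2 \<ge> 0" by simp
  moreover have "(1 - l / 2) ^ n * (norm (P ?B v))\<^sup>2 \<le> inner ((S ^^ n) (P ?B v)) (P ?B v)"
  proof (rule power_lower_bound[where V = "{v. P ?B v = v}"])
    fix w assume w: "w \<in> {v. P ?B v = v}"
    then have Pw: "P ?B w = w" by simp
    show "S w \<in> {v. P ?B v = v}" using inv[OF Pw B(1)] by simp
    show "(1 - l / 2) * (norm w)\<^sup>2 \<le> inner (S w) w"
      using inner_L_le[of l w] unfolding Pw
      by (simp add: S inner_diff_left power2_norm_eq_inner[symmetric] algebra_simps)
  qed (use l symS in \<open>auto simp: P_idem\<close>)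
  ultimately show ?thesis by linarith
qed

end

section \<open>Convolution operators and their trace\<close>

text \<open>The carrier fills the type, so that \<open>'a l2\<close> is the Hilbert space of the
  group.\<close>

locale full_group = group G for G :: "'a monoid" (structure) +
  assumes carrier_UNIV [simp]: "carrier G = UNIV"
begin

lemma gassoc: "(x \<otimes> y) \<otimes> z = x \<otimes> (y \<otimes> z)"
  by (rule m_assoc) simp_all

lemma ginv_mult: "inv (x \<otimes> y) = inv y \<otimes> inv x"
  by (rule inv_mult_group) simp_all

lemma gcancel [simp]: "inv x \<otimes> (x \<otimes> y) = y" "x \<otimes> (inv x \<otimes> y) = y"
  "inv x \<otimes> x = \<one>" "x \<otimes> inv x = \<one>" "inv (inv x) = x" "\<one> \<otimes> x = x" "x \<otimes> \<one> = x"
  by (simp_all add: gassoc[symmetric])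

lemma bij_inv: "bij (\<lambda>x. inv x)"
  by (rule bij_betw_byWitness[where f' = "\<lambda>x. inv x"]) auto

lemma bij_rmult: "bij (\<lambda>x. x \<otimes> g)"
  by (rule bij_betw_byWitness[where f' = "\<lambda>x. x \<otimes> inv g"]) (auto simp: gassoc)

lemma bij_lmult: "bij (\<lambda>x. g \<otimes> x)"
  by (rule bij_betw_byWitness[where f' = "\<lambda>x. inv g \<otimes> x"]) auto

abbreviation \<delta> :: "'a l2" where "\<delta> \<equiv> pt \<one>"

definition rt :: "'a \<Rightarrow> 'a l2 \<Rightarrow> 'a l2" where "rt g = pull (\<lambda>x. x \<otimes> inv g)"

definition lt :: "'a \<Rightarrow> 'a l2 \<Rightarrow> 'a l2" where "lt g = pull (\<lambda>x. inv g \<otimes> x)"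

lemma l2f_rt [simp]: "l2f (rt g v) x = l2f v (x \<otimes> inv g)"
  by (simp add: rt_def bij_rmult)

lemma l2f_lt [simp]: "l2f (lt g v) x = l2f v (inv g \<otimes> x)"
  by (simp add: lt_def bij_lmult)

lemma bounded_linear_rt: "bounded_linear (rt g)"
  unfolding rt_def by (intro bounded_linear_pull bij_rmult)

lemma bounded_linear_lt: "bounded_linear (lt g)"
  unfolding lt_def by (intro bounded_linear_pull bij_lmult)

lemma norm_rt [simp]: "norm (rt g v) = norm v"
  by (simp add: rt_def norm_pull bij_rmult)

lemma inner_rt: "inner (rt g v) w = inner v (rt (inv g) w)"
proof -
  have "rt g (rt (inv g) w) = w" by (rule l2_eqI) (simp add: gassoc)
  then have "inner (rt g v) w = inner (rt g v) (rt g (rt (inv g) w))" by simp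
  then show ?thesis by (simp add: rt_def inner_pull bij_rmult)
qed

lemma inner_lt: "inner (lt g v) w = inner v (lt (inv g) w)"
proof -
  have "lt g (lt (inv g) w) = w" by (rule l2_eqI) simp
  then have "inner (lt g v) w = inner (lt g v) (lt g (lt (inv g) w))" by simp
  then show ?thesis by (simp add: lt_def inner_pull bij_lmult)
qed

lemma lt_pt: "lt g (pt x) = pt (g \<otimes> x)"
  by (rule l2_eqI) (auto simp: l2f_pt point_mass_def gassoc[symmetric])

text \<open>Compatibility with \<open>cscale \<i>\<close> makes a real-linear operator
  complex-linear; these operators form the von Neumann algebra of the right translations. On it X
  |-> \<open>inner (X \<delta>) \<delta>\<close> is the real part of the trace.\<close>

definition equivariant :: "('a l2 \<Rightarrow> 'a l2) \<Rightarrow> bool" where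
  "equivariant X \<longleftrightarrow> bounded_linear X \<and> (\<forall>g v. X (lt g v) = lt g (X v)) \<and> (\<forall>v. X (cscale \<i> v) = cscale \<i> (X v))"

definition adjoint_pair :: "('a l2 \<Rightarrow> 'a l2) \<Rightarrow> ('a l2 \<Rightarrow> 'a l2) \<Rightarrow> bool" where
  "adjoint_pair X Y \<longleftrightarrow> (\<forall>v w. inner (X v) w = inner v (Y w))"

lemma equivariant_comp: "equivariant X \<Longrightarrow> equivariant Y \<Longrightarrow> equivariant (\<lambda>v. X (Y v))"
  unfolding equivariant_def using bounded_linear_compose by auto

lemma equivariant_id: "equivariant (\<lambda>v. v)"
  unfolding equivariant_def by simp

lemma equivariant_funpow: "equivariant X \<Longrightarrow> equivariant (\<lambda>v. (X ^^ n) v)"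
  by (induction n) (simp_all add: equivariant_id id_def o_def equivariant_comp)

lemma lin_simps:
  "bounded_linear X \<Longrightarrow> X (v + w) = X v + X w" "bounded_linear X \<Longrightarrow> X (c *\<^sub>R v) = c *\<^sub>R X v"
  for X :: "'b::real_normed_vector \<Rightarrow> 'c::real_normed_vector"
  by (simp_all add: bounded_linear.linear linear_add linear_scale)

lemma equivariant_add: "equivariant X \<Longrightarrow> equivariant Y \<Longrightarrow> equivariant (\<lambda>v. X v + Y v)"
  unfolding equivariant_def
  by (simp add: bounded_linear_add lin_simps bounded_linear_lt bounded_linear_cscale)

lemma equivariant_scaleR: "equivariant X \<Longrightarrow> equivariant (\<lambda>v. c *\<^sub>R X v)"
  unfolding equivariant_def
  by (auto simp: lin_simps bounded_linear_lt bounded_linear_cscale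
      intro: bounded_linear_compose[OF bounded_linear_scaleR_right])

lemma equivariant_zero: "equivariant (\<lambda>v. 0)"
  using equivariant_scaleR[OF equivariant_id, of 0] by simp

lemma equivariant_sum: "(\<And>i. i \<in> I \<Longrightarrow> equivariant (X i)) \<Longrightarrow> equivariant (\<lambda>v. \<Sum>i\<in>I. X i v)"
  by (induction I rule: infinite_finite_induct) (simp_all add: equivariant_zero equivariant_add)

lemma equivariant_rt: "equivariant (rt g)"
  unfolding equivariant_def using bounded_linear_rt by (auto intro!: l2_eqI simp: gassoc)

section \<open>Symmetry and monotonicity of the trace\<close>

lemma cscale_i_adjoint: "inner (cscale \<i> x) y = - inner x (cscale \<i> y)" for x y :: "'a l2"
  unfolding inner_l2_def by (simp add: infsum_uminus[symmetric] algebra_simps)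

text \<open>By equivariance \<open>X (pt x)\<close> is a left translate of
  \<open>X \<delta>\<close>, which moves the coordinate x to its inverse. Testing with
  \<open>pt x\<close> and \<open>cscale \<i> (pt x)\<close> gives real and imaginary parts.\<close>

lemma adjoint_coordinate:
  assumes X: "equivariant X" and adj: "adjoint_pair X X'"
  shows "l2f (X' \<delta>) x = cnj (l2f (X \<delta>) (inv x))"
proof (rule complex_eqI)
  have ptx: "pt x = lt x \<delta>" and ptix: "pt (inv x) = lt (inv x) \<delta>" by (simp_all add: lt_pt)
  have Xlt: "\<And>g v. X (lt g v) = lt g (X v)" and Xi: "\<And>v. X (cscale \<i> v) = cscale \<i> (X v)"
    using X by (auto simp: equivariant_def)
  have lti: "lt g (cscale \<i> v) = cscale \<i> (lt g v)" for g v by (rule l2_eqI) simp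
  have adj': "inner (X' v) w = inner v (X w)" for v w using adj unfolding adjoint_pair_def
      by (metis inner_commute)
  have "inner (X' \<delta>) (pt x) = inner \<delta> (lt x (X \<delta>))"
    unfolding ptx adj' Xlt ..
  also have "\<dots> = inner (X \<delta>) (pt (inv x))"
    unfolding ptix by (metis inner_commute inner_lt)
  finally show "Re (l2f (X' \<delta>) x) = Re (cnj (l2f (X \<delta>) (inv x)))"
    by (simp add: inner_pt1)
  have "inner (X' \<delta>) (cscale \<i> (pt x)) = inner \<delta> (lt x (cscale \<i> (X \<delta>)))"
    unfolding ptx adj' Xi Xlt lti ..
  also have "\<dots> = inner (cscale \<i> (X \<delta>)) (pt (inv x))"
    unfolding ptix by (metis inner_commute inner_lt)
  also have "\<dots> = - inner (X \<delta>) (cscale \<i> (pt (inv x)))" by (rule cscale_i_adjoint)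
  finally show "Im (l2f (X' \<delta>) x) = Im (cnj (l2f (X \<delta>) (inv x)))"
    by (simp add: inner_pt)
qed

text \<open>With a and b the coordinates of \<open>X \<delta>\<close> and \<open>Y \<delta>\<close>,
  both sides are sums of Re (b x * a (inv x)), up to the substitution of inv x for x.\<close>

lemma trace_commute:
  assumes X: "equivariant X" "adjoint_pair X X'" and Y: "equivariant Y" "adjoint_pair Y Y'"
  shows "inner (X (Y \<delta>)) \<delta> = inner (Y (X \<delta>)) \<delta>"
proof -
  let ?a = "l2f (X \<delta>)" and ?b = "l2f (Y \<delta>)"
  have "inner (X (Y \<delta>)) \<delta> = inner (Y \<delta>) (X' \<delta>)"
    using X by (simp add: adjoint_pair_def)
  also have "\<dots> = (\<Sum>\<^sub>\<infinity>x. Re (?b x * ?a (inv x)))"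
    unfolding inner_l2_def adjoint_coordinate[OF X] by simp
  also have "\<dots> = (\<Sum>\<^sub>\<infinity>x. Re (?b (inv x) * ?a (inv (inv x))))"
    using infsum_reindex_bij_betw[OF bij_inv, of "\<lambda>x. Re (?b x * ?a (inv x))"] by (rule sym)
  also have "\<dots> = inner (X \<delta>) (Y' \<delta>)"
    unfolding inner_l2_def adjoint_coordinate[OF Y] by (simp add: mult.commute)
  also have "\<dots> = inner (Y (X \<delta>)) \<delta>"
    using Y by (simp add: adjoint_pair_def)
  finally show ?thesis .
qed

lemma adjoint_pair_funpow: "adjoint_pair X X' \<Longrightarrow> adjoint_pair (\<lambda>v. (X ^^ n) v) (\<lambda>v. (X' ^^ n) v)"
proof (induction n)
  case 0 show ?case by (simp add: adjoint_pair_def)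
next
  case (Suc n)
  then show ?case
    by (simp add: adjoint_pair_def) (metis funpow_swap1)
qed

lemma adjoint_pair_comp: "adjoint_pair X X' \<Longrightarrow> adjoint_pair Y Y' \<Longrightarrow> adjoint_pair (\<lambda>v. X (Y v)) (\<lambda>v. Y' (X' v))"
  by (simp add: adjoint_pair_def)

text \<open>On the segment \<open>C = A + s (B - A)\<close> the trace of \<open>C^(2m+1)\<close> has the derivative
  \<open>(2m+1) \<tau>(C^m (B - A) C^m) \<ge> 0\<close>.\<close>

lemma trace_power_mono:
  assumes A: "equivariant A" "adjoint_pair A A" and B: "equivariant B" "adjoint_pair B B"
    and le: "\<And>v. inner (A v) v \<le> inner (B v) v"
  shows "inner ((A ^^ (2 * m + 1)) \<delta>) \<delta> \<le> inner ((B ^^ (2 * m + 1)) \<delta>) \<delta>"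
proof -
  define D where "D v = B v + (- 1) *\<^sub>R A v" for v
  have D: "equivariant D" "adjoint_pair D D" "\<And>v. 0 \<le> inner (D v) v"
    using A B le
    by (auto simp: D_def[abs_def] adjoint_pair_def inner_diff_left inner_diff_right
        intro!: equivariant_add[of B "\<lambda>v. (- 1) *\<^sub>R A v", simplified]
            equivariant_scaleR[of A "- 1", simplified])
  define C where "C s v = A v + s *\<^sub>R D v" for s :: real and v
  have C: "equivariant (C s)" "adjoint_pair (C s) (C s)" for s
    using A D by (auto simp: C_def[abs_def] adjoint_pair_def inner_add_left inner_add_right
        intro!: equivariant_add equivariant_scaleR)
  have blA: "bounded_linear A" and blD: "bounded_linear D" and blC: "bounded_linear (C s)" for s
    using A D C by (auto simp: equivariant_def)
  \<comment> \<open>The product rule without commutativity: the derivative \<open>D\<close> of the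
    factor appears in each of the n positions.\<close>
  have deriv: "((\<lambda>s. (C s ^^ n) v) has_vector_derivative (\<Sum>i<n. (C s ^^ i) (D ((C s ^^ (n - 1 - i)) v))))
      (at s)" for n v s
  proof (induction n)
    case 0 show ?case by simp
  next
    case (Suc n)
    let ?u = "\<lambda>s. (C s ^^ n) v" and ?u' = "\<Sum>i<n. (C s ^^ i) (D ((C s ^^ (n - 1 - i)) v))"
    have "((\<lambda>s. A (?u s) + s *\<^sub>R D (?u s)) has_vector_derivative
        (A ?u' + (s *\<^sub>R D ?u' + 1 *\<^sub>R D (?u s)))) (at s)"
      by (intro has_vector_derivative_add has_vector_derivative_scaleR Suc DERIV_ident
          bounded_linear.has_vector_derivative[OF blA] bounded_linear.has_vector_derivative[OF blD])
    moreover have "A ?u' + (s *\<^sub>R D ?u' + 1 *\<^sub>R D (?u s))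
        = (\<Sum>i<Suc n. (C s ^^ i) (D ((C s ^^ (Suc n - 1 - i)) v)))"
    proof -
      have "A ?u' + (s *\<^sub>R D ?u' + 1 *\<^sub>R D (?u s)) = D (?u s) + C s ?u'"
        unfolding C_def[of s ?u'] by (simp add: ac_simps)
      also have "C s ?u' = (\<Sum>i<n. (C s ^^ Suc i) (D ((C s ^^ (n - 1 - i)) v)))"
        using linear_sum[OF bounded_linear.linear[OF blC]] by simp
      also have "D (?u s) + \<dots> = (\<Sum>i<Suc n. (C s ^^ i) (D ((C s ^^ (Suc n - 1 - i)) v)))"
        by (subst sum.lessThan_Suc_shift) simp
      finally show ?thesis .
    qed
    moreover have "(\<lambda>s. (C s ^^ Suc n) v) = (\<lambda>s. A (?u s) + s *\<^sub>R D (?u s))"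
    proof
      fix s show "(C s ^^ Suc n) v = A (?u s) + s *\<^sub>R D (?u s)" using C_def[of s "?u s"] by simp
    qed
    ultimately show ?case by (simp only:)
  qed
  have eqC: "equivariant (\<lambda>v. (C s ^^ i) v)" and adC: "adjoint_pair (\<lambda>v. (C s ^^ i) v) (\<lambda>v. (C s ^^ i) v)"
      for s i
    by (rule equivariant_funpow[OF C(1)], rule adjoint_pair_funpow[OF C(2)])
  have eqY: "equivariant (\<lambda>v. (C s ^^ i) (D ((C s ^^ j) v)))" for s i j
    by (rule equivariant_comp[OF eqC equivariant_comp[OF D(1) eqC]])
  have adY: "adjoint_pair (\<lambda>v. (C s ^^ i) (D ((C s ^^ j) v))) (\<lambda>v. (C s ^^ j) (D ((C s ^^ i) v)))" for s i j
    by (rule adjoint_pair_comp[OF adC adjoint_pair_comp[OF D(2) adC]])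
  \<comment> \<open>Cyclicity moves surplus factors from one side of \<open>D\<close> to the other
    until each side carries m of them. The balance is possible because the exponent 2 m + 1 leaves
    an even number of factors around \<open>D\<close>.\<close>
  have summand_nonneg: "0 \<le> inner ((C s ^^ i) (D ((C s ^^ (2 * m - i)) \<delta>))) \<delta>" if "i < 2 * m + 1" for s i
  proof -
    have "inner ((C s ^^ i) (D ((C s ^^ (2 * m - i)) \<delta>))) \<delta> =
          inner ((C s ^^ m) (D ((C s ^^ m) \<delta>))) \<delta>"
    proof (cases "i \<ge> m")
      case True
      have "inner ((C s ^^ (i - m)) ((C s ^^ m) (D ((C s ^^ (2 * m - i)) \<delta>)))) \<delta>
          = inner ((C s ^^ m) (D ((C s ^^ (2 * m - i)) ((C s ^^ (i - m)) \<delta>)))) \<delta>"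
        by (rule trace_commute[OF eqC adC eqY adY])
      moreover have "(C s ^^ (i - m)) ((C s ^^ m) w) = (C s ^^ i) w" for w
        using True by (metis comp_apply funpow_add le_add_diff_inverse2)
      moreover have "(C s ^^ (2 * m - i)) ((C s ^^ (i - m)) w) = (C s ^^ m) w" for w
      proof -
        have "2 * m - i + (i - m) = m" using True that by simp
        then show ?thesis by (metis comp_apply funpow_add)
      qed
      ultimately show ?thesis by simp
    next
      case False
      have "inner ((C s ^^ i) (D ((C s ^^ m) ((C s ^^ (m - i)) \<delta>)))) \<delta>
          = inner ((C s ^^ (m - i)) ((C s ^^ i) (D ((C s ^^ m) \<delta>)))) \<delta>"
        by (rule trace_commute[OF eqY adY eqC adC])
      moreover have "(C s ^^ (m - i)) ((C s ^^ i) w) = (C s ^^ m) w" for w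
        using False by (metis comp_apply funpow_add le_add_diff_inverse2 linorder_not_le less_imp_le)
      moreover have "(C s ^^ m) ((C s ^^ (m - i)) w) = (C s ^^ (2 * m - i)) w" for w
      proof -
        have "m + (m - i) = 2 * m - i" using False by simp
        then show ?thesis by (metis comp_apply funpow_add)
      qed
      ultimately show ?thesis by simp
    qed
    also have "\<dots> = inner (D ((C s ^^ m) \<delta>)) ((C s ^^ m) \<delta>)"
      using adC by (simp add: adjoint_pair_def)
    finally show ?thesis using D(3) by simp
  qed
  define F where "F s = inner ((C s ^^ (2 * m + 1)) \<delta>) \<delta>" for s
  have "\<exists>y. (F has_real_derivative y) (at s) \<and> 0 \<le> y" for s
  proof -
    have "(F has_vector_derivative inner (\<Sum>i<2 * m + 1. (C s ^^ i) (D ((C s ^^ (2 * m + 1 - 1 - i)) \<delta>))) \<delta>)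
        (at s)"
      unfolding F_def by (intro bounded_linear.has_vector_derivative[OF bounded_linear_inner_left] deriv)
    moreover have "0 \<le> inner (\<Sum>i<2 * m + 1. (C s ^^ i) (D ((C s ^^ (2 * m + 1 - 1 - i)) \<delta>))) \<delta>"
      unfolding inner_sum_left by (intro sum_nonneg) (use summand_nonneg in auto)
    ultimately show ?thesis unfolding has_real_derivative_iff_has_vector_derivative by (intro exI conjI)
  qed
  then have "F 0 \<le> F 1"
    by (intro DERIV_nonneg_imp_nondecreasing[of 0 1 F]) simp_all
  moreover have "C 0 = A" "C 1 = B" by (rule ext; simp add: C_def D_def)+
  ultimately show ?thesis by (simp only: F_def)
qed

end

section \<open>The Laplacian of a finite symmetric set and its comparison with four
  involutions\<close>

context full_group
begin

definition avg :: "'a set \<Rightarrow> 'a l2 \<Rightarrow> 'a l2" where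
  "avg S v = (1 / real (card S)) *\<^sub>R (\<Sum>s\<in>S. rt s v)"

definition lap :: "'a set \<Rightarrow> 'a l2 \<Rightarrow> 'a l2" where
  "lap S v = v + (- 1) *\<^sub>R avg S v"

lemma equivariant_avg: "equivariant (avg S)"
  unfolding avg_def[abs_def] by (intro equivariant_scaleR equivariant_sum equivariant_rt)

lemma equivariant_lap: "equivariant (lap S)"
  unfolding lap_def[abs_def] by (intro equivariant_scaleR equivariant_add equivariant_id equivariant_avg)

lemma inner_rt_self: "inner (rt s v) v = (norm v)\<^sup>2 - (norm (v - rt s v))\<^sup>2 / 2"
proof -
  have "(norm (v - rt s v))\<^sup>2 = (norm v)\<^sup>2 + (norm (rt s v))\<^sup>2 - 2 * inner (rt s v) v"
    by (simp only: power2_norm_eq_inner) (simp add: inner_diff_left inner_diff_right inner_commute)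
  then show ?thesis by (simp add: field_simps)
qed

text \<open>The Dirichlet form, which bounds the spectrum and controls the displacement of vectors
  by the generators.\<close>

lemma inner_lap:
  assumes "finite S" "S \<noteq> {}"
  shows "inner (lap S v) v = (\<Sum>s\<in>S. (norm (v - rt s v))\<^sup>2) / (2 * real (card S))"
proof -
  have "card S > 0" using assms by (simp add: card_gt_0_iff)
  then show ?thesis
    by (simp add: lap_def avg_def inner_diff_left inner_sum_left inner_rt_self sum_subtractf
        power2_norm_eq_inner[symmetric] sum_divide_distrib[symmetric] field_simps)
qed

lemma avg_symmetric:
  assumes "\<And>s. s \<in> S \<Longrightarrow> inv s \<in> S"
  shows "adjoint_pair (avg S) (avg S)"
proof -
  have "(\<Sum>s\<in>S. inner v (rt (inv s) w)) = (\<Sum>s\<in>S. inner v (rt s w))" for v w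
    by (rule sum.reindex_bij_witness[of _ "\<lambda>s. inv s" "\<lambda>s. inv s"]) (use assms in auto)
  then show ?thesis
    by (simp add: adjoint_pair_def avg_def inner_sum_left inner_sum_right
        inner_rt[of _ "v :: 'a l2" "w :: 'a l2" for v w])
qed

lemma lap_symmetric:
  assumes "\<And>s. s \<in> S \<Longrightarrow> inv s \<in> S"
  shows "adjoint_pair (lap S) (lap S)"
  using avg_symmetric[OF assms] by (simp add: adjoint_pair_def lap_def inner_diff_left inner_diff_right)

lemma laplacian_lap:
  assumes "finite S" "S \<noteq> {}"
  shows "laplacian G (pmf_of_set S) (l2f v) = l2f (lap S v)"
proof
  fix x
  have "(\<Sum>\<^sub>\<infinity>\<gamma>\<in>UNIV. l2f v (x \<otimes> inv \<gamma>) * complex_of_real (pmf (pmf_of_set S) \<gamma>))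
      = (\<Sum>\<^sub>\<infinity>\<gamma>\<in>S. l2f v (x \<otimes> inv \<gamma>) * complex_of_real (pmf (pmf_of_set S) \<gamma>))"
    by (rule infsum_cong_neutral) (use assms in auto)
  also have "\<dots> = (\<Sum>\<gamma>\<in>S. l2f v (x \<otimes> inv \<gamma>) * complex_of_real (1 / real (card S)))"
    using assms by simp
  also have "\<dots> = l2f (avg S v) x"
    by (simp add: avg_def l2f_sum sum_distrib_left mult.commute)
  finally show "laplacian G (pmf_of_set S) (l2f v) x = l2f (lap S v) x"
    by (simp add: laplacian_def right_convolution_def lap_def)
qed

lemma norm_diff_rt_le: "(norm (v - rt s v))\<^sup>2 \<le> 4 * (norm v)\<^sup>2"
proof -
  have "norm (v - rt s v) \<le> 2 * norm v" using norm_triangle_ineq4[of v "rt s v"] by simp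
  then have "(norm (v - rt s v))\<^sup>2 \<le> (2 * norm v)\<^sup>2" by (intro power_mono) auto
  then show ?thesis by (simp add: power_mult_distrib)
qed

lemma lap_bounds:
  assumes "finite S" "S \<noteq> {}"
  shows "0 \<le> inner (lap S v) v" "inner (lap S v) v \<le> 2 * (norm v)\<^sup>2"
proof -
  have c: "real (card S) > 0" using assms by (simp add: card_gt_0_iff)
  show "0 \<le> inner (lap S v) v" unfolding inner_lap[OF assms] by (intro divide_nonneg_nonneg sum_nonneg) auto
  have "(\<Sum>s\<in>S. (norm (v - rt s v))\<^sup>2) \<le> real (card S) * (4 * (norm v)\<^sup>2)"
    by (intro sum_bounded_above norm_diff_rt_le)
  then show "inner (lap S v) v \<le> 2 * (norm v)\<^sup>2"
    unfolding inner_lap[OF assms] using c by (simp add: field_simps)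
qed

text \<open>Half the Laplacian is a positive contraction, so the choice behind
  \<open>spectral_projection\<close> is made from a nonempty set of spectral measures.\<close>

lemma spectral_resolution_exists:
  assumes S: "finite S" "S \<noteq> {}" "\<And>s. s \<in> S \<Longrightarrow> inv s \<in> S"
  shows "spectral_resolution (laplacian G (pmf_of_set S))
      (spectral_projection UNIV (laplacian G (pmf_of_set S))) (lap S)"
proof (rule spectral_resolution.intro)
  let ?T = "laplacian G (pmf_of_set S)"
  define A where "A v = (1 / 2) *\<^sub>R lap S v" for v
  have A: "equivariant A" unfolding A_def[abs_def] by (intro equivariant_scaleR equivariant_lap)
  have "positive_contraction A"
  proof (rule positive_contraction.intro)
    show "bounded_linear A" using A by (simp add: equivariant_def)
    show "inner (A v) w = inner v (A w)" for v w
      using lap_symmetric[OF S(3)] by (simp add: A_def adjoint_pair_def)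
    show "0 \<le> inner (A v) v" "inner (A v) v \<le> inner v v" for v
      using lap_bounds[OF S(1,2), of v] by (simp_all add: A_def power2_norm_eq_inner)
  qed
  moreover have "A (cscale \<i> v) = cscale \<i> (A v)" for v using A by (simp add: equivariant_def)
  moreover have "?T (l2f v) = l2f (2 *\<^sub>R A v)" for v
    unfolding laplacian_lap[OF S(1,2)] A_def by simp
  ultimately have "\<exists>E. is_spectral_measure UNIV ?T E" by (rule spectral_measure_exists)
  then show "is_spectral_measure UNIV ?T (spectral_projection UNIV ?T)"
    unfolding spectral_projection_def by (rule someI_ex)
  show "?T (l2f v) = l2f (lap S v)" for v by (rule laplacian_lap[OF S(1,2)])
  show "linear (lap S)" using equivariant_lap by (simp add: equivariant_def bounded_linear.linear)
  show "inner (lap S v) w = inner v (lap S w)" for v w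
    using lap_symmetric[OF S(3)] by (simp add: adjoint_pair_def)
qed

lemma spectral_distribution_le_trace:
  assumes S: "finite S" "S \<noteq> {}" "\<And>s. s \<in> S \<Longrightarrow> inv s \<in> S" and l: "l \<le> 2"
  shows "(1 - l / 2) ^ n * spectral_distribution G (pmf_of_set S) l
    \<le> inner (((\<lambda>v. v + (- 1 / 2) *\<^sub>R lap S v) ^^ n) \<delta>) \<delta>"
proof -
  interpret R: spectral_resolution "laplacian G (pmf_of_set S)"
      "spectral_projection UNIV (laplacian G (pmf_of_set S))" "lap S"
    by (rule spectral_resolution_exists[OF S])
  have pos: "0 \<le> inner (v + (- 1 / 2) *\<^sub>R lap S v) v" for v
    using lap_bounds(2)[OF S(1,2), of v] by (simp add: inner_diff_left power2_norm_eq_inner)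
  have "spectral_distribution G (pmf_of_set S) l = inner (R.P {..l} \<delta>) \<delta>"
    unfolding spectral_distribution_def carrier_UNIV l2f_pt[symmetric]
    by (simp add: R.l2f_P[symmetric] ell2_inner_l2f)
  also have "\<dots> = (norm (R.P {..l} \<delta>))\<^sup>2" by (rule R.inner_P_nonneg) simp
  finally show ?thesis
    using R.spectral_distribution_power_bound[OF _ pos l, of n \<delta>] by simp
qed

text \<open>By \<open>inner_lap\<close> the square root is the l^2 norm of the gradient of
  \<open>v\<close> along \<open>S\<close>, for finite nonempty \<open>S\<close>. A word of length n
  in \<open>S\<close> then has the constant n.\<close>

definition displaced :: "'a set \<Rightarrow> 'a \<Rightarrow> real \<Rightarrow> bool" where
  "displaced S g c \<longleftrightarrow> (\<forall>v. norm (v - rt g v) \<le> c * sqrt (2 * real (card S) * inner (lap S v) v))"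

lemma displaced_one: "displaced S \<one> 0"
proof -
  have "rt \<one> v = v" for v by (rule l2_eqI) simp
  then show ?thesis by (simp add: displaced_def)
qed

lemma displaced_mono:
  assumes "finite S" "S \<noteq> {}" "displaced S g c" "c \<le> d"
  shows "displaced S g d"
  unfolding displaced_def
proof
  fix v
  have "c * sqrt (2 * real (card S) * inner (lap S v) v) \<le> d * sqrt (2 * real (card S) * inner (lap S v) v)"
    using assms lap_bounds[OF assms(1,2), of v] by (intro mult_right_mono) auto
  then show "norm (v - rt g v) \<le> d * sqrt (2 * real (card S) * inner (lap S v) v)"
    using assms(3) unfolding displaced_def by (meson order_trans)
qed

lemma displaced_gen:
  assumes "finite S" "s \<in> S"
  shows "displaced S s 1"
  unfolding displaced_def
proof
  fix v
  have ne: "S \<noteq> {}" using assms by auto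
  have c: "real (card S) > 0" using assms by (simp add: card_gt_0_iff ne)
  have "(norm (v - rt s v))\<^sup>2 \<le> (\<Sum>s\<in>S. (norm (v - rt s v))\<^sup>2)"
    using assms by (intro member_le_sum) auto
  also have "\<dots> = 2 * real (card S) * inner (lap S v) v"
    using c by (simp add: inner_lap[OF assms(1) ne])
  finally show "norm (v - rt s v) \<le> 1 * sqrt (2 * real (card S) * inner (lap S v) v)"
    by (simp add: real_le_rsqrt)
qed

lemma displaced_mult:
  assumes "displaced S g c" "displaced S h d"
  shows "displaced S (g \<otimes> h) (c + d)"
  unfolding displaced_def
proof
  fix v
  let ?e = "sqrt (2 * real (card S) * inner (lap S v) v)"
  \<comment> \<open>\<open>rt\<close> reverses products, so \<open>h\<close> acts last; being
    isometric, it preserves the displacement by \<open>g\<close>.\<close>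
  have "rt (g \<otimes> h) v = rt h (rt g v)" by (rule l2_eqI) (simp add: ginv_mult gassoc)
  then have "v - rt (g \<otimes> h) v = (v - rt h v) + rt h (v - rt g v)"
    using linear_diff[OF bounded_linear.linear[OF bounded_linear_rt]] by simp
  then have "norm (v - rt (g \<otimes> h) v) \<le> norm (v - rt h v) + norm (v - rt g v)"
    using norm_triangle_ineq[of "v - rt h v" "rt h (v - rt g v)"] by (simp only: norm_rt)
  also have "\<dots> \<le> d * ?e + c * ?e" using assms unfolding displaced_def by (intro add_mono) auto
  finally show "norm (v - rt (g \<otimes> h) v) \<le> (c + d) * ?e" by (simp add: algebra_simps)
qed

lemma displaced_inv:
  assumes "displaced S g c"
  shows "displaced S (inv g) c"
  unfolding displaced_def
proof
  fix v
  have "rt g (rt (inv g) v) = v" by (rule l2_eqI) (simp add: gassoc)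
  then have "norm (v - rt (inv g) v) = norm (rt g (rt (inv g) v - v))"
    by (simp add: norm_minus_commute)
  also have "rt g (rt (inv g) v - v) = v - rt g v"
    using linear_diff[OF bounded_linear.linear[OF bounded_linear_rt]] \<open>rt g (rt (inv g) v) = v\<close> by simp
  finally show "norm (v - rt (inv g) v) \<le> c * sqrt (2 * real (card S) * inner (lap S v) v)"
    using assms by (simp add: displaced_def)
qed

lemma displaced_pow:
  assumes "displaced S g c"
  shows "displaced S (g [^] (n::nat)) (real n * c)"
proof (induction n)
  case 0 show ?case by (simp add: displaced_one)
next
  case (Suc n)
  show ?case using displaced_mult[OF Suc assms] by (simp add: algebra_simps)
qed

lemma displaced_generate:
  assumes "finite S" "S \<noteq> {}" "g \<in> generate G S"
  shows "\<exists>c. displaced S g c"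
  using assms(3)
proof induction
  case one show ?case using displaced_one by blast
next
  case (incl h) show ?case using displaced_gen[OF assms(1) incl] by blast
next
  case (inv h) show ?case using displaced_inv[OF displaced_gen[OF assms(1) inv]] by blast
next
  case (eng h1 h2) then show ?case using displaced_mult by blast
qed

text \<open>This is 1 - \<kappa> (1 - M)/2 with M the average of the four right translations, to be
  compared with half the Laplacian subtracted from 1.\<close>

definition lazy_avg :: "real \<Rightarrow> (nat \<Rightarrow> 'a) \<Rightarrow> 'a l2 \<Rightarrow> 'a l2" where
  "lazy_avg \<kappa> a v = (1 - \<kappa> / 2) *\<^sub>R v + (\<kappa> / 8) *\<^sub>R (\<Sum>i<4. rt (a i) v)"

text \<open>On the four-regular tree one neighbour is closer to the root and three are further away, so the
  average of the weight \<open>2^(-ht)\<close> over the neighbours is at most \<open>(2 + 3/2) / 4 = 7/8\<close> of its value. The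
  bound \<open>R\<close> keeps the walk away from the leaves of the ball.\<close>

lemma return_bound:
  fixes a :: "nat \<Rightarrow> 'a"
  assumes a: "\<And>i. i < 4 \<Longrightarrow> a i \<otimes> a i = \<one>" and \<kappa>: "0 \<le> \<kappa>" "\<kappa> \<le> 1"
    and h0: "ht \<one> = (0::nat)"
    and h1: "\<And>g. ht g \<le> R \<Longrightarrow> \<exists>j. \<forall>i<4. i \<noteq> j \<longrightarrow> min R (ht g + 1) \<le> ht (g \<otimes> a i)"
    and h2: "\<And>g i. i < 4 \<Longrightarrow> ht g \<le> ht (g \<otimes> a i) + 1"
    and m: "m \<le> R"
  shows "inner ((lazy_avg \<kappa> a ^^ m) \<delta>) \<delta> \<le> (1 - \<kappa> / 16) ^ m"
proof -
  \<comment> \<open>The value of (1 - \<kappa>/2) + (\<kappa>/8) * (7/2), where 7/2 = 2 + 3/2 is the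
    weight of the four neighbours.\<close>
  define b where "b = 1 - \<kappa> / 16"
  have b: "0 \<le> b" "\<kappa> / 4 \<le> b" using \<kappa> by (auto simp: b_def)
  define q where "q = rec_nat (\<lambda>g. if g = \<one> then 1 else (0::real))
    (\<lambda>_ f g. (1 - \<kappa> / 2) * f g + (\<kappa> / 8) * (\<Sum>i<4. f (g \<otimes> a i)))"
  have q0: "q 0 g = (if g = \<one> then 1 else 0)" and
    qS: "q (Suc m) g = (1 - \<kappa> / 2) * q m g + (\<kappa> / 8) * (\<Sum>i<4. q m (g \<otimes> a i))" for m g
    by (simp_all add: q_def)
  have inva: "inv (a i) = a i" if "i < 4" for i
    using a[OF that] by (intro inv_equality) simp_all
  have q: "l2f ((lazy_avg \<kappa> a ^^ m) \<delta>) g = complex_of_real (q m g)" for m g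
  proof (induction m arbitrary: g)
    case 0 show ?case by (simp add: q0 l2f_pt point_mass_def)
  next
    case (Suc m)
    have "(\<Sum>i<4. l2f (rt (a i) ((lazy_avg \<kappa> a ^^ m) \<delta>)) g) = (\<Sum>i<4. complex_of_real (q m (g \<otimes> a i)))"
      by (intro sum.cong) (auto simp: Suc inva)
    then show ?case
      using lazy_avg_def[of \<kappa> a "(lazy_avg \<kappa> a ^^ m) \<delta>"] by (simp add: l2f_sum Suc qS del: l2f_rt)
  qed
  have nn: "0 \<le> q m g" for m g
    by (induction m arbitrary: g) (use \<kappa> in \<open>auto simp: q0 qS intro!: add_nonneg_nonneg mult_nonneg_nonneg
        sum_nonneg\<close>)
  \<comment> \<open>The support statement is carried along because at height R the neighbours need
    not rise, so that the weights alone do not suffice there.\<close>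
  have "m \<le> R \<Longrightarrow> (m < ht g \<longrightarrow> q m g = 0) \<and> q m g \<le> b ^ m * (1 / 2) ^ ht g" for g
  proof (induction m arbitrary: g)
    case 0
    then show ?case using h0 by (auto simp: q0)
  next
    case (Suc m)
    then have m: "m < R" by simp
    have IH0: "\<And>g. m < ht g \<Longrightarrow> q m g = 0" and IH: "\<And>g. q m g \<le> b ^ m * (1 / 2) ^ ht g"
      using Suc m by auto
    have le2: "q m (g \<otimes> a i) \<le> 2 * (b ^ m * (1 / 2) ^ ht g)" if "i < 4" for i
    proof -
      have "((1::real) / 2) ^ (ht (g \<otimes> a i) + 1) \<le> (1 / 2) ^ ht g"
        using h2[OF that, of g] by (intro power_decreasing) auto
      then have "b ^ m * ((1 / 2) ^ ht (g \<otimes> a i)) \<le> b ^ m * (2 * (1 / 2) ^ ht g)"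
        using b by (intro mult_left_mono) auto
      then show ?thesis using IH[of "g \<otimes> a i"] by (simp add: algebra_simps)
    qed
    have far: "q (Suc m) g = 0" if g: "Suc m < ht g"
    proof -
      have "m < ht (g \<otimes> a i)" if "i < 4" for i using h2[OF that, of g] g by simp
      then have "(\<Sum>i<4. q m (g \<otimes> a i)) = 0" by (intro sum.neutral) (auto intro: IH0)
      then show ?thesis using g IH0 by (simp add: qS)
    qed
    show ?case
    proof (intro conjI impI far)
      define X where "X = b ^ m * (1 / 2) ^ ht g"
      have X: "X \<ge> 0" using b by (simp add: X_def)
      consider "ht g \<le> m" | "ht g = Suc m" | "Suc m < ht g" by linarith
      then show "q (Suc m) g \<le> b ^ Suc m * (1 / 2) ^ ht g"
      proof cases
        case 1
        then obtain j where "\<forall>i<4. i \<noteq> j \<longrightarrow> min R (ht g + 1) \<le> ht (g \<otimes> a i)"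
          using h1[of g] m by auto
        moreover have "min R (ht g + 1) = ht g + 1" using 1 m by simp
        ultimately have j: "\<And>i. i < 4 \<Longrightarrow> i \<noteq> j \<Longrightarrow> ht g + 1 \<le> ht (g \<otimes> a i)" by simp
        have "q m (g \<otimes> a i) \<le> (if i = j then 2 * X else X / 2)" if i: "i < 4" for i
        proof (cases "i = j")
          case True then show ?thesis using le2[OF i] by (simp add: X_def)
        next
          case False
          have "((1::real) / 2) ^ ht (g \<otimes> a i) \<le> (1 / 2) ^ (ht g + 1)"
            using j[OF i False] by (intro power_decreasing) auto
          then have "b ^ m * (1 / 2) ^ ht (g \<otimes> a i) \<le> b ^ m * (1 / 2) ^ (ht g + 1)"
            using b by (intro mult_left_mono) auto
          then show ?thesis using IH[of "g \<otimes> a i"] False by (simp add: X_def)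
        qed
        then have "(\<Sum>i<4. q m (g \<otimes> a i)) \<le> (\<Sum>i<4. if i = j then 2 * X else X / 2)"
          by (intro sum_mono) auto
        also have "\<dots> \<le> 7 / 2 * X"
          using X by (auto simp: numeral_eq_Suc)
        finally have "q (Suc m) g \<le> (1 - \<kappa> / 2) * X + (\<kappa> / 8) * (7 / 2 * X)"
          unfolding qS using \<kappa> IH[of g] by (intro add_mono mult_left_mono) (auto simp: X_def)
        also have "\<dots> = b * X" by (simp add: b_def field_simps)
        finally show ?thesis by (simp add: X_def)
      next
        case 2
        \<comment> \<open>At height Suc m the value q m g is still 0, and only the neighbour j can
          lie within height m. This includes the boundary case Suc m = R.\<close>
        then obtain j where "\<forall>i<4. i \<noteq> j \<longrightarrow> min R (ht g + 1) \<le> ht (g \<otimes> a i)"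
          using h1[of g] m by auto
        moreover have "m < min R (ht g + 1)" using 2 m by simp
        ultimately have j: "\<And>i. i < 4 \<Longrightarrow> i \<noteq> j \<Longrightarrow> m < ht (g \<otimes> a i)"
          by (meson order_less_le_trans)
        have "q m (g \<otimes> a i) \<le> (if i = j then 2 * X else 0)" if i: "i < 4" for i
          using le2[OF i] IH0[OF j[OF i]] by (auto simp: X_def)
        then have "(\<Sum>i<4. q m (g \<otimes> a i)) \<le> (\<Sum>i<4. if i = j then 2 * X else 0)"
          by (intro sum_mono) auto
        also have "\<dots> \<le> 2 * X"
          using X by (auto simp: numeral_eq_Suc)
        finally have "(\<kappa> / 8) * (\<Sum>i<4. q m (g \<otimes> a i)) \<le> (\<kappa> / 8) * (2 * X)"
          using \<kappa> by (intro mult_left_mono) auto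
        then have "q (Suc m) g \<le> \<kappa> / 4 * X"
          using IH0[of g] 2 by (simp add: qS algebra_simps)
        also have "\<dots> \<le> b * X" using b X by (intro mult_right_mono) auto
        finally show ?thesis by (simp add: X_def)
      next
        case 3 then show ?thesis using b far by simp
      qed
    qed
  qed
  from this[OF m, of "\<one>"] have "q m \<one> \<le> b ^ m" using h0 by simp
  then show ?thesis by (simp add: inner_pt1 q b_def)
qed

text \<open>The trace of an odd power of 1 - \<Delta>/2 is squeezed between (1 - l/2)^n N(l) and a
  return coefficient of the walk along \<open>a\<close>, which \<open>return_bound\<close>
  estimates.\<close>

theorem spectral_distribution_bound:
  fixes a :: "nat \<Rightarrow> 'a"
  assumes S: "finite S" "S \<noteq> {}" "\<And>s. s \<in> S \<Longrightarrow> inv s \<in> S"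
    and a: "\<And>i. i < 4 \<Longrightarrow> a i \<otimes> a i = \<one>" and c: "\<And>i. i < 4 \<Longrightarrow> displaced S (a i) c" "1 \<le> c"
    and h0: "ht \<one> = (0::nat)"
    and h1: "\<And>g. ht g \<le> R \<Longrightarrow> \<exists>j. \<forall>i<4. i \<noteq> j \<longrightarrow> min R (ht g + 1) \<le> ht (g \<otimes> a i)"
    and h2: "\<And>g i. i < 4 \<Longrightarrow> ht g \<le> ht (g \<otimes> a i) + 1"
    and R: "2 * m + 1 \<le> R"
    and \<eta>: "\<eta> \<le> 1 / (16 * c\<^sup>2 * real (card S))" "l \<le> \<eta>"
  shows "spectral_distribution G (pmf_of_set S) l \<le> (1 - \<eta> / 2) ^ (2 * m + 1)"
proof -
  let ?n = "2 * m + 1"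
  let ?A = "\<lambda>v. v + (- 1 / 2) *\<^sub>R lap S v"
  have cS: "real (card S) \<ge> 1" using S by (simp add: Suc_leI card_gt_0_iff)
  \<comment> \<open>The form of 1 - M is an eighth of the sum of four squared displacements, each at
    most 2 \<open>c\<^sup>2\<close> |S| times the form of \<Delta>. Hence \<Delta> dominates
    \<kappa> (1 - M).\<close>
  define \<kappa> where "\<kappa> = 1 / (c\<^sup>2 * real (card S))"
  have c2: "1 \<le> c\<^sup>2" using c(2) by simp
  then have "1 \<le> c\<^sup>2 * real (card S)" using cS mult_mono[of 1 "c\<^sup>2" 1 "real (card S)"] by simp
  then have \<kappa>: "0 < \<kappa>" "\<kappa> \<le> 1" by (auto simp: \<kappa>_def)
  have \<eta>\<kappa>: "\<eta> \<le> \<kappa> / 16" using \<eta> by (simp add: \<kappa>_def)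
  let ?B = "lazy_avg \<kappa> a"
  have inva: "inv (a i) = a i" if "i < 4" for i
    using a[OF that] by (intro inv_equality) simp_all
  have eqA: "equivariant ?A" by (intro equivariant_add equivariant_id equivariant_scaleR equivariant_lap)
  have adA: "adjoint_pair ?A ?A"
    using lap_symmetric[OF S(3)] by (simp add: adjoint_pair_def inner_diff_left inner_diff_right)
  have eqB: "equivariant ?B" unfolding lazy_avg_def[abs_def]
    by (intro equivariant_add equivariant_id equivariant_scaleR equivariant_sum equivariant_rt)
  have adB: "adjoint_pair ?B ?B"
  proof -
    have "(\<Sum>i<4. inner (rt (a i) v) w) = (\<Sum>i<4. inner v (rt (a i) w))" for v w
      by (intro sum.cong refl) (metis inner_rt inva lessThan_iff)
    then show ?thesis
      by (simp add: adjoint_pair_def lazy_avg_def inner_add_left inner_add_right inner_sum_left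
          inner_sum_right)
  qed
  have le: "inner (?A v) v \<le> inner (?B v) v" for v
  proof -
    define e where "e = inner (lap S v) v"
    have e: "e \<ge> 0" unfolding e_def using lap_bounds[OF S(1,2)] by simp
    have "(norm (v - rt (a i) v))\<^sup>2 \<le> c\<^sup>2 * (2 * real (card S) * e)" if i: "i < 4" for i
    proof -
      have "norm (v - rt (a i) v) \<le> c * sqrt (2 * real (card S) * e)"
        using c(1)[OF i] by (simp add: displaced_def e_def)
      then have "(norm (v - rt (a i) v))\<^sup>2 \<le> (c * sqrt (2 * real (card S) * e))\<^sup>2"
        by (intro power_mono) auto
      then show ?thesis using e by (simp add: power_mult_distrib)
    qed
    then have "(\<Sum>i<4. (norm (v - rt (a i) v))\<^sup>2) \<le> real (card {..<4::nat}) * (c\<^sup>2 * (2 * real (card S) * e))"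
      by (intro sum_bounded_above) auto
    then have "\<kappa> / 16 * (\<Sum>i<4. (norm (v - rt (a i) v))\<^sup>2) \<le> \<kappa> / 16 * (4 * (c\<^sup>2 * (2 * real (card S) * e)))"
      using \<kappa> by (intro mult_left_mono) auto
    also have "\<dots> = \<kappa> * (c\<^sup>2 * real (card S)) * e / 2" by simp
    also have "\<kappa> * (c\<^sup>2 * real (card S)) = 1" using c(2) cS by (auto simp: \<kappa>_def)
    finally have 1: "\<kappa> / 16 * (\<Sum>i<4. (norm (v - rt (a i) v))\<^sup>2) \<le> e / 2" by simp
    have "inner (?B v) v = (1 - \<kappa> / 2) * (norm v)\<^sup>2
        + \<kappa> / 8 * (\<Sum>i<4. (norm v)\<^sup>2 - (norm (v - rt (a i) v))\<^sup>2 / 2)"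
      by (simp add: lazy_avg_def inner_add_left inner_sum_left inner_rt_self power2_norm_eq_inner)
    also have "\<dots> = (norm v)\<^sup>2 - \<kappa> / 16 * (\<Sum>i<4. (norm (v - rt (a i) v))\<^sup>2)"
      by (simp add: sum_subtractf sum_divide_distrib[symmetric] field_simps)
    finally show ?thesis using 1
      by (simp add: inner_diff_left e_def[symmetric] power2_norm_eq_inner)
  qed
  have \<eta>1: "\<eta> \<le> 1 / 16" using \<eta>\<kappa> \<kappa> by linarith
  have "(1 - l / 2) ^ ?n * spectral_distribution G (pmf_of_set S) l \<le> inner ((?A ^^ ?n) \<delta>) \<delta>"
    by (rule spectral_distribution_le_trace[OF S _]) (use \<eta>(2) \<eta>1 in auto)
  also have "\<dots> \<le> inner ((?B ^^ ?n) \<delta>) \<delta>"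
    by (rule trace_power_mono[OF eqA adA eqB adB le])
  also have "\<dots> \<le> (1 - \<kappa> / 16) ^ ?n"
    by (rule return_bound[OF a _ _ h0 h1 h2 R]) (use \<kappa> in auto)
  also have "\<dots> \<le> (1 - \<eta>) ^ ?n"
    using \<eta>\<kappa> \<kappa> by (intro power_mono) auto
  \<comment> \<open>One of the two factors 1 - \<eta>/2 is given up to cancel (1 - l/2)^n from the
    left-hand side; the other remains as decay.\<close>
  also have "\<dots> \<le> ((1 - l / 2) * (1 - \<eta> / 2)) ^ ?n"
  proof (rule power_mono)
    have "(1 - \<eta> / 2) * (1 - \<eta> / 2) \<le> (1 - l / 2) * (1 - \<eta> / 2)"
      using \<eta> \<eta>1 by (intro mult_right_mono) auto
    moreover have "1 - \<eta> \<le> (1 - \<eta> / 2) * (1 - \<eta> / 2)" by (simp add: algebra_simps)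
    ultimately show "1 - \<eta> \<le> (1 - l / 2) * (1 - \<eta> / 2)" by linarith
    show "0 \<le> 1 - \<eta>" using \<eta>1 by simp
  qed
  also have "\<dots> = (1 - l / 2) ^ ?n * (1 - \<eta> / 2) ^ ?n" by (rule power_mult_distrib)
  finally show ?thesis
    using \<eta> \<eta>1 by (subst (asm) mult_le_cancel_left_pos) (auto intro!: zero_less_power)
qed

end

section \<open>Amenability and permutation groups\<close>

lemma compact_unit_functions: "compact {m :: 'b \<Rightarrow> real. \<forall>A. m A \<in> {0..1}}"
proof -
  have "compactin (product_topology (\<lambda>_. euclidean) UNIV) (PiE UNIV (\<lambda>_::'b. {0..1::real}))"
    by (subst compactin_PiE) auto
  then show ?thesis
    by (simp add: euclidean_product_topology PiE_def Pi_def extensional_def)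
qed

text \<open>By Tychonoff the sequence has a cluster point, and a continuous functional that tends to
  0 along the sequence vanishes there. Additivity and invariance will be expressed by such
  functionals.\<close>

lemma finitely_additive_limit:
  fixes M :: "nat \<Rightarrow> 'b \<Rightarrow> real"
  assumes "\<And>n A. M n A \<in> {0..1}"
  obtains m where "\<And>A. m A \<in> {0..1}"
    "\<And>\<phi>. continuous_on UNIV \<phi> \<Longrightarrow> (\<lambda>n. \<phi> (M n) :: real) \<longlonglongrightarrow> 0 \<Longrightarrow> \<phi> m = 0"
proof -
  let ?K = "{m :: 'b \<Rightarrow> real. \<forall>A. m A \<in> {0..1}}" and ?F = "filtermap M sequentially"
  have "eventually (\<lambda>x. x \<in> ?K) ?F" using assms by (simp add: eventually_filtermap)
  moreover have "?F \<noteq> bot" by (simp add: filtermap_bot_iff)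
  ultimately obtain m where m: "m \<in> ?K" "inf (nhds m) ?F \<noteq> bot"
    using compact_unit_functions[unfolded compact_filter] by blast
  show thesis
  proof (rule that[of m])
    show "m A \<in> {0..1}" for A using m by blast
    fix \<phi> :: "('b \<Rightarrow> real) \<Rightarrow> real"
    assume \<phi>: "continuous_on UNIV \<phi>" "(\<lambda>n. \<phi> (M n)) \<longlonglongrightarrow> 0"
    show "\<phi> m = 0"
    proof (rule ccontr)
      assume "\<phi> m \<noteq> 0"
      then have pos: "\<bar>\<phi> m\<bar> / 2 > 0" by simp
      have "(\<phi> \<longlongrightarrow> \<phi> m) (nhds m)"
        using \<phi>(1) by (simp add: continuous_on_def tendsto_at_iff_tendsto_nhds)
      then have "((\<lambda>x. \<bar>\<phi> x\<bar>) \<longlongrightarrow> \<bar>\<phi> m\<bar>) (nhds m)" by (rule tendsto_rabs)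
      from order_tendstoD(1)[OF this, of "\<bar>\<phi> m\<bar> / 2"] pos
      have "eventually (\<lambda>x. \<bar>\<phi> m\<bar> / 2 < \<bar>\<phi> x\<bar>) (inf (nhds m) ?F)"
        by (auto intro: filter_leD[OF inf_le1])
      moreover have "eventually (\<lambda>x. \<bar>\<phi> x\<bar> < \<bar>\<phi> m\<bar> / 2) ?F"
        using order_tendstoD(2)[OF tendsto_rabs_zero[OF \<phi>(2)] pos] by (simp add: eventually_filtermap)
      then have "eventually (\<lambda>x. \<bar>\<phi> x\<bar> < \<bar>\<phi> m\<bar> / 2) (inf (nhds m) ?F)"
        by (rule filter_leD[OF inf_le2])
      ultimately have "eventually (\<lambda>x. False) (inf (nhds m) ?F)"
        by eventually_elim linarith
      then show False using m(2) by (simp add: trivial_limit_def)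
    qed
  qed
qed

context full_group
begin

text \<open>The mean is a cluster point of the densities of a set in \<open>F n\<close>. The Folner
  condition gives invariance under \<open>T\<close>, and invariance passes to inverses and
  products.\<close>

lemma Folner_imp_amenable:
  assumes gen: "generate G T = UNIV" and F: "\<And>n::nat. finite (F n)" "\<And>n. F n \<noteq> {}"
    and Folner: "\<And>g. g \<in> T \<Longrightarrow> (\<lambda>n. real (card ((\<lambda>x. g \<otimes> x) ` F n - F n)) / real (card (F n))) \<longlonglongrightarrow> 0"
  shows "amenable G"
proof -
  define M where "M n A = real (card (A \<inter> F n)) / real (card (F n))" for n A
  have c: "real (card (F n)) > 0" for n using F[of n] by (simp add: card_gt_0_iff)
  have "M n A \<in> {0..1}" for n A
    using c[of n] F(1)[of n] by (auto simp: M_def divide_le_eq_1 intro!: card_mono)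
  then obtain m where m01: "\<And>A. m A \<in> {0..1}"
    and lim: "\<And>\<phi>. continuous_on UNIV \<phi> \<Longrightarrow> (\<lambda>n. \<phi> (M n) :: real) \<longlonglongrightarrow> 0 \<Longrightarrow> \<phi> m = 0"
    using finitely_additive_limit by blast
  have coord: "continuous_on UNIV (\<lambda>m :: 'a set \<Rightarrow> real. m A)" for A
    by (rule continuous_on_product_coordinates)
  have one: "m UNIV = 1"
  proof -
    have "m UNIV - 1 = 0"
    proof (rule lim)
      show "continuous_on UNIV (\<lambda>m :: 'a set \<Rightarrow> real. m UNIV - 1)" by (intro continuous_intros coord)
      show "(\<lambda>n. M n UNIV - 1) \<longlonglongrightarrow> 0" using c by (simp add: M_def less_imp_neq[symmetric])
    qed
    then show ?thesis by simp
  qed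
  have add: "m (A \<union> B) = m A + m B" if "A \<inter> B = {}" for A B
  proof -
    have "m (A \<union> B) - (m A + m B) = 0"
    proof (rule lim)
      show "continuous_on UNIV (\<lambda>m :: 'a set \<Rightarrow> real. m (A \<union> B) - (m A + m B))"
          by (intro continuous_intros coord)
      have "M n (A \<union> B) = M n A + M n B" for n
      proof -
        have "card ((A \<union> B) \<inter> F n) = card (A \<inter> F n) + card (B \<inter> F n)"
          unfolding Int_Un_distrib2 using that F(1)[of n] by (intro card_Un_disjoint) auto
        then show ?thesis by (simp add: M_def add_divide_distrib)
      qed
      then show "(\<lambda>n. M n (A \<union> B) - (M n A + M n B)) \<longlonglongrightarrow> 0" by simp
    qed
    then show ?thesis by simp
  qed
  have invT: "m ((\<lambda>x. g \<otimes> x) ` A) = m A" if g: "g \<in> T" for g A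
  proof -
    let ?g = "\<lambda>x. g \<otimes> x"
    have inj: "inj_on ?g X" for X using bij_lmult[of g] by (meson bij_is_inj inj_on_subset subset_UNIV)
    have "m (?g ` A) - m A = 0"
    proof (rule lim)
      show "continuous_on UNIV (\<lambda>m :: 'a set \<Rightarrow> real. m (?g ` A) - m A)" by (intro continuous_intros coord)
      have "norm (M n (?g ` A) - M n A) \<le> real (card (?g ` F n - F n)) / real (card (F n))" for n
      proof -
        let ?F = "F n" and ?gF = "?g ` F n"
        have fin: "finite ?F" "finite ?gF" using F by auto
        have cF: "card ?gF = card ?F" by (rule card_image[OF inj])
        have "card (A \<inter> ?F) = card (?g ` (A \<inter> ?F))" by (rule card_image[OF inj, symmetric])
        also have "?g ` (A \<inter> ?F) = ?g ` A \<inter> ?gF" using inj[of UNIV] by (auto simp: inj_on_def)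
        finally have cA: "card (A \<inter> ?F) = card (?g ` A \<inter> ?gF)" .
        have "card (?gF - ?F) = card (?F - ?gF)"
        proof -
          have "card ?gF = card (?gF - ?F) + card (?gF \<inter> ?F)" "card ?F = card (?F - ?gF) + card (?gF \<inter> ?F)"
            using fin by (metis add.commute card_Int_Diff, metis Int_commute add.commute card_Int_Diff)
          then show ?thesis using cF by simp
        qed
        moreover have "card (?g ` A \<inter> ?gF) \<le> card (?g ` A \<inter> ?F) + card (?gF - ?F)"
          using card_mono[of "(?g ` A \<inter> ?F) \<union> (?gF - ?F)" "?g ` A \<inter> ?gF"] fin
              card_Un_le[of "?g ` A \<inter> ?F" "?gF - ?F"] by force
        moreover have "card (?g ` A \<inter> ?F) \<le> card (?g ` A \<inter> ?gF) + card (?F - ?gF)"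
          using card_mono[of "(?g ` A \<inter> ?gF) \<union> (?F - ?gF)" "?g ` A \<inter> ?F"] fin
              card_Un_le[of "?g ` A \<inter> ?gF" "?F - ?gF"] by force
        ultimately have "\<bar>real (card (?g ` A \<inter> ?F)) - real (card (A \<inter> ?F))\<bar> \<le> real (card (?gF - ?F))"
          using cA by linarith
        then show ?thesis using c[of n]
          by (simp add: M_def diff_divide_distrib[symmetric] divide_right_mono)
      qed
      then show "(\<lambda>n. M n (?g ` A) - M n A) \<longlonglongrightarrow> 0"
        by (intro Lim_null_comparison[OF _ Folner[OF g]] always_eventually allI)
    qed
    then show ?thesis by simp
  qed
  have inv: "m ((\<lambda>x. g \<otimes> x) ` A) = m A" if "g \<in> generate G T" for g A
    using that
  proof (induction arbitrary: A)
    case one then show ?case by simp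
  next
    case (incl h) then show ?case by (rule invT)
  next
    case (inv h)
    have "A = (\<lambda>x. h \<otimes> x) ` (\<lambda>x. inv h \<otimes> x) ` A" by (simp add: image_image)
    then show ?case using invT[OF inv, of "(\<lambda>x. inv h \<otimes> x) ` A"] by simp
  next
    case (eng h1 h2)
    have "(\<lambda>x. (h1 \<otimes> h2) \<otimes> x) ` A = (\<lambda>x. h1 \<otimes> x) ` (\<lambda>x. h2 \<otimes> x) ` A" by (simp add: image_image gassoc)
    then show ?case using eng by simp
  qed
  have coset: "g <# A = (\<lambda>x. g \<otimes> x) ` A" for g A by (auto simp: l_coset_def)
  show ?thesis
    unfolding amenable_def carrier_UNIV
    by (rule exI[of _ m]) (use one add inv gen m01 coset in auto)
qed

end

text \<open>The words in t, t' and u form a countable group of permutations, infinite because the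
  powers of t are distinct. An enumeration by all natural numbers transports its multiplication to a
  group that fills the type \<open>nat\<close>.\<close>

lemma countable_permutation_group:
  fixes t t' u :: "'b \<Rightarrow> 'b"
  assumes tt: "t \<circ> t' = id" "t' \<circ> t = id" and uu: "u \<circ> u = id" and inf: "inj (\<lambda>n::nat. t ^^ n)"
  obtains G :: "nat monoid" and e \<tau> \<upsilon> where "full_group G" "\<And>a b. e (a \<otimes>\<^bsub>G\<^esub> b) = e a \<circ> e b" "e \<one>\<^bsub>G\<^esub> = id"
    "inj e" "e \<tau> = t" "e \<upsilon> = u" "generate G {\<tau>, \<upsilon>} = UNIV"
proof -
  define word where "word ws = foldr (\<circ>) ws id" for ws :: "('b \<Rightarrow> 'b) list"
  have word_simps: "word [] = id" "word (w # ws) = w \<circ> word ws" for w ws by (simp_all add: word_def)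
  have word_app: "word (xs @ ys) = word xs \<circ> word ys" for xs ys
    by (induction xs) (simp_all add: word_simps comp_assoc)
  define C where "C = word ` lists {t, t', u}"
  have C_id: "id \<in> C" unfolding C_def by (rule image_eqI[of _ _ "[]"]) (auto simp: word_simps)
  have C_gen: "s \<in> C" if "s \<in> {t, t', u}" for s
    unfolding C_def by (rule image_eqI[of _ _ "[s]"]) (use that in \<open>auto simp: word_simps\<close>)
  have C_comp: "f \<circ> g \<in> C" if "f \<in> C" "g \<in> C" for f g
  proof -
    from that obtain xs ys where "f = word xs" "g = word ys" "xs \<in> lists {t, t', u}" "ys \<in> lists {t, t', u}"
      unfolding C_def by blast
    then show ?thesis unfolding C_def by (intro image_eqI[of _ _ "xs @ ys"]) (auto simp: word_app)
  qed
  have C_inv: "\<exists>g\<in>C. g \<circ> word ws = id" if "ws \<in> lists {t, t', u}" for ws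
    using that
  proof (induction ws)
    case Nil show ?case by (rule bexI[OF _ C_id]) (simp add: word_simps)
  next
    case (Cons w ws)
    then obtain g where g: "g \<in> C" "g \<circ> word ws = id" by blast
    obtain w' where w': "w' \<in> C" "w' \<circ> w = id"
    proof -
      consider "w = t" | "w = t'" | "w = u" using Cons.hyps by auto
      then show thesis using that[of t'] that[of t] that[of u] C_gen tt uu by cases auto
    qed
    have "(g \<circ> w') \<circ> word (w # ws) = g \<circ> (w' \<circ> w) \<circ> word ws" by (simp add: word_simps comp_assoc)
    then have "(g \<circ> w') \<circ> word (w # ws) = id" by (simp add: w' g)
    then show ?case using C_comp[OF g(1) w'(1)] by blast
  qed
  have cC: "countable C" unfolding C_def by (intro countable_image countable_lists) auto
  have "t ^^ n \<in> C" for n :: nat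
  proof (induction n)
    case (Suc n)
    have "t \<in> C" by (rule C_gen) simp
    from C_comp[OF this Suc] show ?case by (simp only: funpow.simps)
  qed (simp only: funpow.simps C_id)
  then have "range (\<lambda>n::nat. t ^^ n) \<subseteq> C" by auto
  then have iC: "infinite C" using range_inj_infinite[OF inf] finite_subset by blast
  define e where "e = from_nat_into C"
  define d where "d = to_nat_on C"
  have eC: "e n \<in> C" for n unfolding e_def using C_id by (intro from_nat_into) auto
  have ed: "e (d f) = f" if "f \<in> C" for f unfolding e_def d_def using cC that by simp
  have de: "d (e n) = n" for n unfolding e_def d_def using cC iC by simp
  define G :: "nat monoid" where "G = \<lparr>carrier = UNIV, mult = (\<lambda>a b. d (e a \<circ> e b)), one = d id\<rparr>"
  have e_mult: "e (a \<otimes>\<^bsub>G\<^esub> b) = e a \<circ> e b" for a b by (simp add: G_def ed C_comp eC)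
  have e_one: "e \<one>\<^bsub>G\<^esub> = id" by (simp add: G_def ed C_id)
  have inj: "inj e" by (rule inj_on_inverseI[of _ d]) (simp add: de)
  have "group G"
  proof (rule groupI)
    fix x y z assume "x \<in> carrier G"
    show "(x \<otimes>\<^bsub>G\<^esub> y) \<otimes>\<^bsub>G\<^esub> z = x \<otimes>\<^bsub>G\<^esub> (y \<otimes>\<^bsub>G\<^esub> z)"
      by (rule injD[OF inj]) (simp add: e_mult comp_assoc)
    show "\<one>\<^bsub>G\<^esub> \<otimes>\<^bsub>G\<^esub> x = x" by (rule injD[OF inj]) (simp add: e_mult e_one)
    obtain ws where "e x = word ws" "ws \<in> lists {t, t', u}" using eC[of x] unfolding C_def by blast
    then obtain g where g: "g \<in> C" "g \<circ> e x = id" using C_inv by metis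
    show "\<exists>y\<in>carrier G. y \<otimes>\<^bsub>G\<^esub> x = \<one>\<^bsub>G\<^esub>"
    proof (rule bexI[of _ "d g"])
      show "d g \<otimes>\<^bsub>G\<^esub> x = \<one>\<^bsub>G\<^esub>" by (rule injD[OF inj]) (simp add: e_mult e_one ed g)
    qed (simp add: G_def)
  qed (simp_all add: G_def)
  then have full: "full_group G" by (simp add: full_group_def full_group_axioms_def G_def)
  interpret full_group G by fact
  have inv_t: "d t' = inv\<^bsub>G\<^esub> (d t)"
  proof (rule inv_equality[symmetric])
    show "d t' \<otimes>\<^bsub>G\<^esub> d t = \<one>\<^bsub>G\<^esub>" by (rule injD[OF inj]) (simp add: e_mult e_one ed C_gen tt)
  qed simp_all
  have "d (word ws) \<in> generate G {d t, d u}" if "ws \<in> lists {t, t', u}" for ws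
    using that
  proof (induction ws)
    case Nil
    have "d (word []) = \<one>\<^bsub>G\<^esub>" by (simp add: word_simps G_def)
    then show ?case by (simp add: generate.one)
  next
    case (Cons w ws)
    have "w \<in> C" "word ws \<in> C" using C_gen Cons.hyps by (auto simp: C_def)
    then have "d (word (w # ws)) = d w \<otimes>\<^bsub>G\<^esub> d (word ws)" by (simp add: word_simps G_def ed)
    moreover have "d w \<in> generate G {d t, d u}"
    proof -
      consider "w = t" | "w = t'" | "w = u" using Cons.hyps by auto
      then show ?thesis by cases (auto simp: inv_t intro: generate.incl generate.inv)
    qed
    ultimately show ?case using Cons by (auto intro: generate.eng)
  qed
  then have "a \<in> generate G {d t, d u}" for a
    using eC[of a] de[of a] unfolding C_def by (metis imageE)
  then have "generate G {d t, d u} = UNIV" by blast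
  then show thesis
    using that[of G e "d t" "d u"] full e_mult e_one inj ed C_gen by simp
qed

section \<open>The group\<close>

text \<open>The ball of radius r around the identity in the free product of four groups of order
  two, whose Cayley graph is the four-regular tree.\<close>

definition reduced_words :: "nat \<Rightarrow> nat list set" where
  "reduced_words r = {w. set w \<subseteq> {..<4} \<and> length w \<le> r \<and> distinct_adj w}"

lemma finite_reduced: "finite (reduced_words r)"
  by (rule finite_subset[OF _ finite_lists_length_le[of "{..<4::nat}" r]]) (auto simp: reduced_words_def)

lemma Nil_reduced [simp]: "[] \<in> reduced_words r"
  by (simp add: reduced_words_def)

text \<open>Left multiplication by the i-th generator, cut off at the ball: a word that would leave
  the ball stays fixed, as does everything outside. The map therefore remains an involution.\<close>

definition flip :: "nat \<Rightarrow> nat \<Rightarrow> nat list \<Rightarrow> nat list" where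
  "flip r i w = (if w \<notin> reduced_words r then w
     else if w \<noteq> [] \<and> hd w = i then tl w
     else if length w < r then i # w else w)"

lemma flip_reduced: "i < 4 \<Longrightarrow> flip r i w \<in> reduced_words r \<longleftrightarrow> w \<in> reduced_words r"
  by (cases w) (auto simp: flip_def reduced_words_def distinct_adj_Cons split: if_splits)

lemma flip_flip:
  assumes "i < 4"
  shows "flip r i (flip r i w) = w"
proof (cases "w \<in> reduced_words r")
  case False then show ?thesis by (simp add: flip_def)
next
  case True
  then have fr: "flip r i w \<in> reduced_words r" using assms by (simp add: flip_reduced)
  show ?thesis
  proof (cases w)
    case Nil then show ?thesis using fr True by (auto simp: flip_def)
  next
    case (Cons x xs)
    show ?thesis
    proof (cases "x = i")
      case True': True
      then have f: "flip r i w = xs" using Cons True by (simp add: flip_def)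
      have "xs = [] \<or> hd xs \<noteq> i" "length xs < r"
        using True Cons True' by (auto simp: reduced_words_def distinct_adj_Cons)
      then have "flip r i xs = i # xs" using fr f by (auto simp: flip_def)
      then show ?thesis using f Cons True' by simp
    next
      case False
      then show ?thesis using Cons True fr by (auto simp: flip_def)
    qed
  qed
qed

lemma length_flip_ge: "length w \<le> length (flip r i w) + 1"
  by (simp add: flip_def)

lemma length_flip_other:
  assumes "w \<in> reduced_words r" "w = [] \<or> i \<noteq> hd w"
  shows "min r (length w + 1) \<le> length (flip r i w)"
  using assms by (auto simp: flip_def reduced_words_def)

section \<open>Lamps over the powers of two\<close>

definition pow2 :: "int set" where
  "pow2 = range (\<lambda>p::nat. 2 ^ p)"

text \<open>The exponent p = 4 n + i encodes generator i on the ball of radius \<open>R n\<close>;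
  it is recovered from x by \<open>inv_into\<close>.\<close>

definition lamp_at :: "(nat \<Rightarrow> nat) \<Rightarrow> int \<Rightarrow> nat list \<Rightarrow> nat list" where
  "lamp_at R x w = (if x \<in> pow2 then
     (let p = inv_into UNIV (\<lambda>p::nat. 2 ^ p) x in flip (R (p div 4)) (p mod 4) w) else w)"

lemma lamp_at_pow2: "lamp_at R (2 ^ p) w = flip (R (p div 4)) (p mod 4) w"
proof -
  have "inj (\<lambda>p::nat. (2::int) ^ p)" by (rule injI) simp
  then show ?thesis by (simp add: lamp_at_def pow2_def inv_into_f_f)
qed

lemma lamp_at_other: "x \<notin> pow2 \<Longrightarrow> lamp_at R x w = w"
  by (simp add: lamp_at_def)

lemma lamp_at_lamp_at: "lamp_at R x (lamp_at R x w) = w"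
  by (cases "x \<in> pow2") (auto simp: pow2_def lamp_at_pow2 flip_flip lamp_at_other)

definition shift :: "int \<Rightarrow> int \<times> nat list \<Rightarrow> int \<times> nat list" where
  "shift k p = (fst p + k, snd p)"

text \<open>The conjugate of \<open>lamp R 0\<close> by the j-th shift, see
  \<open>lamp_conj\<close>. For j a power of two it acts on the fibre over 0 as
  \<open>lamp R 0\<close> acts over j.\<close>

definition lamp :: "(nat \<Rightarrow> nat) \<Rightarrow> int \<Rightarrow> int \<times> nat list \<Rightarrow> int \<times> nat list" where
  "lamp R j p = (fst p, lamp_at R (fst p + j) (snd p))"

lemma lamp_lamp: "lamp R j (lamp R j p) = p"
  by (simp add: lamp_def lamp_at_lamp_at)

lemma lamp_conj: "lamp R j p = shift (- j) (lamp R 0 (shift j p))"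
  by (simp add: lamp_def shift_def)

section \<open>Finiteness of the set of products of finitely many lamps\<close>

definition crowded :: "nat \<Rightarrow> int set" where
  "crowded m = {x. \<exists>i<m. \<exists>j<m. i \<noteq> j \<and> x + int i \<in> pow2 \<and> x + int j \<in> pow2}"

text \<open>Of two distinct powers of two the smaller is at most their difference, which is below m
  here. This sparsity keeps the set bounded.\<close>

lemma crowded_subset: "crowded m \<subseteq> {- int m<..<2 * int m}"
proof
  fix x assume "x \<in> crowded m"
  then obtain i j where ij: "i < m" "j < m" "i \<noteq> j" "x + int i \<in> pow2" "x + int j \<in> pow2"
    by (auto simp: crowded_def)
  have *: "x \<in> {- int m<..<2 * int m}" if ij: "i < j" "j < m" "x + int i = 2 ^ a" "x + int j = 2 ^ b"
      for i j a b
  proof -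
    have "(2::int) ^ a < 2 ^ b" using ij by linarith
    then have "a < b" by simp
    then have "(2::int) ^ Suc a \<le> 2 ^ b" by (intro power_increasing) auto
    then have "2 * (2::int) ^ a \<le> 2 ^ b" by simp
    moreover have "(2::int) ^ b - 2 ^ a = int j - int i" using ij by linarith
    moreover have "(2::int) ^ a > 0" by simp
    ultimately have "- int m < x" "x < 2 * int m" using ij by linarith+
    then show ?thesis by simp
  qed
  from ij obtain a b where "x + int i = 2 ^ a" "x + int j = 2 ^ b" by (auto simp: pow2_def)
  then show "x \<in> {- int m<..<2 * int m}" using *[of i j a b] *[of j i b a] ij by (cases "i < j") auto
qed

lemma finite_crowded: "finite (crowded m)"
  using finite_subset[OF crowded_subset] by blast

text \<open>Over a crowded fibre only powers 2^p < 3 m are reached by the first m lamps, and p <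
  2^p; so the balls with p < 3 m contain all words that can be moved.\<close>

definition window :: "(nat \<Rightarrow> nat) \<Rightarrow> nat \<Rightarrow> (int \<times> nat list) set" where
  "window R m = crowded m \<times> (\<Union>p<3 * m. reduced_words (R (p div 4)))"

lemma finite_window: "finite (window R m)"
  by (simp add: window_def finite_crowded finite_reduced)

lemma lamp_window:
  assumes "j < m" "x \<in> crowded m"
  shows "(x, w) \<in> window R m \<Longrightarrow> lamp R (int j) (x, w) \<in> window R m"
    and "(x, w) \<notin> window R m \<Longrightarrow> lamp R (int j) (x, w) = (x, w)"
proof -
  consider p where "x + int j = 2 ^ p" "p < 3 * m" | "x + int j \<notin> pow2"
  proof (cases "x + int j \<in> pow2")
    case True
    then obtain p where p: "x + int j = 2 ^ p" by (auto simp: pow2_def)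
    have "x + int j < 3 * int m" using assms crowded_subset[of m] by auto
    then have "(2::int) ^ p < int (3 * m)" using p by simp
    moreover have "int p < 2 ^ p" using of_nat_less_two_power[of p] by simp
    ultimately have "p < 3 * m" by linarith
    with p that show thesis by blast
  qed (use that in blast)
  then have "((x, w) \<in> window R m \<longrightarrow> lamp R (int j) (x, w) \<in> window R m) \<and>
    ((x, w) \<notin> window R m \<longrightarrow> lamp R (int j) (x, w) = (x, w))"
  proof cases
    case (1 p)
    have "lamp R (int j) (x, w) = (x, flip (R (p div 4)) (p mod 4) w)"
      by (simp add: lamp_def 1 lamp_at_pow2)
    moreover have "flip (R (p div 4)) (p mod 4) w = w" if "w \<notin> reduced_words (R (p div 4))"
      using that by (simp add: flip_def)
    moreover have "flip (R (p div 4)) (p mod 4) w \<in> reduced_words (R (p div 4))"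
        if "w \<in> reduced_words (R (p div 4))"
      using that by (simp add: flip_reduced)
    ultimately show ?thesis using 1(2) assms(2)
        by (cases "w \<in> reduced_words (R (p div 4))") (auto simp: window_def)
  next
    case 2
    then show ?thesis by (simp add: lamp_def lamp_at_other)
  qed
  then show "(x, w) \<in> window R m \<Longrightarrow> lamp R (int j) (x, w) \<in> window R m"
    "(x, w) \<notin> window R m \<Longrightarrow> lamp R (int j) (x, w) = (x, w)" by auto
qed

text \<open>Here \<open>J\<close> records the conjugates of the involution that have been applied an odd number of times.
  Over a fibre that is not crowded at most one of them acts, so \<open>J\<close> determines the permutation there.\<close>

definition switched :: "(nat \<Rightarrow> nat) \<Rightarrow> nat \<Rightarrow> nat set \<Rightarrow> (int \<times> nat list \<Rightarrow> int \<times> nat list) set" where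
  "switched R m J = {f. (\<forall>p. fst (f p) = fst p) \<and>
     (\<forall>x w. x \<in> crowded m \<longrightarrow> (if (x, w) \<in> window R m then f (x, w) \<in> window R m else f (x, w) = (x, w))) \<and>
     (\<forall>x w. x \<notin> crowded m \<longrightarrow>
        (\<forall>j\<in>J. x + int j \<in> pow2 \<longrightarrow> f (x, w) = lamp R (int j) (x, w)) \<and>
        ((\<forall>j\<in>J. x + int j \<notin> pow2) \<longrightarrow> f (x, w) = (x, w)))}"

lemma fst_switched: "f \<in> switched R m J \<Longrightarrow> fst (f p) = fst p"
  by (simp only: switched_def mem_Collect_eq)

text \<open>Off the window a member is determined by \<open>J\<close>, and the window is a finite
  set that it maps into itself.\<close>

lemma finite_switched: "finite (switched R m J)"
proof (rule finite_imageD)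
  show "inj_on (\<lambda>f. restrict f (window R m)) (switched R m J)"
  proof (rule inj_onI, rule ext)
    fix f g and p :: "int \<times> nat list" assume f: "f \<in> switched R m J" and g: "g \<in> switched R m J"
      and eq: "restrict f (window R m) = restrict g (window R m)"
    obtain x w where p: "p = (x, w)" by (cases p)
    show "f p = g p"
    proof (cases "x \<in> crowded m")
      case True
      show ?thesis
      proof (cases "p \<in> window R m")
        case True then show ?thesis using fun_cong[OF eq, of p] by simp
      next
        case False then show ?thesis using f g True p by (auto simp: switched_def)
      qed
    next
      case False
      show ?thesis
      proof (cases "\<forall>j\<in>J. x + int j \<notin> pow2")
        case True
        then have "f p = p" "g p = p" using f g False p unfolding switched_def by auto
        then show ?thesis by simp
      next
        case nT: False
        then obtain j where j: "j \<in> J" "x + int j \<in> pow2" by blast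
        then have "f p = lamp R (int j) p" "g p = lamp R (int j) p"
          using f g False p unfolding switched_def by auto
        then show ?thesis by simp
      qed
    qed
  qed
  have "(\<lambda>f. restrict f (window R m)) ` switched R m J \<subseteq> window R m \<rightarrow>\<^sub>E window R m"
    by (auto simp: switched_def window_def split: if_splits)
  then show "finite ((\<lambda>f. restrict f (window R m)) ` switched R m J)"
    by (rule finite_subset) (intro finite_PiE finite_window)
qed

text \<open>A finite stand-in for the subgroup generated by the first m lamps: it contains
  \<open>id\<close> and is closed under composition with these lamps on the left, hence it contains
  that subgroup.\<close>

definition lamp_configs :: "(nat \<Rightarrow> nat) \<Rightarrow> nat \<Rightarrow> (int \<times> nat list \<Rightarrow> int \<times> nat list) set" where
  "lamp_configs R m = (\<Union>J\<in>Pow {..<m}. switched R m J)"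

lemma finite_lamp_configs: "finite (lamp_configs R m)"
  unfolding lamp_configs_def by (intro finite_UN_I finite_switched) auto

lemma id_lamp_configs: "id \<in> lamp_configs R m"
  unfolding lamp_configs_def by (rule UN_I[of "{}"]) (auto simp: switched_def)

lemma fst_lamp_configs: "f \<in> lamp_configs R m \<Longrightarrow> fst (f p) = fst p"
  by (auto simp: lamp_configs_def fst_switched)

lemma lamp_comp_lamp_configs:
  assumes i: "i < m" and f: "f \<in> lamp_configs R m"
  shows "lamp R (int i) \<circ> f \<in> lamp_configs R m"
proof -
  obtain J where J: "J \<subseteq> {..<m}" "f \<in> switched R m J" using f by (auto simp: lamp_configs_def)
  \<comment> \<open>One more application of lamp i changes the parity of i only.\<close>
  define J' where "J' = (if i \<in> J then J - {i} else insert i J)"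
  have fst_f: "fst (f p) = fst p" for p using J by (simp add: fst_switched)
  have "lamp R (int i) \<circ> f \<in> switched R m J'"
    unfolding switched_def
  proof (intro CollectI conjI allI impI)
    fix p show "fst ((lamp R (int i) \<circ> f) p) = fst p" by (simp add: lamp_def fst_f)
  next
    fix x w assume x: "x \<in> crowded m"
    show "if (x, w) \<in> window R m then (lamp R (int i) \<circ> f) (x, w) \<in> window R m else (lamp R (int i) \<circ> f)
        (x, w) = (x, w)"
    proof (cases "(x, w) \<in> window R m")
      case True
      then have fb: "f (x, w) \<in> window R m" using J(2) x by (simp add: switched_def)
      have "f (x, w) = (x, snd (f (x, w)))" using fst_f[of "(x, w)"] by (metis fst_conv prod.collapse)
      then show ?thesis using lamp_window(1)[OF i x] fb True by (metis comp_apply)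
    next
      case False
      then have "f (x, w) = (x, w)" using J(2) x by (simp add: switched_def)
      then show ?thesis using False lamp_window(2)[OF i x False] by simp
    qed
  next
    fix x w assume x: "x \<notin> crowded m"
    \<comment> \<open>At most one of the first m lamps acts over this fibre, so lamp i either
      commutes trivially with what \<open>f\<close> does there, starts acting, or cancels
      itself.\<close>
    have uniq: "j = j'" if "j < m" "j' < m" "x + int j \<in> pow2" "x + int j' \<in> pow2" for j j'
      using x that by (auto simp: crowded_def)
    have f1: "f (x, w) = lamp R (int j) (x, w)" if "j \<in> J" "x + int j \<in> pow2" for j
      using J(2) x that by (simp add: switched_def)
    have f2: "f (x, w) = (x, w)" if "\<And>j. j \<in> J \<Longrightarrow> x + int j \<notin> pow2"
      using J(2) x that by (simp add: switched_def)
    have off: "lamp R (int i) (x, w') = (x, w')" if "x + int i \<notin> pow2" for w'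
      using that by (simp add: lamp_def lamp_at_other)
    have fx: "f (x, w) = (x, snd (f (x, w)))" using fst_f[of "(x, w)"] by (metis fst_conv prod.collapse)
    show "\<forall>j\<in>J'. x + int j \<in> pow2 \<longrightarrow> (lamp R (int i) \<circ> f) (x, w) = lamp R (int j) (x, w)"
    proof (intro ballI impI)
      fix j assume j: "j \<in> J'" "x + int j \<in> pow2"
      have jm: "j < m" using j J i by (auto simp: J'_def split: if_splits)
      show "(lamp R (int i) \<circ> f) (x, w) = lamp R (int j) (x, w)"
      proof (cases "j = i")
        case True
        then have "i \<notin> J" using j by (auto simp: J'_def split: if_splits)
        then have "f (x, w) = (x, w)" using uniq[OF _ i] j True J by (intro f2) blast
        then show ?thesis using True by simp
      next
        case False
        then have "j \<in> J" using j by (auto simp: J'_def split: if_splits)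
        moreover have "x + int i \<notin> pow2" using uniq[OF jm i] j False by blast
        ultimately show ?thesis using f1[OF _ j(2)] off fx by (metis comp_apply)
      qed
    qed
    show "(lamp R (int i) \<circ> f) (x, w) = (x, w)" if none: "\<forall>j\<in>J'. x + int j \<notin> pow2"
    proof (cases "x + int i \<in> pow2")
      case True
      then have "i \<in> J" using none by (auto simp: J'_def split: if_splits)
      then show ?thesis using f1[OF _ True] by (simp add: lamp_lamp)
    next
      case False
      then have "x + int j \<notin> pow2" if "j \<in> J" for j
        using none that by (cases "j = i") (auto simp: J'_def split: if_splits)
      then have "f (x, w) = (x, w)" by (rule f2)
      then show ?thesis using off[OF False] by simp
    qed
  qed
  moreover have "J' \<in> Pow {..<m}" using J i by (auto simp: J'_def)
  ultimately show ?thesis unfolding lamp_configs_def by blast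
qed

section \<open>Amenability and spectral estimate for the group generated by the shift and the
  lamp\<close>

locale lamp_group = full_group G for G :: "nat monoid" (structure) +
  fixes R :: "nat \<Rightarrow> nat" and e :: "nat \<Rightarrow> int \<times> nat list \<Rightarrow> int \<times> nat list" and \<tau> \<upsilon>
  assumes e_mult: "e (a \<otimes> b) = e a \<circ> e b" and e_one: "e \<one> = id" and inj: "inj e"
    and e\<tau>: "e \<tau> = shift 1" and e\<upsilon>: "e \<upsilon> = lamp R 0" and gen: "generate G {\<tau>, \<upsilon>} = UNIV"
begin

lemma e_inv: "e (inv g) (e g p) = p"
proof -
  have "e (inv g) \<circ> e g = id" by (simp only: e_mult[symmetric] gcancel e_one)
  then show ?thesis by (metis comp_apply id_apply)
qed

lemma e_pow: "e (\<tau> [^] (n::nat)) = shift (int n)"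
  by (induction n) (auto simp: e_one e_mult e\<tau> shift_def fun_eq_iff)

lemma e_pow_inv: "e (inv (\<tau> [^] (n::nat))) = shift (- int n)"
proof
  fix p
  have "p = e (\<tau> [^] n) (shift (- int n) p)" by (simp add: e_pow shift_def)
  then show "e (inv (\<tau> [^] n)) p = shift (- int n) p" by (metis e_inv)
qed

definition lamp_elt :: "nat \<Rightarrow> nat" where
  "lamp_elt j = inv (\<tau> [^] j) \<otimes> (\<upsilon> \<otimes> (\<tau> [^] j))"

lemma e_lamp_elt: "e (lamp_elt j) = lamp R (int j)"
  by (rule ext) (simp add: lamp_elt_def e_mult e_pow e_pow_inv e\<upsilon> lamp_conj[of R "int j"])

lemma lamp_elt_involution: "lamp_elt j \<otimes> lamp_elt j = \<one>"
  by (rule injD[OF inj]) (auto simp: e_mult e_lamp_elt e_one lamp_lamp)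

text \<open>The Folner sets consist of the products of \<tau>^j, j \<le> m, with elements over
  \<open>lamp_configs\<close>. Left multiplication by \<upsilon> preserves them because \<upsilon>
  passes \<tau>^j as \<open>lamp_elt j\<close>; \<tau> pushes out at most the top layer, a fraction
  1/(m + 1).\<close>

lemma amenable_G: "amenable G"
proof (rule Folner_imp_amenable[OF gen])
  define W where "W m = {a. e a \<in> lamp_configs R m}" for m
  define F where "F m = (\<lambda>(j, a). \<tau> [^] j \<otimes> a) ` ({..<Suc m} \<times> W (Suc m))" for m :: nat
  have finW: "finite (W m)" for m
    unfolding W_def using finite_vimageI[OF finite_lamp_configs inj] by (simp add: vimage_def)
  have oneW: "\<one> \<in> W m" for m by (simp add: W_def e_one id_lamp_configs)
  \<comment> \<open>Elements of \<open>W m\<close> preserve all fibres, so the image of (0, [])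
    reveals j.\<close>
  have injF: "inj_on (\<lambda>(j, a). \<tau> [^] (j::nat) \<otimes> a) (UNIV \<times> W m)" for m
  proof (rule inj_onI, clarsimp)
    fix j a k b assume ab: "a \<in> W m" "b \<in> W m" and eq: "\<tau> [^] (j::nat) \<otimes> a = \<tau> [^] (k::nat) \<otimes> b"
    have "e (\<tau> [^] j \<otimes> a) (0, []) = e (\<tau> [^] k \<otimes> b) (0, [])" by (simp add: eq)
    then have "j = k"
      using ab by (simp add: e_mult e_pow shift_def W_def fst_lamp_configs)
    moreover have "inv (\<tau> [^] j) \<otimes> (\<tau> [^] j \<otimes> a) = inv (\<tau> [^] j) \<otimes> (\<tau> [^] k \<otimes> b)"
      by (simp add: eq)
    ultimately show "j = k \<and> a = b" by simp
  qed
  have cardF: "card (F m) = Suc m * card (W (Suc m))" for m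
    unfolding F_def by (subst card_image[OF inj_on_subset[OF injF]]) (auto simp: card_cartesian_product)
  show "finite (F m)" for m unfolding F_def using finW by auto
  show "F m \<noteq> {}" for m unfolding F_def using oneW by auto
  have cW: "card (W m) > 0" for m using oneW finW by (auto simp: card_gt_0_iff)
  fix g assume "g \<in> {\<tau>, \<upsilon>}"
  then consider "g = \<tau>" | "g = \<upsilon>" by blast
  then have bound: "real (card ((\<lambda>x. g \<otimes> x) ` F m - F m)) / real (card (F m)) \<le> 1 / real (Suc m)" for m
  proof cases
    case 1
    have \<tau>S: "\<tau> \<otimes> (\<tau> [^] (j::nat) \<otimes> a) = \<tau> [^] Suc j \<otimes> a" for j a
      by (rule injD[OF inj]) (simp add: e_mult e\<tau> e_pow fun_eq_iff shift_def del: nat_pow_Suc)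
    have "(\<lambda>x. \<tau> \<otimes> x) ` F m - F m \<subseteq> (\<lambda>a. \<tau> [^] Suc m \<otimes> a) ` W (Suc m)"
    proof
      fix y assume y: "y \<in> (\<lambda>x. \<tau> \<otimes> x) ` F m - F m"
      then obtain j a where ja: "j < Suc m" "a \<in> W (Suc m)" "y = \<tau> [^] Suc j \<otimes> a"
        unfolding F_def using \<tau>S by auto
      have "\<not> Suc j < Suc m"
      proof
        assume "Suc j < Suc m"
        then have "y \<in> F m" unfolding F_def using ja by (intro image_eqI[of _ _ "(Suc j, a)"]) auto
        then show False using y by blast
      qed
      then have "j = m" using ja by simp
      then show "y \<in> (\<lambda>a. \<tau> [^] Suc m \<otimes> a) ` W (Suc m)" using ja by blast
    qed
    then have "card ((\<lambda>x. \<tau> \<otimes> x) ` F m - F m) \<le> card (W (Suc m))"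
      using surj_card_le finW by blast
    then have "real (card ((\<lambda>x. \<tau> \<otimes> x) ` F m - F m)) / real (card (F m))
        \<le> real (card (W (Suc m))) / real (card (F m))"
      by (intro divide_right_mono) auto
    also have "\<dots> = 1 / real (Suc m)" using cW[of "Suc m"]
        by (simp add: cardF of_nat_mult del: of_nat_Suc mult_Suc)
    finally show ?thesis using 1 by simp
  next
    case 2
    have \<upsilon>S: "\<upsilon> \<otimes> (\<tau> [^] (j::nat) \<otimes> a) = \<tau> [^] j \<otimes> (lamp_elt j \<otimes> a)" for j a
      by (simp add: lamp_elt_def gassoc)
    have "(\<lambda>x. \<upsilon> \<otimes> x) ` F m \<subseteq> F m"
    proof
      fix y assume "y \<in> (\<lambda>x. \<upsilon> \<otimes> x) ` F m"
      then obtain j a where ja: "j < Suc m" "a \<in> W (Suc m)" "y = \<tau> [^] j \<otimes> (lamp_elt j \<otimes> a)"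
        unfolding F_def using \<upsilon>S by auto
      have "lamp_elt j \<otimes> a \<in> W (Suc m)"
        using ja lamp_comp_lamp_configs[OF ja(1)] by (simp add: W_def e_mult e_lamp_elt)
      then show "y \<in> F m" unfolding F_def using ja by (intro image_eqI[of _ _ "(j, lamp_elt j \<otimes> a)"]) auto
    qed
    then have "(\<lambda>x. \<upsilon> \<otimes> x) ` F m - F m = {}" by blast
    then show ?thesis unfolding 2 by (simp only: card.empty) simp
  qed
  show "(\<lambda>m. real (card ((\<lambda>x. g \<otimes> x) ` F m - F m)) / real (card (F m))) \<longlonglongrightarrow> 0"
    by (rule squeeze_zero[OF _ bound one_div_Suc_tendsto_0]) simp
qed

text \<open>One constant c serves all n: the conjugates used for n have word length of order 2^(4n),
  whose square is accounted for in the bound on \<eta>, while the radius \<open>R n\<close> enters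
  only through the admissible m.\<close>

lemma spectral_distribution_small:
  assumes S: "finite S" "S \<noteq> {}" "symmetric_generating_set G S"
  shows "\<exists>c>0. \<forall>n m \<eta> l. 2 * m + 1 \<le> R n \<longrightarrow> \<eta> \<le> c / (2 ^ (4 * n + 4))\<^sup>2 \<longrightarrow> l \<le> \<eta> \<longrightarrow>
    spectral_distribution G (pmf_of_set S) l \<le> (1 - \<eta> / 2) ^ (2 * m + 1)"
proof -
  have Sinv: "\<And>s. s \<in> S \<Longrightarrow> inv s \<in> S" and Sgen: "generate G S = UNIV"
    using S(3) by (auto simp: symmetric_generating_set_def)
  obtain c1 c2 where c: "displaced S \<tau> c1" "displaced S \<upsilon> c2"
    using displaced_generate[OF S(1,2)] Sgen by blast
  define K where "K = max 1 (max c1 c2)"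
  have K: "K \<ge> 1" "displaced S \<tau> K" "displaced S \<upsilon> K"
    using displaced_mono[OF S(1,2) c(1), of K] displaced_mono[OF S(1,2) c(2), of K] by (auto simp: K_def)
  have cS: "real (card S) > 0" using S by (simp add: card_gt_0_iff)
  \<comment> \<open>Equal to (2^(4n+4))^2 / (16 \<open>C\<^sup>2\<close> |S|) for the displacement
    bound C = K 2^(4n+5) used below.\<close>
  define c where "c = 1 / (64 * K\<^sup>2 * real (card S))"
  have "c > 0" using K cS by (auto simp: c_def intro!: divide_pos_pos mult_pos_pos)
  moreover have "spectral_distribution G (pmf_of_set S) l \<le> (1 - \<eta> / 2) ^ (2 * m + 1)"
    if R: "2 * m + 1 \<le> R n" and \<eta>: "\<eta> \<le> c / (2 ^ (4 * n + 4))\<^sup>2" and l: "l \<le> \<eta>" for n m \<eta> l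
  proof -
    define a where "a i = lamp_elt (2 ^ (4 * n + i))" for i
    define C where "C = K * 2 ^ (4 * n + 5)"
    \<comment> \<open>Points outside the ball over 0 get a height above \<open>R n\<close>. The four
      involutions preserve the ball and its complement, so the height never jumps.\<close>
    define hgt where "hgt p = (if fst p = 0 \<and> snd p \<in> reduced_words (R n) then length (snd p) else R n + 1)"
      for p :: "int \<times> nat list"
    \<comment> \<open>The inverse turns right multiplication by \<open>a i\<close> into the action
      of the lamp on the point reached.\<close>
    define ht where "ht g = hgt (e (inv g) (0, []))" for g
    have inva: "inv (a i) = a i" for i
      using lamp_elt_involution by (intro inv_equality) (simp_all add: a_def)
    have ht_a: "ht (g \<otimes> a i) = hgt (lamp R (2 ^ (4 * n + i)) (e (inv g) (0, [])))" for g i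
      unfolding ht_def ginv_mult inva by (simp add: e_mult a_def e_lamp_elt)
    have act: "lamp R (2 ^ (4 * n + i)) (0, w) = (0, flip (R n) i w)" if "i < 4" for i w
      using that by (simp add: lamp_def lamp_at_pow2 del: power_add)
    show ?thesis
    proof (rule spectral_distribution_bound[OF S(1,2) Sinv, of a C ht "R n" m \<eta> l])
      show "a i \<otimes> a i = \<one>" for i by (simp add: a_def lamp_elt_involution)
      show "displaced S (a i) C" if "i < 4" for i
      proof (rule displaced_mono[OF S(1,2)])
        let ?j = "2 ^ (4 * n + i) :: nat"
        show "displaced S (a i) (real ?j * K + (K + real ?j * K))"
          unfolding a_def lamp_elt_def by (intro displaced_mult displaced_inv displaced_pow K)
        have "(2::real) ^ (4 * n + i) \<le> 2 ^ (4 * n + 3)" using that by (intro power_increasing) auto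
        moreover have "(1::real) \<le> 2 ^ (4 * n + 3)" by simp
        ultimately have "(2::real) ^ (4 * n + i) + (1 + 2 ^ (4 * n + i)) \<le> 3 * 2 ^ (4 * n + 3)" by linarith
        also have "\<dots> \<le> 2 ^ (4 * n + 5)" by (simp add: power_add)
        finally have "K * ((2::real) ^ (4 * n + i) + (1 + 2 ^ (4 * n + i))) \<le> K * 2 ^ (4 * n + 5)"
          using K by (intro mult_left_mono) auto
        then show "real ?j * K + (K + real ?j * K) \<le> C"
          by (simp add: C_def distrib_left mult.commute)
      qed
      show "1 \<le> C" unfolding C_def using K mult_mono[of 1 K 1 "2 ^ (4 * n + 5)"] by simp
      show "ht \<one> = 0" by (simp add: ht_def e_one hgt_def)
      show "2 * m + 1 \<le> R n" by fact
      show "l \<le> \<eta>" by fact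
      show "\<eta> \<le> 1 / (16 * C\<^sup>2 * real (card S))"
      proof -
        have "C\<^sup>2 = 4 * (K\<^sup>2 * (2 ^ (4 * n + 4))\<^sup>2)"
          by (simp add: C_def power_mult_distrib power_add)
        then have "c / (2 ^ (4 * n + 4))\<^sup>2 = 1 / (16 * C\<^sup>2 * real (card S))"
          by (simp add: c_def mult.assoc mult.commute mult.left_commute)
        then show ?thesis using \<eta> by simp
      qed
      show "\<exists>j. \<forall>i<4. i \<noteq> j \<longrightarrow> min (R n) (ht g + 1) \<le> ht (g \<otimes> a i)" if htg: "ht g \<le> R n" for g
      proof -
        obtain w where w: "e (inv g) (0, []) = (0, w)" "w \<in> reduced_words (R n)"
          using htg by (cases "e (inv g) (0, [])") (auto simp: ht_def hgt_def split: if_splits)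
        have "min (R n) (ht g + 1) \<le> ht (g \<otimes> a i)" if i: "i < 4" "w = [] \<or> i \<noteq> hd w" for i
          using length_flip_other[OF w(2) i(2)] w flip_reduced[OF i(1), of "R n" w] act[OF i(1), of w]
          unfolding ht_a by (simp add: ht_def hgt_def)
        \<comment> \<open>Only the first letter of w can shorten it. For the empty word the witness
          4 lies outside the index range, so all four neighbours are covered.\<close>
        then show ?thesis by (intro exI[of _ "if w = [] then 4 else hd w"]) auto
      qed
      show "ht g \<le> ht (g \<otimes> a i) + 1" if i: "i < 4" for g i
      proof -
        obtain x w where xw: "e (inv g) (0, []) = (x, w)" by (cases "e (inv g) (0, [])")
        show ?thesis
        proof (cases "x = 0")
          case True
          then show ?thesis
            using xw flip_reduced[OF i, of "R n" w] act[OF i, of w] length_flip_ge[of w "R n" i]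
            unfolding ht_a by (auto simp: ht_def hgt_def)
        next
          case False
          then show ?thesis unfolding ht_a using xw by (simp add: ht_def hgt_def lamp_def)
        qed
      qed
    qed
  qed
  ultimately show ?thesis by blast
qed

end

theorem group_with_small_spectral_distribution:
  fixes R :: "nat \<Rightarrow> nat"
  obtains \<Gamma> :: "nat monoid" where "group \<Gamma>" "finitely_generated \<Gamma>" "amenable \<Gamma>"
    "\<And>S. finite S \<Longrightarrow> S \<noteq> {} \<Longrightarrow> symmetric_generating_set \<Gamma> S \<Longrightarrow>
      \<exists>c>0. \<forall>n m \<eta> l. 2 * m + 1 \<le> R n \<longrightarrow> \<eta> \<le> c / (2 ^ (4 * n + 4))\<^sup>2 \<longrightarrow> l \<le> \<eta> \<longrightarrow>
        spectral_distribution \<Gamma> (pmf_of_set S) l \<le> (1 - \<eta> / 2) ^ (2 * m + 1)"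
proof -
  have tt: "shift 1 \<circ> shift (- 1) = id" "shift (- 1) \<circ> shift 1 = id"
    by (auto simp: shift_def fun_eq_iff)
  have uu: "lamp R 0 \<circ> lamp R 0 = id" by (rule ext) (simp add: lamp_lamp)
  have tn: "shift 1 ^^ n = shift (int n)" for n
    by (induction n) (auto simp: shift_def fun_eq_iff)
  have "inj (\<lambda>n::nat. shift 1 ^^ n)"
  proof (rule injI)
    fix a b :: nat assume "shift 1 ^^ a = shift 1 ^^ b"
    then have "shift (int a) (0, []) = shift (int b) (0, [])" by (simp add: tn)
    then show "a = b" by (simp add: shift_def)
  qed
  from countable_permutation_group[OF tt uu this] obtain G :: "nat monoid" and e \<tau> \<upsilon> where
    "full_group G" "\<And>a b. e (a \<otimes>\<^bsub>G\<^esub> b) = e a \<circ> e b" "e \<one>\<^bsub>G\<^esub> = id"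
    "inj e" "e \<tau> = shift 1" "e \<upsilon> = lamp R 0" "generate G {\<tau>, \<upsilon>} = UNIV"
    by metis
  then interpret lamp_group G R e \<tau> \<upsilon> by (simp add: lamp_group_def lamp_group_axioms_def)
  have "finitely_generated G"
    unfolding finitely_generated_def by (rule exI[of _ "{\<tau>, \<upsilon>}"]) (simp add: gen)
  then show thesis by (rule that[OF is_group _ amenable_G spectral_distribution_small])
qed

section \<open>Choice of the radii for a given function\<close>

theorem corollary1p9:
  fixes f :: "real \<Rightarrow> real" and x0 :: real
  assumes "\<And>x. x > x0 \<Longrightarrow> f x > 0"
    and "\<And>K. compact K \<Longrightarrow> K \<subseteq> {x0<..} \<Longrightarrow> bounded (f ` K)"
  shows "\<exists>\<Gamma> :: nat monoid.
    group \<Gamma> \<and> finitely_generated \<Gamma> \<and> amenable \<Gamma> \<and>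
    (\<forall>S. finite S \<longrightarrow> S \<noteq> {} \<longrightarrow> symmetric_generating_set \<Gamma> S \<longrightarrow>
       preceq_near_zero (spectral_distribution \<Gamma> (pmf_of_set S))
         (\<lambda>l. if l = 0 then 0 else 1 / f (inverse l)))"
proof -
  \<comment> \<open>The group has to be fixed before \<open>S\<close>, hence before the constant c
    of \<open>S\<close> is known. The extra factor 1/(n + 1) falls below any such c for large
    n.\<close>
  define \<eta> :: "nat \<Rightarrow> real" where "\<eta> n = 1 / (real (Suc n) * (2 ^ (4 * n + 4))\<^sup>2)" for n
  have \<eta>_pos: "\<eta> n > 0" for n by (simp add: \<eta>_def)
  have \<eta>_le: "\<eta> n \<le> 1 / real (Suc n)" for n
  proof -
    have "real (Suc n) * 1 \<le> real (Suc n) * (2 ^ (4 * n + 4))\<^sup>2"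
      by (intro mult_left_mono) (auto simp: one_le_power)
    then show ?thesis unfolding \<eta>_def by (intro divide_left_mono) auto
  qed
  have \<eta>_lim: "\<eta> \<longlonglongrightarrow> 0"
    by (rule squeeze_zero[OF _ \<eta>_le one_div_Suc_tendsto_0]) (use \<eta>_pos in \<open>simp add: less_imp_le\<close>)
  \<comment> \<open>The compact intervals from 1/\<eta> n to 1/\<eta> (n + 1) lie in the domain of f
    once 1/\<eta> n > x0; for other n the bound is void.\<close>
  have "\<exists>B\<ge>1. \<forall>x. 1 / \<eta> n > x0 \<longrightarrow> x \<in> {1 / \<eta> n..1 / \<eta> (Suc n)} \<longrightarrow> f x \<le> B" for n
  proof (cases "1 / \<eta> n > x0")
    case True
    then have "bounded (f ` {1 / \<eta> n..1 / \<eta> (Suc n)})" by (intro assms(2)) auto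
    then obtain B where "\<forall>y\<in>f ` {1 / \<eta> n..1 / \<eta> (Suc n)}. norm y \<le> B" using bounded_iff by blast
    then have "f x \<le> B" if "x \<in> {1 / \<eta> n..1 / \<eta> (Suc n)}" for x using that by (force simp: abs_le_iff)
    then show ?thesis by (intro exI[of _ "max 1 B"]) (auto simp: le_max_iff_disj)
  qed auto
  then obtain B where B1: "\<And>n. B n \<ge> 1"
    and B: "\<And>n x. 1 / \<eta> n > x0 \<Longrightarrow> x \<in> {1 / \<eta> n..1 / \<eta> (Suc n)} \<Longrightarrow> f x \<le> B n" by metis
  \<comment> \<open>The radius 2 k + 1 is taken large enough to beat the bound on f; the factor n +
    1 forces N(0) = 0 below.\<close>
  have "\<exists>k. (1 - \<eta> n / 2) ^ (2 * k + 1) \<le> 1 / (B n * real (Suc n))" for n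
  proof -
    have "\<eta> n \<le> 1" using \<eta>_le[of n] by (rule order_trans) simp
    then have u: "0 \<le> 1 - \<eta> n / 2" "1 - \<eta> n / 2 < 1" using \<eta>_pos[of n] by auto
    have "0 < 1 / (B n * real (Suc n))" using B1[of n] by simp
    then obtain k where k: "(1 - \<eta> n / 2) ^ k < 1 / (B n * real (Suc n))"
      using real_arch_pow_inv[OF _ u(2)] by blast
    have "(1 - \<eta> n / 2) ^ (2 * k + 1) \<le> (1 - \<eta> n / 2) ^ k" using u by (intro power_decreasing) auto
    with k show ?thesis by (intro exI[of _ k]) linarith
  qed
  then obtain k where k: "\<And>n. (1 - \<eta> n / 2) ^ (2 * k n + 1) \<le> 1 / (B n * real (Suc n))" by metis
  obtain \<Gamma> :: "nat monoid" where \<Gamma>: "group \<Gamma>" "finitely_generated \<Gamma>" "amenable \<Gamma>"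
    and small: "\<And>S. finite S \<Longrightarrow> S \<noteq> {} \<Longrightarrow> symmetric_generating_set \<Gamma> S \<Longrightarrow>
      \<exists>c>0. \<forall>n m \<eta> l. 2 * m + 1 \<le> 2 * k n + 1 \<longrightarrow> \<eta> \<le> c / (2 ^ (4 * n + 4))\<^sup>2 \<longrightarrow> l \<le> \<eta> \<longrightarrow>
        spectral_distribution \<Gamma> (pmf_of_set S) l \<le> (1 - \<eta> / 2) ^ (2 * m + 1)"
    using group_with_small_spectral_distribution[of "\<lambda>n. 2 * k n + 1"] by metis
  have "preceq_near_zero (spectral_distribution \<Gamma> (pmf_of_set S))
      (\<lambda>l. if l = 0 then 0 else 1 / f (inverse l))"
    if S: "finite S" "S \<noteq> {}" "symmetric_generating_set \<Gamma> S" for S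
  proof -
    let ?N = "spectral_distribution \<Gamma> (pmf_of_set S)"
    obtain c where c: "c > 0" and N: "\<And>n m \<eta> l. 2 * m + 1 \<le> 2 * k n + 1 \<Longrightarrow> \<eta> \<le> c / (2 ^ (4 * n + 4))\<^sup>2 \<Longrightarrow> l
        \<le> \<eta> \<Longrightarrow>
        ?N l \<le> (1 - \<eta> / 2) ^ (2 * m + 1)"
      using small[OF S] by blast
    \<comment> \<open>From n0 on \<eta> n is admissible for the constant c of \<open>S\<close>, and
      from n2 on 1/\<eta> n lies in the domain of f.\<close>
    obtain n0 where n0: "1 / real (Suc n0) < c" using nat_approx_posE[OF c] by blast
    obtain n2 where n2: "x0 < real n2" using reals_Archimedean2 by blast
    define n1 where "n1 = max n0 n2"
    have Nle: "?N l \<le> 1 / (B n * real (Suc n))" if n: "n \<ge> n1" and l: "l \<le> \<eta> n" for n l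
    proof -
      have "1 / real (Suc n) \<le> 1 / real (Suc n0)" using n by (intro divide_left_mono) (auto simp: n1_def)
      then have "1 / real (Suc n) \<le> c" using n0 by linarith
      then have "1 / real (Suc n) / (2 ^ (4 * n + 4))\<^sup>2 \<le> c / (2 ^ (4 * n + 4))\<^sup>2"
          by (intro divide_right_mono) auto
      then have "\<eta> n \<le> c / (2 ^ (4 * n + 4))\<^sup>2" by (simp add: \<eta>_def)
      from N[OF order_refl this l] k[of n] show ?thesis by linarith
    qed
    have x0: "x0 < 1 / \<eta> n" if "n \<ge> n1" for n
    proof -
      have "real (Suc n) \<le> 1 / \<eta> n" using \<eta>_le[of n] \<eta>_pos[of n] by (simp add: field_simps del: of_nat_Suc)
      moreover have "x0 < real (Suc n)" using n2 that by (auto simp: n1_def)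
      ultimately show ?thesis by linarith
    qed
    have "?N l \<le> 1 * (if 1 * l = 0 then 0 else 1 / f (inverse (1 * l)))" if l: "l \<in> {0..<\<eta> n1}" for l
    proof (cases "l = 0")
      case True
      \<comment> \<open>The comparison function has the value 0 at 0, so N must have no mass there;
        l = 0 lies below every \<eta> n.\<close>
      have "?N 0 \<le> 1 / real (Suc n)" if "n \<ge> n1" for n
      proof -
        have "?N 0 \<le> 1 / (B n * real (Suc n))" using Nle[OF that, of 0] \<eta>_pos[of n] by simp
        also have "\<dots> \<le> 1 / (1 * real (Suc n))"
          using B1[of n] by (intro divide_left_mono mult_right_mono) auto
        finally show ?thesis by simp
      qed
      then have "?N 0 \<le> 0" by (intro LIMSEQ_le_const[OF one_div_Suc_tendsto_0]) auto
      then show ?thesis using True by simp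
    next
      case False
      then have lpos: "l > 0" using l by simp
      have "\<exists>n. n1 \<le> n \<and> \<eta> (Suc n) \<le> l"
      proof -
        have "\<forall>\<^sub>F n in sequentially. \<eta> n < l" by (rule order_tendstoD(2)[OF \<eta>_lim lpos])
        then obtain M where M: "\<And>n. n \<ge> M \<Longrightarrow> \<eta> n < l" by (auto simp: eventually_sequentially)
        have "\<eta> (Suc (max n1 M)) < l" by (rule M) simp
        then show ?thesis by (intro exI[of _ "max n1 M"]) simp
      qed
      \<comment> \<open>Minimality places l between \<eta> (n + 1) and \<eta> n; if n = n1 the upper
        bound is the assumption l < \<eta> n1.\<close>
      define n where "n = (LEAST n. n1 \<le> n \<and> \<eta> (Suc n) \<le> l)"
      have n: "n1 \<le> n" "\<eta> (Suc n) \<le> l"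
        using LeastI_ex[OF \<open>\<exists>n. n1 \<le> n \<and> \<eta> (Suc n) \<le> l\<close>] by (auto simp: n_def)
      have ln: "l \<le> \<eta> n"
      proof (cases "n = n1")
        case True then show ?thesis using l by simp
      next
        case False
        then obtain n' where n': "n = Suc n'" "n1 \<le> n'" using n(1)
            by (metis Suc_leI le_neq_implies_less not0_implies_Suc Suc_le_mono not_less_eq_eq le_0_eq)
        then have "\<not> (n1 \<le> n' \<and> \<eta> (Suc n') \<le> l)"
          using not_less_Least[of n' "\<lambda>n. n1 \<le> n \<and> \<eta> (Suc n) \<le> l"] by (simp add: n_def[symmetric])
        then show ?thesis using n' by simp
      qed
      have "1 / l \<in> {1 / \<eta> n..1 / \<eta> (Suc n)}"
        using n ln lpos \<eta>_pos by (auto intro!: divide_left_mono)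
      then have fB: "f (1 / l) \<le> B n" using B x0[OF n(1)] by blast
      have "x0 < 1 / l" using x0[OF n(1)] ln lpos divide_left_mono[of l "\<eta> n" 1] \<eta>_pos[of n] by auto
      then have fpos: "f (1 / l) > 0" by (rule assms(1))
      have "?N l \<le> 1 / (B n * real (Suc n))" by (rule Nle[OF n(1) ln])
      also have "\<dots> \<le> 1 / (B n * 1)" using B1[of n] by (intro divide_left_mono mult_left_mono) auto
      also have "\<dots> \<le> 1 / f (1 / l)" using fB fpos B1[of n] by (intro divide_left_mono) auto
      finally show ?thesis using False by (simp add: inverse_eq_divide)
    qed
    then show ?thesis unfolding preceq_near_zero_def
      using \<eta>_pos[of n1] by (intro exI[of _ 1] exI[of _ "\<eta> n1"]) auto
  qed
  then show ?thesis using \<Gamma> by blast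
qed

end
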